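(* Let $G=(A\uplus B,E)$ be a finite simple planar bipartite graph. Then a generic $(2,2)$-embedding of $G$ is $(2,2)$-stress free. If moreover $G$ is a maximal planar bipartite graph, then a generic $(2,2)$-embedding of $G$ is also $(2,2)$-rigid.
   Context: A bipartite graph $G=(A\uplus B,E)$ comes with a fixed bipartition into sides $A$ and $B$. A $(k,l)$-embedding of $G$ is a map $\phi:A\uplus B\to\mathbb{R}^k\times\mathbb{R}^l$ with $\phi(a)\in\mathbb{R}^k\times(0)$ for $a\in A$ and $\phi(b)\in(0)\times\mathbb{R}^l$ for $b\in B$; it is generic if all its coordinates (in the nonzero blocks) are algebraically independent over $\mathbb{Q}$. The embedding $\phi$ is $(k,l)$-stress free if there are no weights $w_{ab}\in\mathbb{R}$, $ab\in E$, not all zero, such that $\sum_{v:\,uv\in E}w_{uv}\phi(v)=0$ for every vertex $u$. The embedding $\phi$ is $(k,l)$-rigid if every assignment of vectors $V(a)\in(0)\times\mathbb{R}^l$ ($a\in A$) and $V(b)\in\mathbb{R}^k\times(0)$ ($b\in B$) satisfying $\langle V(a),\phi(b)\rangle+\langle V(b),\phi(a)\rangle=0$ for all $ab\in E$ satisfies this equation for all $(a,b)\in A\times B$. A planar bipartite graph is maximal if adding any new edge between two of its existing vertices yields a graph that is non-planar or non-bipartite. *)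

theory Defs
  imports "HOL-Analysis.Analysis" "HOL-Library.Poly_Mapping"
begin

section \<open>Graphs\<close>

definition simple_graph :: "'v set \<Rightarrow> 'v set set \<Rightarrow> bool" where
  "simple_graph V E \<longleftrightarrow> finite V \<and> (\<forall>e\<in>E. e \<subseteq> V \<and> card e = 2)"

definition bipartition :: "'v set \<Rightarrow> 'v set set \<Rightarrow> 'v set \<Rightarrow> 'v set \<Rightarrow> bool" where
  "bipartition V E A B \<longleftrightarrow>
     V = A \<union> B \<and> A \<inter> B = {} \<and> (\<forall>e\<in>E. \<exists>a\<in>A. \<exists>b\<in>B. e = {a, b})"

definition bipartite :: "'v set \<Rightarrow> 'v set set \<Rightarrow> bool" where
  "bipartite V E \<longleftrightarrow> (\<exists>A B. bipartition V E A B)"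

text \<open>A drawing in the plane (modelled by the complex numbers): \<open>p\<close> places the vertices and
  \<open>\<gamma> e\<close> is a simple arc joining the two ends of the edge \<open>e\<close>.  An arc passes through no vertices
  other than its ends, and two arcs meet at most in the images of common ends.\<close>

definition plane_drawing ::
    "'v set \<Rightarrow> 'v set set \<Rightarrow> ('v \<Rightarrow> complex) \<Rightarrow> ('v set \<Rightarrow> real \<Rightarrow> complex) \<Rightarrow> bool" where
  "plane_drawing V E p \<gamma> \<longleftrightarrow>
     inj_on p V \<and>
     (\<forall>e\<in>E. arc (\<gamma> e) \<and> {pathstart (\<gamma> e), pathfinish (\<gamma> e)} = p ` e \<and>
             path_image (\<gamma> e) \<inter> p ` V = p ` e) \<and>
     (\<forall>e\<in>E. \<forall>f\<in>E. e \<noteq> f \<longrightarrow> path_image (\<gamma> e) \<inter> path_image (\<gamma> f) \<subseteq> p ` (e \<inter> f))"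

definition planar :: "'v set \<Rightarrow> 'v set set \<Rightarrow> bool" where
  "planar V E \<longleftrightarrow> (\<exists>p \<gamma>. plane_drawing V E p \<gamma>)"

text \<open>Whether the enlarged graph is bipartite is judged with respect to arbitrary bipartitions, so
  for a disconnected graph the new edge may also join two vertices of the same side of a given
  bipartition.\<close>

definition maximal_planar_bipartite :: "'v set \<Rightarrow> 'v set set \<Rightarrow> bool" where
  "maximal_planar_bipartite V E \<longleftrightarrow>
     planar V E \<and> bipartite V E \<and>
     (\<forall>u\<in>V. \<forall>v\<in>V. u \<noteq> v \<and> {u, v} \<notin> E \<longrightarrow>
        \<not> planar V (insert {u, v} E) \<or> \<not> bipartite V (insert {u, v} E))"

section \<open>Algebraic independence\<close>

text \<open>Polynomials over the rationals in variables indexed by \<open>'i\<close> are finitely supported maps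
  from monomials (finitely supported exponent vectors) to coefficients.\<close>

definition eval_rat_poly :: "('i \<Rightarrow> real) \<Rightarrow> (('i \<Rightarrow>\<^sub>0 nat) \<Rightarrow>\<^sub>0 rat) \<Rightarrow> real" where
  "eval_rat_poly x P =
     (\<Sum>m\<in>Poly_Mapping.keys P. of_rat (Poly_Mapping.lookup P m) *
        (\<Prod>i\<in>Poly_Mapping.keys m. x i ^ Poly_Mapping.lookup m i))"

definition algebraically_independent_rat :: "'i set \<Rightarrow> ('i \<Rightarrow> real) \<Rightarrow> bool" where
  "algebraically_independent_rat I x \<longleftrightarrow>
     (\<forall>P :: ('i \<Rightarrow>\<^sub>0 nat) \<Rightarrow>\<^sub>0 rat.
        (\<forall>m\<in>Poly_Mapping.keys P. Poly_Mapping.keys m \<subseteq> I) \<and> eval_rat_poly x P = 0 \<longrightarrow> P = 0)"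

section \<open>Bipartite embeddings, stresses and rigidity\<close>

text \<open>The dimensions \<open>k\<close> and \<open>l\<close> are the cardinalities of the index types \<open>'k\<close> and \<open>'l\<close>.\<close>

definition bipartite_embedding ::
    "'v set \<Rightarrow> 'v set \<Rightarrow> ('v \<Rightarrow> (real^'k) \<times> (real^'l)) \<Rightarrow> bool" where
  "bipartite_embedding A B \<phi> \<longleftrightarrow>
     (\<forall>a\<in>A. \<phi> a \<in> UNIV \<times> {0}) \<and> (\<forall>b\<in>B. \<phi> b \<in> {0} \<times> UNIV)"

fun coordinate :: "('v \<Rightarrow> (real^'k) \<times> (real^'l)) \<Rightarrow> 'v \<times> ('k + 'l) \<Rightarrow> real" where
  "coordinate \<phi> (v, Inl i) = fst (\<phi> v) $ i"
| "coordinate \<phi> (v, Inr j) = snd (\<phi> v) $ j"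

definition generic_embedding ::
    "'v set \<Rightarrow> 'v set \<Rightarrow> ('v \<Rightarrow> (real^'k) \<times> (real^'l)) \<Rightarrow> bool" where
  "generic_embedding A B \<phi> \<longleftrightarrow>
     bipartite_embedding A B \<phi> \<and>
     algebraically_independent_rat (A \<times> range Inl \<union> B \<times> range Inr) (coordinate \<phi>)"

definition stress_free ::
    "'v set \<Rightarrow> 'v set set \<Rightarrow> ('v \<Rightarrow> (real^'k) \<times> (real^'l)) \<Rightarrow> bool" where
  "stress_free V E \<phi> \<longleftrightarrow>
     \<not> (\<exists>w :: 'v set \<Rightarrow> real.
          (\<exists>e\<in>E. w e \<noteq> 0) \<and>
          (\<forall>u\<in>V. (\<Sum>v\<in>{v. {u, v} \<in> E}. w {u, v} *\<^sub>R \<phi> v) = 0))"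

definition bipartite_rigid ::
    "'v set \<Rightarrow> 'v set \<Rightarrow> 'v set set \<Rightarrow> ('v \<Rightarrow> (real^'k) \<times> (real^'l)) \<Rightarrow> bool" where
  "bipartite_rigid A B E \<phi> \<longleftrightarrow>
     (\<forall>U :: 'v \<Rightarrow> (real^'k) \<times> (real^'l).
        (\<forall>a\<in>A. U a \<in> {0} \<times> UNIV) \<and> (\<forall>b\<in>B. U b \<in> UNIV \<times> {0}) \<and>
        (\<forall>a\<in>A. \<forall>b\<in>B. {a, b} \<in> E \<longrightarrow> U a \<bullet> \<phi> b + U b \<bullet> \<phi> a = 0) \<longrightarrow>
        (\<forall>a\<in>A. \<forall>b\<in>B. U a \<bullet> \<phi> b + U b \<bullet> \<phi> a = 0))"

end

theory Submission
  imports Defs "HOL-Complex_Analysis.Riemann_Mapping" "HOL-Computational_Algebra.Polynomial"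
begin

text \<open>Independence of the edge rows at one embedding implies independence at every generic one, so
  for stress freeness it suffices to find a single stress free position.  If two vertices \<open>u\<close>, \<open>v\<close> of
  the same side have at most two common neighbours, a stress free position of the graph with \<open>u\<close> and
  \<open>v\<close> identified yields one of the original graph by placing \<open>v\<close> at the position of \<open>u\<close>.  If both lie
  on edges of one face, they can be joined by an arc inside that face; collapsing the arc (the
  complement of an arc is mapped onto a punctured plane by the Riemann mapping theorem) shows that
  the identified graph is again planar.  Such a pair exists unless the graph is a star: otherwise
  all cofacial vertices of one side have three common neighbours, and an innermost 4-cycle either
  contains a smaller one or bounds a face whose two diagonals would have to cross outside of it.

  In a maximal graph every face is bounded by a 4-cycle and every edge lies on two faces, so that
  Euler's formula gives \<open>2 n - 4\<close> edges.  A nontrivial infinitesimal motion would make one more row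
  independent, but the rows satisfy four linear relations and hence span at most \<open>2 n - 4\<close>
  dimensions.\<close>

section \<open>Collapsing an arc of the plane\<close>

text \<open>Faces enter only as components of the complement, and an edge counts as lying on a face
  if the closure of the face meets the interior of the edge. No boundary walks are formed; the
  arguments rest on theta curves and Janiszewski's theorem. The bound of two common neighbours is
  the dimension: with \<open>v\<close> placed on \<open>u\<close>, a stress survives only on the
  edges to common neighbours, with opposite weights at \<open>u\<close> and \<open>v\<close>.
  Balance at \<open>u\<close> is then a linear relation between at most two vectors of R^2, which
  can be taken independent. This and the independence inherited from the smaller graph are both
  nonvanishing conditions on polynomials, so one position meets both. For the count of the m edges,
  2 m is at most the number of incidences of edges and faces, and this at most four times the number
  f of faces. So the direction f + n <= m + 2 of Euler's formula yields m >= 2 n - 4. The four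
  linear relations are the entries of a 2 x 2 matrix: moving one side by a matrix and the other side
  by its negative transpose solves the motion equation for every pair.\<close>

lemma arc_interior_empty:
  fixes g :: "real \<Rightarrow> complex"
  assumes "arc g"
  shows "interior (path_image g) = {}"
proof (rule ccontr)
  assume ne: "interior (path_image g) \<noteq> {}"
  have cont: "continuous_on {0..1} g" and inj: "inj_on g {0..1}"
    using assms by (auto simp: arc_def path_def)
  have "continuous_on (g ` {0..1}) (the_inv_into {0..1} g)"
    by (rule continuous_on_inv_into [OF cont compact_Icc inj])
  then have "continuous_on (interior (path_image g)) (the_inv_into {0..1} g)"
    by (rule continuous_on_subset) (use interior_subset[of "path_image g"] in \<open>simp add: path_image_def\<close>)
  moreover have "inj_on (the_inv_into {0..1} g) (interior (path_image g))"
    by (rule inj_on_subset[OF inj_on_the_inv_into[OF inj]])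
      (use interior_subset[of "path_image g"] in \<open>simp add: path_image_def\<close>)
  ultimately have "DIM(complex) \<le> DIM(real)"
    using invariance_of_dimension [of "interior (path_image g)" "the_inv_into {0..1} g"] ne by auto
  then show False by simp
qed

text \<open>The inversion about the start of the arc sends that point to infinity, so the rest of
  the arc becomes a closed, connected and unbounded set \<open>L\<close>. An open connected set
  whose complement has only unbounded components is simply connected.\<close>

lemma arc_complement_inverted_simply_connected:
  fixes g :: "real \<Rightarrow> complex"
  assumes g: "arc g"
  defines "U \<equiv> - ((\<lambda>z. inverse (z - pathstart g)) ` (path_image g - {pathstart g}))"
  shows "open U" "simply_connected U"
proof -
  define K where "K = path_image g"
  define c where "c = pathstart g"
  define \<iota> where "\<iota> = (\<lambda>z. inverse (z - c))"
  define L where "L = \<iota> ` (K - {c})"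
  have U: "U = - L" by (simp add: U_def L_def \<iota>_def K_def c_def)
  have compK: "compact K" by (simp add: K_def g compact_arc_image)
  have cK: "c \<in> K" by (simp add: K_def c_def pathstart_in_path_image)
  \<comment> \<open>This includes \<open>z = c\<close>, because
    \<open>inverse 0 = 0\<close>.\<close>
  have \<iota>\<iota>: "c + inverse (\<iota> z) = z" for z by (simp add: \<iota>_def)
  have Lalt: "w \<in> L \<longleftrightarrow> w \<noteq> 0 \<and> c + inverse w \<in> K" for w
    by (auto simp: L_def \<iota>_def image_iff intro!: bexI[of _ "c + inverse w"])
  have K_eq: "K - {c} = g ` {0<..1}"
  proof -
    have inj: "inj_on g {0..1}" using g by (simp add: arc_def)
    have "K = g ` {0..1}" by (simp add: K_def path_image_def)
    moreover have "{0..1} - {0} = {0<..(1::real)}" by auto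
    ultimately show ?thesis using inj_on_image_set_diff[OF inj, of "{0..1}" "{0}"]
      by (auto simp: c_def pathstart_def)
  qed
  have contg: "continuous_on {0<..1} g"
    using g by (auto simp: arc_def path_def intro: continuous_on_subset)
  have "connected (K - {c})"
    unfolding K_eq by (intro connected_continuous_image contg) auto
  moreover have "continuous_on (K - {c}) \<iota>"
    unfolding \<iota>_def by (intro continuous_intros) auto
  ultimately have connL: "connected L"
    unfolding L_def by (rule connected_continuous_image[rotated])
  \<comment> \<open>Since \<open>K\<close> is bounded, \<open>L\<close> stays away from 0, so a
    limit of points of \<open>L\<close> can be inverted back into the closed set
    \<open>K\<close>.\<close>
  have clL: "closed L"
  proof (rule closed_sequential_limits[THEN iffD2], intro allI impI, elim conjE)
    fix x l assume xL: "\<forall>n. x n \<in> L" and xl: "x \<longlonglongrightarrow> l"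
    obtain R0 where R0: "\<forall>z\<in>K. dist c z \<le> R0"
      using compact_imp_bounded[OF compK] bounded_any_center[of K c] by blast
    define R where "R = max 1 R0"
    have R: "R > 0" "\<And>z. z \<in> K \<Longrightarrow> norm (z - c) \<le> R"
      using R0 by (force simp: R_def dist_norm norm_minus_commute)+
    have "norm (x n) \<ge> inverse R" for n
    proof -
      have "x n \<noteq> 0" "c + inverse (x n) \<in> K" using xL Lalt by auto
      then have "norm (inverse (x n)) \<le> R" using R(2) by fastforce
      then show ?thesis using \<open>x n \<noteq> 0\<close> R(1)
        by (simp add: norm_inverse norm_divide field_simps)
    qed
    then have "norm l \<ge> inverse R"
      using LIMSEQ_le_const[OF tendsto_norm[OF xl]] by blast
    then have l0: "l \<noteq> 0" using R(1) by auto
    have lim: "(\<lambda>n. c + inverse (x n)) \<longlonglongrightarrow> c + inverse l"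
      by (intro tendsto_intros xl l0)
    have mem: "\<And>n. c + inverse (x n) \<in> K" using xL Lalt by auto
    have "c + inverse l \<in> K"
      by (rule closed_sequentially[OF compact_imp_closed[OF compK] mem lim])
    then show "l \<in> L" using l0 Lalt by auto
  qed
  show "open U" using clL by (simp add: U open_Compl)
  have L_unb: "\<not> bounded L"
  proof
    assume "bounded L"
    then obtain R where R: "R > 0" "\<And>w. w \<in> L \<Longrightarrow> norm w \<le> R"
      by (meson bounded_pos)
    have "connected K" using g by (simp add: K_def connected_arc_image)
    moreover have "pathfinish g \<in> K" "pathfinish g \<noteq> c"
      using g arc_distinct_ends by (auto simp: K_def c_def pathfinish_in_path_image)
    ultimately have "c islimpt K"
      using connected_imp_perfect[of K c] cK by blast
    then obtain z where z: "z \<in> K" "z \<noteq> c" "dist z c < inverse (2 * R)"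
      using R(1) unfolding islimpt_approachable
      by (meson inverse_positive_iff_positive mult_pos_pos zero_less_numeral)
    then have "norm (\<iota> z) \<le> R" using R(2) by (auto simp: L_def)
    moreover have "norm (\<iota> z) > 2 * R"
      using z R(1) by (simp add: \<iota>_def norm_inverse norm_divide dist_norm field_simps)
    ultimately show False using R(1) by auto
  qed
  have "L \<noteq> {}" using L_unb by auto
  then have compsU: "components (- U) = {L}"
    using connL by (simp add: U components_eq_sing_iff)
  \<comment> \<open>The additional point 0 plays the role of infinity; it lies in the closure of the
    rest, which is connected because an arc does not separate the plane.\<close>
  have Ueq: "U = insert 0 (\<iota> ` (- K))"
  proof -
    have "w \<in> U \<longleftrightarrow> w = 0 \<or> c + inverse w \<notin> K" for w using Lalt U by auto
    moreover have "w \<in> \<iota> ` (-K) \<longleftrightarrow> w \<noteq> 0 \<and> c + inverse w \<notin> K" for w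
      using cK by (auto simp: \<iota>_def image_iff intro!: bexI[of _ "c + inverse w"])
    ultimately show ?thesis by auto
  qed
  have "connected U"
  proof -
    have "connected (- K)" using connected_arc_complement[OF g] by (simp add: K_def)
    moreover have "continuous_on (- K) \<iota>"
      unfolding \<iota>_def using cK by (intro continuous_intros) auto
    ultimately have conn: "connected (\<iota> ` (- K))" by (rule connected_continuous_image[rotated])
    have cl0: "0 \<in> closure (\<iota> ` (- K))"
    proof -
      obtain e where e: "e > 0" "ball 0 e \<subseteq> U" 
        using \<open>open U\<close> Ueq openE[of U 0] by blast
      have "\<exists>y \<in> \<iota> ` (- K). dist y 0 < d" if "d > 0" for d
      proof -
        define w where "w = complex_of_real (min d e / 2)"
        have "w \<noteq> 0" "norm w < d" "norm w < e" using that e(1) 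
          by (auto simp: w_def norm_divide)
        then have "w \<in> U" "w \<noteq> 0" using e by auto
        then show ?thesis using Ueq \<open>norm w < d\<close> by auto
      qed
      then show ?thesis by (auto simp: closure_approachable)
    qed
    have "insert 0 (\<iota> ` (- K)) \<subseteq> closure (\<iota> ` (- K))"
      using cl0 closure_subset[of "\<iota> ` (- K)"] by blast
    then show ?thesis
      unfolding Ueq using connected_intermediate_closure[OF conn subset_insertI] by blast
  qed
  then show "simply_connected U"
    using simply_connected_eq_unbounded_complement_components[OF \<open>open U\<close>] compsU L_unb by auto
qed

text \<open>The map is built from an inversion, a homeomorphism of the simply connected region
  \<open>U\<close> onto the plane, and a second inversion. Approaching the arc means leaving every
  compact subset of \<open>U\<close>, hence going to infinity under the homeomorphism and to 0 after
  the last inversion.\<close>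

lemma arc_collapse:
  fixes g :: "real \<Rightarrow> complex"
  assumes g: "arc g"
  obtains q :: "complex \<Rightarrow> complex" where
    "continuous_on UNIV q" "\<And>z w. q z = q w \<longleftrightarrow> z = w \<or> z \<in> path_image g \<and> w \<in> path_image g"
proof -
  define K where "K = path_image g"
  define c where "c = pathstart g"
  define \<iota> where "\<iota> = (\<lambda>z. inverse (z - c))"
  define U where "U = - (\<iota> ` (K - {c}))"
  have U: "open U" "simply_connected U"
    using arc_complement_inverted_simply_connected[OF g] by (simp_all add: U_def \<iota>_def K_def c_def)
  have compK: "compact K" by (simp add: K_def g compact_arc_image)
  have cK: "c \<in> K" by (simp add: K_def c_def pathstart_in_path_image)
  have U0: "0 \<in> U" by (auto simp: U_def \<iota>_def)
  have inU: "\<iota> z \<in> U" if "z \<notin> K" for z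
    using that by (auto simp: U_def \<iota>_def)
  have "U homeomorphic ball (0::complex) 1"
    using simply_connected_eq_homeomorphic_to_disc[OF U(1)] U(2) U0 by auto
  moreover have "ball (0::complex) 1 homeomorphic (UNIV :: complex set)"
    by (rule homeomorphic_ball_UNIV) simp
  ultimately have "U homeomorphic (UNIV :: complex set)"
    using homeomorphic_trans by blast
  then obtain h0 k0 where hk0: "homeomorphism U (UNIV :: complex set) h0 k0" by (auto simp: homeomorphic_def)
  \<comment> \<open>The translation makes 0, which stands for infinity before the first inversion, a
    fixed point; it stays the excluded point of the second inversion.\<close>
  define h where "h = (\<lambda>w. h0 w - h0 0)"
  define k where "k = (\<lambda>w. k0 (w + h0 0))"
  have h_cont: "continuous_on U h" and k_cont: "continuous_on UNIV k" and kU: "\<And>w. k w \<in> U"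
    and kh: "\<And>z. z \<in> U \<Longrightarrow> k (h z) = z" and hk: "\<And>w. h (k w) = w"
  proof -
    show "continuous_on U h" using hk0 by (auto simp: h_def homeomorphism_def intro!: continuous_intros)
    show "continuous_on UNIV k" unfolding k_def
      by (rule continuous_on_compose2[of UNIV k0]) (use hk0 in \<open>auto simp: homeomorphism_def intro!: continuous_intros\<close>)
  qed (use hk0 in \<open>auto simp: h_def k_def homeomorphism_def\<close>)
  have h_inj: "h z = h w \<longleftrightarrow> z = w" if "z \<in> U" "w \<in> U" for z w using kh that by metis
  have h0: "h w = 0 \<longleftrightarrow> w = 0" if "w \<in> U" for w
    using h_inj[OF that U0] by (simp add: h_def)
  have \<iota>_inj: "\<iota> z = \<iota> w \<longleftrightarrow> z = w" for z w by (simp add: \<iota>_def)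
  have \<iota>0: "\<iota> z \<noteq> 0" if "z \<notin> K" for z using that cK by (auto simp: \<iota>_def)
  define q where "q = (\<lambda>z. if z \<in> K then 0 else inverse (h (\<iota> z)))"
  have q0: "q z = 0 \<longleftrightarrow> z \<in> K" for z
    using h0[OF inU] \<iota>0 by (auto simp: q_def)
  have inj: "q z = q w \<longleftrightarrow> z = w \<or> z \<in> K \<and> w \<in> K" for z w
  proof (cases "z \<in> K \<or> w \<in> K")
    case True then show ?thesis using q0 by metis
  next
    case False then show ?thesis by (auto simp: q_def h_inj inU \<iota>_inj)
  qed
  have small: "\<exists>e>0. \<forall>z. dist z a < e \<longrightarrow> norm (q z) < d" if "a \<in> K" "d > 0" for a d
  proof -
    \<comment> \<open>\<open>\<iota> z \<in> M\<close> says that \<open>h (\<iota> z)\<close> has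
      norm at most \<open>inverse d\<close>, that is, that \<open>q z\<close> has norm at least
      \<open>d\<close>. So \<open>N\<close> collects the points where \<open>q\<close> is not small,
      and continuity at \<open>a\<close> amounts to \<open>N\<close> being closed.\<close>
    define M where "M = k ` cball 0 (inverse d)"
    have compM: "compact M" unfolding M_def
      by (intro compact_continuous_image continuous_on_subset[OF k_cont]) auto
    define N where "N = {z. z \<notin> K \<and> \<iota> z \<in> M}"
    have "closed N"
    proof (rule closed_sequential_limits[THEN iffD2], intro allI impI, elim conjE)
      fix x l assume xN: "\<forall>n. x n \<in> N" and xl: "x \<longlonglongrightarrow> l"
      obtain R where R: "R > 0" "\<And>w. w \<in> M \<Longrightarrow> norm w \<le> R"
        using compact_imp_bounded[OF compM] by (meson bounded_pos)
      have "norm (x n - c) \<ge> inverse R" for n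
      proof -
        have "norm (\<iota> (x n)) \<le> R" "x n \<noteq> c" using xN R(2) cK by (auto simp: N_def)
        then show ?thesis using R(1) by (simp add: \<iota>_def norm_inverse norm_divide field_simps)
      qed
      moreover have "(\<lambda>n. norm (x n - c)) \<longlonglongrightarrow> norm (l - c)" by (intro tendsto_intros xl)
      ultimately have "norm (l - c) \<ge> inverse R"
        using LIMSEQ_le_const by blast
      then have lc: "l \<noteq> c" using R(1) by auto
      have lim: "(\<lambda>n. \<iota> (x n)) \<longlonglongrightarrow> \<iota> l"
        unfolding \<iota>_def by (intro tendsto_intros xl) (use lc in auto)
      have mem: "\<And>n. \<iota> (x n) \<in> M" using xN by (auto simp: N_def)
      have lM: "\<iota> l \<in> M"
        by (rule closed_sequentially[OF compact_imp_closed[OF compM] mem lim])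
      then have "\<iota> l \<in> U" using kU by (auto simp: M_def)
      then have "l \<notin> K" using lc by (auto simp: U_def)
      then show "l \<in> N" using lM by (auto simp: N_def)
    qed
    moreover have "a \<notin> N" using that by (auto simp: N_def)
    ultimately obtain e where e: "e > 0" "ball a e \<subseteq> - N"
      using openE[of "- N" a] by (auto simp: open_Compl)
    have "norm (q z) < d" if z: "dist z a < e" for z
    proof (cases "z \<in> K")
      case True then show ?thesis using \<open>d > 0\<close> by (simp add: q_def)
    next
      case False
      then have "\<iota> z \<notin> M" using e z by (auto simp: N_def dist_commute)
      then have "h (\<iota> z) \<notin> cball 0 (inverse d)"
        using kh[OF inU[OF False]] by (metis M_def imageI)
      then have "norm (h (\<iota> z)) > inverse d" by auto
      then show ?thesis using False \<open>d > 0\<close> less_imp_inverse_less[of "inverse d" "norm (h (\<iota> z))"]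
        by (simp add: q_def norm_inverse)
    qed
    then show ?thesis using e(1) by blast
  qed
  have "continuous (at a) q" for a
  proof (cases "a \<in> K")
    case True
    then show ?thesis using small[OF True] by (simp add: continuous_at_eps_delta q_def)
  next
    case False
    have "continuous_on (- K) (\<lambda>z. inverse (h (\<iota> z)))"
    proof (intro continuous_intros)
      show "continuous_on (- K) (\<lambda>z. h (\<iota> z))"
        by (rule continuous_on_compose2[OF h_cont])
          (use inU cK in \<open>auto simp: \<iota>_def intro!: continuous_intros\<close>)
    qed (use h0[OF inU] \<iota>0 in auto)
    then have "continuous_on (- K) q" by (rule continuous_on_eq) (auto simp: q_def)
    then show ?thesis using False compact_imp_closed[OF compK]
      by (metis ComplI continuous_on_eq_continuous_at open_Compl)
  qed
  then have "continuous_on UNIV q" by (simp add: continuous_at_imp_continuous_on)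
  with inj show ?thesis using that K_def by blast
qed

section \<open>Contraction, subdivision and insertion of edges\<close>

text \<open>Edges that become loops have an image of cardinality 1 and disappear; parallel edges
  merge, as edges are sets.\<close>

definition contract_edges :: "('a \<Rightarrow> 'b) \<Rightarrow> 'a set set \<Rightarrow> 'b set set" where
  "contract_edges r E = {f \<in> (`) r ` E. card f = 2}"

lemma planar_subgraph:
  assumes "planar V E" "V' \<subseteq> V" "E' \<subseteq> E" "\<And>e. e \<in> E' \<Longrightarrow> e \<subseteq> V'"
  shows "planar V' E'"
proof -
  obtain p \<gamma> where d: "plane_drawing V E p \<gamma>" using assms(1) by (auto simp: planar_def)
  have "path_image (\<gamma> e) \<inter> p ` V' = p ` e" if "e \<in> E'" for e
  proof -
    have "path_image (\<gamma> e) \<inter> p ` V = p ` e" using d that assms(3) unfolding plane_drawing_def by (meson subsetD)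
    then show ?thesis using assms(2,4) that by fastforce
  qed
  then have "plane_drawing V' E' p \<gamma>"
    using d assms(2,3) unfolding plane_drawing_def by (meson inj_on_subset subsetD)
  then show ?thesis by (auto simp: planar_def)
qed

lemma planar_image:
  assumes "planar V E" "inj_on f V" "\<And>e. e \<in> E \<Longrightarrow> e \<subseteq> V"
  shows "planar (f ` V) ((`) f ` E)"
proof -
  obtain p \<gamma> where d: "plane_drawing V E p \<gamma>" using assms(1) by (auto simp: planar_def)
  let ?i = "inv_into V f"
  have ie: "?i ` f ` e = e" if "e \<subseteq> V" for e using inv_into_image_cancel[OF assms(2) that] .
  have pe: "(p \<circ> ?i) ` f ` e = p ` e" if "e \<subseteq> V" for e
    using ie[OF that] by (metis image_comp)
  have "inj_on (p \<circ> ?i) (f ` V)"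
    using d ie[of V] by (intro comp_inj_on inj_on_inv_into) (auto simp: plane_drawing_def)
  moreover have "p ` (e \<inter> g) = (p \<circ> ?i) ` (f ` e \<inter> f ` g)" if "e \<in> E" "g \<in> E" for e g
    using pe[of "e \<inter> g"] assms that by (metis inf.coboundedI1 inj_on_image_Int)
  ultimately have "plane_drawing (f ` V) ((`) f ` E) (p \<circ> ?i) (\<lambda>e. \<gamma> (?i ` e))"
    using d unfolding plane_drawing_def
    by (simp add: ie pe assms(3) del: comp_apply) metis
  then show ?thesis by (auto simp: planar_def)
qed

lemma edge_doubleton:
  assumes "card e = 2" "u \<in> e"
  obtains v where "e = {u, v}" "u \<noteq> v"
  using assms by (auto simp: card_2_iff)

text \<open>The new drawing is the old one followed by the collapse of the arc of
  \<open>{u, v}\<close>. The collapse identifies points on that arc only, so both ends land on one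
  point and nothing else is glued.\<close>

lemma planar_contract:
  assumes pl: "planar V E" and E: "\<And>e. e \<in> E \<Longrightarrow> e \<subseteq> V \<and> card e = 2"
    and uv: "{u, v} \<in> E" "u \<noteq> v"
  shows "planar (V - {v}) (contract_edges (id(v := u)) E)"
proof -
  obtain p \<gamma> where d: "plane_drawing V E p \<gamma>" using pl by (auto simp: planar_def)
  have injp: "inj_on p V" using d by (auto simp: plane_drawing_def)
  have arcE: "arc (\<gamma> e)" and endsE: "{pathstart (\<gamma> e), pathfinish (\<gamma> e)} = p ` e"
    and VE: "path_image (\<gamma> e) \<inter> p ` V = p ` e" if "e \<in> E" for e
    using d that by (auto simp: plane_drawing_def)
  have EE: "path_image (\<gamma> e) \<inter> path_image (\<gamma> f) \<subseteq> p ` (e \<inter> f)" if "e \<in> E" "f \<in> E" "e \<noteq> f" for e f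
    using d that by (auto simp: plane_drawing_def)
  define K where "K = path_image (\<gamma> {u, v})"
  obtain q :: "complex \<Rightarrow> complex" where q: "continuous_on UNIV q" "\<And>z w. q z = q w \<longleftrightarrow> z = w \<or> z \<in> K \<and> w \<in> K"
    using arc_collapse[OF arcE[OF uv(1)]] unfolding K_def by metis
  define r where "r = id(v := u)"
  have rv: "r v = u" and rn: "\<And>x. x \<noteq> v \<Longrightarrow> r x = x" by (auto simp: r_def)
  have ru: "r u = u" using rn uv(2) by blast
  let ?E = "contract_edges r E"
  have uvV: "u \<in> V" "v \<in> V" using E uv by auto
  have KV: "p x \<in> K \<longleftrightarrow> x = u \<or> x = v" if "x \<in> V" for x
  proof -
    have "p x \<in> K \<longleftrightarrow> p x \<in> p ` {u, v}" using VE[OF uv(1)] that K_def by blast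
    then show ?thesis using injp that uvV by (auto simp: inj_on_def)
  qed
  have qr: "q (p (r x)) = q (p x)" if "x \<in> V" for x
    using KV uvV q(2) rv rn by metis
  \<comment> \<open>A common neighbour of \<open>u\<close> and \<open>v\<close> gives two edges with
    the same image; only one of them is drawn.\<close>
  define s where "s = (\<lambda>f. SOME e. e \<in> E \<and> r ` e = f)"
  have s: "s f \<in> E" "r ` s f = f" if "f \<in> ?E" for f
  proof -
    have "\<exists>e. e \<in> E \<and> r ` e = f" using that by (auto simp: contract_edges_def)
    from someI_ex[OF this] show "s f \<in> E" "r ` s f = f" by (auto simp: s_def)
  qed
  \<comment> \<open>An edge other than \<open>{u, v}\<close> contains at most one of
    \<open>u\<close> and \<open>v\<close>, so it touches the collapsed arc at most once and the
    collapse stays injective along it.\<close>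
  have one: "\<exists>x. x \<in> V \<and> path_image (\<gamma> (s f)) \<inter> K \<subseteq> {p x}"
    and toK: "path_image (\<gamma> (s f)) \<inter> K \<noteq> {} \<Longrightarrow> u \<in> f" if f: "f \<in> ?E" for f
  proof -
    note sf = s[OF f]
    have "card (r ` s f) = 2" using f sf by (auto simp: contract_edges_def)
    then have ne: "s f \<noteq> {u, v}" using rv ru by auto
    then have nsub: "\<not> {u, v} \<subseteq> s f"
      using E[OF sf(1)] uv(2) by (metis card_2_iff card_subset_eq finite_subset card.infinite zero_neq_numeral)
    have sub: "path_image (\<gamma> (s f)) \<inter> K \<subseteq> p ` (s f \<inter> {u, v})"
      unfolding K_def using EE[OF sf(1) uv(1) ne] .
    then show "\<exists>x. x \<in> V \<and> path_image (\<gamma> (s f)) \<inter> K \<subseteq> {p x}"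
      using nsub uvV by (cases "u \<in> s f") auto
    show "u \<in> f" if "path_image (\<gamma> (s f)) \<inter> K \<noteq> {}"
    proof -
      have "s f \<inter> {u, v} \<noteq> {}" using that sub by auto
      then obtain x where "x \<in> s f" "r x = u" using rv ru by auto
      then have "u \<in> r ` s f" by blast
      then show ?thesis using sf(2) by simp
    qed
  qed
  have sV: "s f \<subseteq> V" if "f \<in> ?E" for f using s[OF that] E by auto
  have fV: "f \<subseteq> V - {v}" if fE: "f \<in> ?E" for f
  proof
    fix x assume "x \<in> f"
    then have "x \<in> r ` s f" using s(2)[OF fE] by simp
    then obtain y where "y \<in> s f" "x = r y" by blast
    then show "x \<in> V - {v}" using sV[OF fE] uvV uv rv rn by (cases "y = v") auto
  qed
  have qf: "(q \<circ> p) ` f = q ` p ` s f" if "f \<in> ?E" for f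
  proof -
    have "(q \<circ> p) ` r ` s f = q ` p ` s f"
      unfolding image_image by (rule image_cong) (use qr sV[OF that] in auto)
    then show ?thesis using s(2)[OF that] by simp
  qed
  have "plane_drawing (V - {v}) ?E (q \<circ> p) (\<lambda>f. q \<circ> \<gamma> (s f))"
    unfolding plane_drawing_def
  proof (intro conjI ballI impI)
    show "inj_on (q \<circ> p) (V - {v})"
      using q(2) KV injp by (auto simp: inj_on_def)
  next
    fix f assume f: "f \<in> ?E"
    note sf = s[OF f]
    show "arc (q \<circ> \<gamma> (s f))"
      unfolding arc_def
    proof
      show "path (q \<circ> \<gamma> (s f))"
        using arcE[OF sf(1)] q(1) by (meson arc_imp_path continuous_on_subset path_continuous_image subset_UNIV)
      show "inj_on (q \<circ> \<gamma> (s f)) {0..1}"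
      proof (rule inj_onI)
        fix t t' :: real assume t: "t \<in> {0..1}" "t' \<in> {0..1}" "(q \<circ> \<gamma> (s f)) t = (q \<circ> \<gamma> (s f)) t'"
        obtain x where x: "path_image (\<gamma> (s f)) \<inter> K \<subseteq> {p x}" using one[OF f] by auto
        have "\<gamma> (s f) t \<in> path_image (\<gamma> (s f))" "\<gamma> (s f) t' \<in> path_image (\<gamma> (s f))"
          using t by (auto simp: path_image_def)
        then have "\<gamma> (s f) t = \<gamma> (s f) t'" using t(3) q(2)[of "\<gamma> (s f) t" "\<gamma> (s f) t'"] x
          by (metis Int_iff comp_apply singletonD subsetD)
        then show "t = t'" using arcE[OF sf(1)] t by (auto simp: arc_def inj_on_def)
      qed
    qed
    have "{pathstart (q \<circ> \<gamma> (s f)), pathfinish (q \<circ> \<gamma> (s f))} = q ` {pathstart (\<gamma> (s f)), pathfinish (\<gamma> (s f))}"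
      by (simp add: pathstart_def pathfinish_def)
    then show "{pathstart (q \<circ> \<gamma> (s f)), pathfinish (q \<circ> \<gamma> (s f))} = (q \<circ> p) ` f"
      using endsE[OF sf(1)] qf[OF f] by simp
    show "path_image (q \<circ> \<gamma> (s f)) \<inter> (q \<circ> p) ` (V - {v}) = (q \<circ> p) ` f"
    proof
      show "path_image (q \<circ> \<gamma> (s f)) \<inter> (q \<circ> p) ` (V - {v}) \<subseteq> (q \<circ> p) ` f"
      proof
        fix w assume w: "w \<in> path_image (q \<circ> \<gamma> (s f)) \<inter> (q \<circ> p) ` (V - {v})"
        then obtain z where z: "z \<in> path_image (\<gamma> (s f))" "w = q z" by (auto simp: path_image_compose)
        obtain x where x: "x \<in> V - {v}" "w = q (p x)" using w by auto
        have "q z = q (p x)" using z x by simp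
        then consider "z = p x" | "z \<in> K" "p x \<in> K" using q(2)[of z "p x"] by blast
        then show "w \<in> (q \<circ> p) ` f"
        proof cases
          case 1
          then have "z \<in> p ` s f" using VE[OF sf(1)] z x by auto
          then show ?thesis using qf[OF f] z by auto
        next
          case 2
          then have xu: "x = u" using KV x by auto
          have "u \<in> f" using toK[OF f] 2(1) z(1) by blast
          then show ?thesis using x(2) xu by auto
        qed
      qed
      show "(q \<circ> p) ` f \<subseteq> path_image (q \<circ> \<gamma> (s f)) \<inter> (q \<circ> p) ` (V - {v})"
      proof -
        have "q ` p ` s f \<subseteq> path_image (q \<circ> \<gamma> (s f))"
          using VE[OF sf(1)] by (auto simp: path_image_compose)
        moreover have "(q \<circ> p) ` f \<subseteq> (q \<circ> p) ` (V - {v})" using fV[OF f] by (rule image_mono)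
        ultimately show ?thesis unfolding qf[OF f] by blast
      qed
    qed
  next
    fix f g assume f: "f \<in> ?E" and g: "g \<in> ?E" and fg: "f \<noteq> g"
    note sf = s[OF f] and sg = s[OF g]
    show "path_image (q \<circ> \<gamma> (s f)) \<inter> path_image (q \<circ> \<gamma> (s g)) \<subseteq> (q \<circ> p) ` (f \<inter> g)"
    proof
      fix w assume w: "w \<in> path_image (q \<circ> \<gamma> (s f)) \<inter> path_image (q \<circ> \<gamma> (s g))"
      then obtain z y where z: "z \<in> path_image (\<gamma> (s f))" "w = q z" and y: "y \<in> path_image (\<gamma> (s g))" "w = q y"
        by (auto simp: path_image_compose)
      then have "q z = q y" by simp
      then consider "z = y" | "z \<in> K" "y \<in> K" using q(2)[of z y] by blast
      then show "w \<in> (q \<circ> p) ` (f \<inter> g)"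
      proof cases
        case 1
        have "s f \<noteq> s g" using sf(2) sg(2) fg by metis
        then obtain x where x: "x \<in> s f" "x \<in> s g" "z = p x" using EE[OF sf(1) sg(1)] z y 1 by auto
        then have "r x \<in> f" "r x \<in> g" using sf(2) sg(2) by (metis imageI)+
        moreover have "w = q (p (r x))" using x z qr sV[OF f] by auto
        ultimately show ?thesis by auto
      next
        case 2
        then have "u \<in> f" "u \<in> g" using toK[OF f] toK[OF g] z y by auto
        moreover have "w = q (p u)" using 2 z q(2) KV uvV by auto
        ultimately show ?thesis by auto
      qed
    qed
  qed
  then show ?thesis unfolding r_def by (auto simp: planar_def)
qed


lemma split_arc_at:
  fixes g :: "real \<Rightarrow> complex"
  assumes g: "arc g" and x: "x \<in> path_image g" "x \<noteq> pathstart g" "x \<noteq> pathfinish g"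
  obtains g1 g2 where "arc g1" "arc g2" "pathstart g1 = pathstart g" "pathfinish g1 = x"
    "pathstart g2 = x" "pathfinish g2 = pathfinish g"
    "path_image g1 \<union> path_image g2 = path_image g" "path_image g1 \<inter> path_image g2 = {x}"
    "pathfinish g \<notin> path_image g1" "pathstart g \<notin> path_image g2"
proof -
  obtain t where t: "t \<in> {0..1}" "x = g t" using x by (auto simp: path_image_def)
  have t01: "t \<noteq> 0" "t \<noteq> 1" using x t by (auto simp: pathstart_def pathfinish_def)
  have inj: "inj_on g {0..1}" using g by (simp add: arc_def)
  let ?g1 = "subpath 0 t g" and ?g2 = "subpath t 1 g"
  have im: "path_image ?g1 = g ` {0..t}" "path_image ?g2 = g ` {t..1}"
    using t by (auto simp: path_image_subpath)
  have "{0..1} = {0..t} \<union> {t..1}" and Int: "{0..t} \<inter> {t..1} = {t}" using t by auto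
  then have un: "path_image ?g1 \<union> path_image ?g2 = path_image g"
    unfolding im by (metis image_Un path_image_def)
  have "g ` ({0..t} \<inter> {t..1}) = g ` {0..t} \<inter> g ` {t..1}"
    by (rule inj_on_image_Int[OF inj]) (use t in auto)
  then have int: "path_image ?g1 \<inter> path_image ?g2 = {x}" unfolding im Int using t by simp
  have "g 1 \<notin> g ` {0..t}" "g 0 \<notin> g ` {t..1}"
    using inj t t01 by (force simp: inj_on_def)+
  then have "pathfinish g \<notin> path_image ?g1" "pathstart g \<notin> path_image ?g2"
    unfolding im by (simp_all add: pathstart_def pathfinish_def)
  moreover have "arc ?g1" "arc ?g2" using t t01 g by (auto intro: arc_subpath_arc)
  moreover have "pathstart ?g1 = pathstart g" "pathfinish ?g1 = x" "pathstart ?g2 = x" "pathfinish ?g2 = pathfinish g"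
    using t by (simp_all add: pathstart_def pathfinish_def subpath_def)
  ultimately show ?thesis using un int that by blast
qed

text \<open>The combinatorial side of sliding an end: \<open>x\<close> subdivides
  \<open>{u, b}\<close> and is joined to \<open>y\<close>; contracting the piece
  \<open>{u, x}\<close> restores \<open>{u, b}\<close> and turns \<open>{x, y}\<close> into
  \<open>{u, y}\<close>.\<close>

lemma contract_edges_subdivided:
  assumes E: "\<And>e. e \<in> E \<Longrightarrow> e \<subseteq> V \<and> card e = 2"
    and "{u, b} \<in> E" "x \<notin> V" "y \<in> V" "u \<noteq> y"
  shows "contract_edges (id(x := u)) (insert {x, y} (insert {u, x} (insert {x, b} (E - {{u, b}})))) = insert {u, y} E"
proof -
  define r where "r = id(x := u)"
  have r: "r x = u" "\<And>z. z \<in> V \<Longrightarrow> r z = z" using assms by (auto simp: r_def)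
  have uV: "u \<in> V" "b \<in> V" using assms by blast+
  have rE: "r ` f = f" if "f \<in> E" for f
    using E[OF that] r by (force simp: image_iff)
  have "(`) r ` (E - {{u, b}}) = E - {{u, b}}"
    using rE by (simp add: image_def)
  then have "(`) r ` (insert {x, y} (insert {u, x} (insert {x, b} (E - {{u, b}})))) = insert {u, y} (insert {u} E)"
    using insert_Diff[OF assms(2)] r(2)[OF assms(4)] r(2)[OF uV(1)] r(2)[OF uV(2)] r(1) by simp
  then show ?thesis
    using E assms(5) by (auto simp: contract_edges_def r_def)
qed

lemma insert2_cases:
  assumes "e \<in> insert p (insert q S)" "f \<in> insert p (insert q S)" "e \<noteq> f"
  shows "e \<in> {p, q} \<and> f \<in> S \<or> f \<in> {p, q} \<and> e \<in> S \<or> e \<in> S \<and> f \<in> S \<or> e = p \<and> f = q \<or> f = p \<and> e = q"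
  using assms by blast

section \<open>Plane graphs whose vertices are points of the plane\<close>

locale plane_graph =
  fixes V :: "complex set" and E :: "complex set set" and \<gamma> :: "complex set \<Rightarrow> real \<Rightarrow> complex"
  assumes finV: "finite V"
    and edge_sub: "\<And>e. e \<in> E \<Longrightarrow> e \<subseteq> V"
    and edge_card: "\<And>e. e \<in> E \<Longrightarrow> card e = 2"
    and arcE: "\<And>e. e \<in> E \<Longrightarrow> arc (\<gamma> e)"
    and endsE: "\<And>e. e \<in> E \<Longrightarrow> {pathstart (\<gamma> e), pathfinish (\<gamma> e)} = e"
    and VE: "\<And>e. e \<in> E \<Longrightarrow> path_image (\<gamma> e) \<inter> V = e"
    and EE: "\<And>e f. e \<in> E \<Longrightarrow> f \<in> E \<Longrightarrow> e \<noteq> f \<Longrightarrow> path_image (\<gamma> e) \<inter> path_image (\<gamma> f) \<subseteq> e \<inter> f"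
begin

definition X :: "complex set" where "X = V \<union> (\<Union>e\<in>E. path_image (\<gamma> e))"

definition open_edge :: "complex set \<Rightarrow> complex set" where "open_edge e = path_image (\<gamma> e) - e"

lemma drawing: "plane_drawing V E id \<gamma>"
  using arcE endsE VE EE by (simp add: plane_drawing_def)

lemma planar: "planar V E"
  using drawing planar_def by blast

lemma finE: "finite E"
  using finV edge_sub by (meson PowI finite_Pow_iff finite_subset subsetI)

lemma edge_arc:
  assumes "{a, b} \<in> E"
  obtains g where "arc g" "pathstart g = a" "pathfinish g = b" "path_image g = path_image (\<gamma> {a, b})"
proof (cases "pathstart (\<gamma> {a, b}) = a")
  case True
  then have "pathfinish (\<gamma> {a, b}) = b"
    using endsE[OF assms] arc_distinct_ends[OF arcE[OF assms]] by (metis doubleton_eq_iff)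
  then show ?thesis using True that arcE[OF assms] by blast
next
  case False
  then have "pathfinish (\<gamma> {a, b}) = a" "pathstart (\<gamma> {a, b}) = b"
    using endsE[OF assms] by (metis doubleton_eq_iff)+
  then show ?thesis using that[of "reversepath (\<gamma> {a, b})"] arcE[OF assms]
    by (simp add: arc_reversepath)
qed

lemma add_arc:
  assumes "arc \<sigma>" "pathstart \<sigma> = x" "pathfinish \<sigma> = y" "x \<in> V" "y \<in> V" "{x, y} \<notin> E"
    and dis: "path_image \<sigma> - {x, y} \<subseteq> - X"
  shows "plane_graph V (insert {x, y} E) (\<gamma>({x, y} := \<sigma>))"
proof -
  have xy: "x \<noteq> y" using assms arc_distinct_ends by metis
  have in\<sigma>: "x \<in> path_image \<sigma>" "y \<in> path_image \<sigma>"
    using assms pathstart_in_path_image pathfinish_in_path_image by metis+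
  have meet: "path_image \<sigma> \<inter> path_image (\<gamma> e) \<subseteq> {x, y} \<inter> e" if "e \<in> E" for e
  proof
    fix z assume z: "z \<in> path_image \<sigma> \<inter> path_image (\<gamma> e)"
    then have "z \<in> X" using that by (auto simp: X_def)
    then have "z = x \<or> z = y" using dis z by blast
    moreover have "z \<in> e" using calculation VE[OF that] z assms(4,5) by blast
    ultimately show "z \<in> {x, y} \<inter> e" by auto
  qed
  have neq: "e \<noteq> {x, y}" if "e \<in> E" for e using that assms(6) by auto
  show ?thesis
  proof
    fix e f assume "e \<in> insert {x, y} E" "f \<in> insert {x, y} E" "e \<noteq> f"
    then show "path_image ((\<gamma>({x, y} := \<sigma>)) e) \<inter> path_image ((\<gamma>({x, y} := \<sigma>)) f) \<subseteq> e \<inter> f"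
      using meet[of e] meet[of f] EE[of e f] neq by (auto split: if_splits)
  next
    fix e assume "e \<in> insert {x, y} E"
    then show "path_image ((\<gamma>({x, y} := \<sigma>)) e) \<inter> V = e"
      using VE[of e] neq[of e] dis in\<sigma> assms(4,5) by (auto simp: X_def)
    show "arc ((\<gamma>({x, y} := \<sigma>)) e)"
      using \<open>e \<in> insert {x, y} E\<close> arcE assms(1) by auto
    show "{pathstart ((\<gamma>({x, y} := \<sigma>)) e), pathfinish ((\<gamma>({x, y} := \<sigma>)) e)} = e"
    proof (cases "e = {x, y}")
      case True then show ?thesis using assms(2,3) by simp
    next
      case False
      then show ?thesis using \<open>e \<in> insert {x, y} E\<close> endsE[of e] by simp
    qed
    show "e \<subseteq> V" "card e = 2"
      using \<open>e \<in> insert {x, y} E\<close> edge_sub edge_card assms(4,5) xy by auto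
  qed (rule finV)
qed

text \<open>The point set \<open>X\<close> of the drawing does not change, so an arc that avoided
  the drawing before the subdivision still avoids it afterwards.\<close>

lemma subdivide:
  assumes ab: "{a, b} \<in> E" and x: "x \<in> open_edge {a, b}"
  obtains \<gamma>' where "plane_graph (insert x V) (insert {a, x} (insert {x, b} (E - {{a, b}}))) \<gamma>'"
    "plane_graph.X (insert x V) (insert {a, x} (insert {x, b} (E - {{a, b}}))) \<gamma>' = X"
    "\<And>f. f \<in> E \<Longrightarrow> f \<noteq> {a, b} \<Longrightarrow> \<gamma>' f = \<gamma> f"
proof -
  obtain g where g: "arc g" "pathstart g = a" "pathfinish g = b" "path_image g = path_image (\<gamma> {a, b})"
    using edge_arc[OF ab] .
  have abV: "a \<in> V" "b \<in> V" "a \<noteq> b" using edge_sub[OF ab] edge_card[OF ab] by (auto simp: card_2_iff)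
  have xg: "x \<in> path_image g" "x \<noteq> a" "x \<noteq> b" using x g by (auto simp: open_edge_def)
  then have xV: "x \<notin> V" using VE[OF ab] g by auto
  obtain g1 g2 where g12: "arc g1" "arc g2" "pathstart g1 = a" "pathfinish g1 = x"
    "pathstart g2 = x" "pathfinish g2 = b" and gg: 
    "path_image g1 \<union> path_image g2 = path_image g" "path_image g1 \<inter> path_image g2 = {x}"
    "b \<notin> path_image g1" "a \<notin> path_image g2"
    using split_arc_at[OF g(1) xg(1)] xg g(2,3) by metis
  have ing: "a \<in> path_image g1" "x \<in> path_image g1" "x \<in> path_image g2" "b \<in> path_image g2"
    using g12 pathstart_in_path_image pathfinish_in_path_image by metis+
  let ?E' = "E - {{a, b}}"
  define \<gamma>' where "\<gamma>' = \<gamma>({a, x} := g1, {x, b} := g2)"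
  have ne: "{a, x} \<noteq> {x, b}" using abV by (auto simp: doubleton_eq_iff)
  have new: "{a, x} \<notin> E" "{x, b} \<notin> E" using edge_sub xV by blast+
  have \<gamma>': "\<gamma>' {a, x} = g1" "\<gamma>' {x, b} = g2" using ne by (auto simp: \<gamma>'_def)
  have \<gamma>'E: "\<gamma>' f = \<gamma> f" if "f \<in> E" for f using new that by (auto simp: \<gamma>'_def)
  have V1: "path_image g1 \<inter> V = {a}" "path_image g2 \<inter> V = {b}"
  proof -
    have "path_image g1 \<inter> V \<subseteq> {a, b}" "path_image g2 \<inter> V \<subseteq> {a, b}"
      using VE[OF ab] g(4) gg(1) by auto
    then show "path_image g1 \<inter> V = {a}" "path_image g2 \<inter> V = {b}"
      using gg(3,4) ing abV by auto
  qed
  have meet: "path_image g \<inter> path_image (\<gamma> f) \<subseteq> {a, b} \<inter> f" if "f \<in> ?E'" for f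
    using EE[OF ab, of f] that g(4) by auto
  have meet1: "path_image g1 \<inter> path_image (\<gamma> f) \<subseteq> {a, x} \<inter> f"
    "path_image g2 \<inter> path_image (\<gamma> f) \<subseteq> {x, b} \<inter> f" if "f \<in> ?E'" for f
    using meet[OF that] gg by blast+
  have xf: "x \<notin> path_image (\<gamma> f)" if "f \<in> ?E'" for f
    using meet[OF that] xg by blast
  have PG: "plane_graph (insert x V) (insert {a, x} (insert {x, b} ?E')) \<gamma>'"
  proof
    fix e f assume ef: "e \<in> insert {a, x} (insert {x, b} ?E')" "f \<in> insert {a, x} (insert {x, b} ?E')" "e \<noteq> f"
    have *: "path_image (\<gamma>' e) \<inter> path_image (\<gamma>' f) \<subseteq> e \<inter> f" if "e \<in> {{a, x}, {x, b}}" "f \<in> ?E'" for e f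
      using that meet1[of f] \<gamma>' \<gamma>'E[of f] by (elim insertE emptyE) simp_all
    have **: "path_image (\<gamma>' {a, x}) \<inter> path_image (\<gamma>' {x, b}) \<subseteq> {a, x} \<inter> {x, b}"
      using \<gamma>' gg by simp
    from insert2_cases[OF ef] show "path_image (\<gamma>' e) \<inter> path_image (\<gamma>' f) \<subseteq> e \<inter> f"
    proof (elim disjE conjE)
      assume "e \<in> {{a, x}, {x, b}}" "f \<in> ?E'" then show ?thesis by (rule *)
    next
      assume "f \<in> {{a, x}, {x, b}}" "e \<in> ?E'" from *[OF this] show ?thesis by (simp only: Int_commute)
    next
      assume "e \<in> ?E'" "f \<in> ?E'" then show ?thesis using EE[of e f] \<gamma>'E ef(3) by simp
    next
      assume "e = {a, x}" "f = {x, b}" with ** show ?thesis by (simp only:)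
    next
      assume "f = {a, x}" "e = {x, b}" with ** show ?thesis by (simp only: Int_commute)
    qed
  next
    fix e assume e: "e \<in> insert {a, x} (insert {x, b} ?E')"
    then consider "e = {a, x}" | "e = {x, b}" | "e \<in> ?E'" by blast
    then have "path_image (\<gamma>' e) \<inter> insert x V = e \<and> arc (\<gamma>' e) \<and> {pathstart (\<gamma>' e), pathfinish (\<gamma>' e)} = e"
    proof cases
      case 1 then show ?thesis using V1 ing \<gamma>' g12 by auto
    next
      case 2 then show ?thesis using V1 ing \<gamma>' g12 by auto
    next
      case 3 then show ?thesis using VE[of e] \<gamma>'E[of e] xf[of e] arcE[of e] endsE[of e] by auto
    qed
    then show "path_image (\<gamma>' e) \<inter> insert x V = e" "arc (\<gamma>' e)"
      "{pathstart (\<gamma>' e), pathfinish (\<gamma>' e)} = e" by auto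
    show "e \<subseteq> insert x V" "card e = 2" using e abV edge_sub edge_card xg by auto
  qed (use finV in auto)
  have "(\<Union>e\<in>insert {a, x} (insert {x, b} ?E'). path_image (\<gamma>' e))
      = path_image g1 \<union> path_image g2 \<union> (\<Union>e\<in>?E'. path_image (\<gamma> e))"
    using \<gamma>' \<gamma>'E by auto
  also have "\<dots> = (\<Union>e\<in>E. path_image (\<gamma> e))" using gg(1) g(4) ab by blast
  finally have "plane_graph.X (insert x V) (insert {a, x} (insert {x, b} ?E')) \<gamma>' = X"
    unfolding plane_graph.X_def[OF PG] X_def using xg(1) g(4) ab by blast
  with PG show ?thesis using that \<gamma>'E by blast
qed

lemma open_edge_Int:
  assumes "e \<in> E" "f \<in> E" "e \<noteq> f"
  shows "open_edge e \<inter> path_image (\<gamma> f) = {}"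
  using EE[OF assms] by (auto simp: open_edge_def)

lemma open_edge_V: "e \<in> E \<Longrightarrow> open_edge e \<inter> V = {}"
  using VE by (auto simp: open_edge_def)

text \<open>An arc that ends in the interior of an edge is slid along that edge to one of its ends by
  subdividing the edge and contracting one of the two pieces.\<close>

lemma planar_slide:
  assumes "arc \<sigma>" "pathstart \<sigma> = x" "pathfinish \<sigma> = y" "y \<in> V"
    and e: "e \<in> E" "x \<in> open_edge e" "u \<in> e" "u \<noteq> y"
    and dis: "path_image \<sigma> - {x, y} \<subseteq> - X"
  shows "planar V (insert {u, y} E)"
proof -
  obtain b where b: "e = {u, b}" "u \<noteq> b" using edge_doubleton[OF edge_card e(3)] e(1) by metis
  have ub: "{u, b} \<in> E" "x \<in> open_edge {u, b}" using e b by auto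
  have uV: "u \<in> V" "b \<in> V" using edge_sub[OF ub(1)] by auto
  have xV: "x \<notin> V" using open_edge_V[OF ub(1)] ub(2) by auto
  let ?E1 = "insert {u, x} (insert {x, b} (E - {{u, b}}))"
  obtain \<gamma>1 where 1: "plane_graph (insert x V) ?E1 \<gamma>1" "plane_graph.X (insert x V) ?E1 \<gamma>1 = X"
    using subdivide[OF ub] by metis
  interpret G1: plane_graph "insert x V" ?E1 \<gamma>1 by (rule 1(1))
  \<comment> \<open>For \<open>y = b\<close> the edge \<open>{x, y}\<close> is already one of the
    two pieces; otherwise the arc is added as a new edge.\<close>
  have "planar (insert x V) (insert {x, y} ?E1)"
  proof (cases "{x, y} \<in> ?E1")
    case True then show ?thesis using G1.planar by (metis insert_absorb)
  next
    case False
    show ?thesis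
      using plane_graph.planar[OF G1.add_arc[OF assms(1-3) _ _ False]] assms(4) dis 1(2) by auto
  qed
  then have "planar (insert x V - {x}) (contract_edges (id(x := u)) (insert {x, y} ?E1))"
  proof (rule planar_contract)
    show "{u, x} \<in> insert {x, y} ?E1" "u \<noteq> x" using uV xV by auto
    show "e \<subseteq> insert x V \<and> card e = 2" if "e \<in> insert {x, y} ?E1" for e
    proof (cases "e = {x, y}")
      case True then show ?thesis using assms(4) xV by (auto simp: card_2_iff)
    next
      case False then show ?thesis using that G1.edge_sub G1.edge_card by blast
    qed
  qed
  moreover have "insert x V - {x} = V" using xV by auto
  moreover have "contract_edges (id(x := u)) (insert {x, y} ?E1) = insert {u, y} E"
    using edge_sub edge_card by (intro contract_edges_subdivided[OF _ ub(1) xV assms(4) e(4)]) auto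
  ultimately show ?thesis by simp
qed

text \<open>Subdividing \<open>f\<close> at \<open>y\<close> makes that end of the arc a vertex;
  then the end on \<open>e\<close> slides to \<open>u\<close>, and contracting \<open>{v, y}\<close>
  slides the other end to \<open>v\<close>. Because \<open>e \<noteq> f\<close>, the arc of
  \<open>e\<close> survives the subdivision unchanged.\<close>

lemma planar_add_through_arc:
  assumes \<sigma>: "arc \<sigma>" "pathstart \<sigma> = x" "pathfinish \<sigma> = y"
    and e: "e \<in> E" "x \<in> open_edge e" "u \<in> e"
    and f: "f \<in> E" "y \<in> open_edge f" "v \<in> f"
    and "e \<noteq> f" "u \<noteq> v"
    and dis: "path_image \<sigma> - {x, y} \<subseteq> - X"
  shows "planar V (insert {u, v} E)"
proof -
  obtain c where c: "f = {v, c}" "v \<noteq> c" using edge_doubleton[OF edge_card f(3)] f(1) by metis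
  have vc: "{v, c} \<in> E" "y \<in> open_edge {v, c}" using f c by auto
  have vV: "v \<in> V" "c \<in> V" using edge_sub[OF vc(1)] by auto
  have yV: "y \<notin> V" using open_edge_V[OF vc(1)] vc(2) by auto
  have uV: "u \<in> V" using edge_sub e by auto
  let ?E1 = "insert {v, y} (insert {y, c} (E - {{v, c}}))"
  obtain \<gamma>1 where 1: "plane_graph (insert y V) ?E1 \<gamma>1" "plane_graph.X (insert y V) ?E1 \<gamma>1 = X"
    and \<gamma>1: "\<And>f. f \<in> E \<Longrightarrow> f \<noteq> {v, c} \<Longrightarrow> \<gamma>1 f = \<gamma> f"
    using subdivide[OF vc] by metis
  interpret G1: plane_graph "insert y V" ?E1 \<gamma>1 by (rule 1(1))
  have "x \<in> G1.open_edge e"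
    using e \<gamma>1[of e] \<open>e \<noteq> f\<close> c by (simp add: G1.open_edge_def open_edge_def)
  then have "planar (insert y V) (insert {u, y} ?E1)"
    using G1.planar_slide[OF \<sigma>, of e u] e uV yV dis 1(2) \<open>e \<noteq> f\<close> c by auto
  then have "planar (insert y V - {y}) (contract_edges (id(y := v)) (insert {u, y} ?E1))"
  proof (rule planar_contract)
    show "{v, y} \<in> insert {u, y} ?E1" "v \<noteq> y" using vV yV by auto
    show "e \<subseteq> insert y V \<and> card e = 2" if "e \<in> insert {u, y} ?E1" for e
    proof (cases "e = {u, y}")
      case True then show ?thesis using uV yV by (auto simp: card_2_iff)
    next
      case False then show ?thesis using that G1.edge_sub G1.edge_card by blast
    qed
  qed
  moreover have "insert y V - {y} = V" using yV by auto
  moreover have "contract_edges (id(y := v)) (insert {y, u} ?E1) = insert {v, u} E"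
    using edge_sub edge_card \<open>u \<noteq> v\<close> by (intro contract_edges_subdivided[OF _ vc(1) yV uV]) auto
  ultimately show ?thesis by (simp add: insert_commute)
qed

end

section \<open>Theta curves and faces\<close>

definition arcs_between :: "complex \<Rightarrow> complex \<Rightarrow> (real \<Rightarrow> complex) \<Rightarrow> (real \<Rightarrow> complex) \<Rightarrow> bool" where
  "arcs_between p q c d \<longleftrightarrow> arc c \<and> arc d \<and> pathstart c = p \<and> pathfinish c = q \<and>
     pathstart d = p \<and> pathfinish d = q \<and> path_image c \<inter> path_image d = {p, q}"

lemma arcs_between_commute: "arcs_between p q c d \<longleftrightarrow> arcs_between p q d c"
  by (auto simp: arcs_between_def Int_commute)

lemma Jordan_two_arcs:
  assumes "arcs_between p q c d"
  defines "J \<equiv> path_image c \<union> path_image d"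
  shows "inside J \<noteq> {}" "open (inside J)" "connected (inside J)" "open (outside J)" "connected (outside J)"
    "bounded (inside J)" "\<not> bounded (outside J)" "frontier (inside J) = J" "frontier (outside J) = J"
    "closure (inside J) = inside J \<union> J" "compact J"
proof -
  have sp: "simple_path (c +++ reversepath d)" "path_image (c +++ reversepath d) = J"
    "pathfinish (c +++ reversepath d) = pathstart (c +++ reversepath d)"
    using assms by (auto simp: arcs_between_def path_image_join simple_path_join_loop_eq arc_reversepath)
  note * = Jordan_inside_outside[OF sp(1,3), unfolded sp(2)]
  show "inside J \<noteq> {}" "open (inside J)" "connected (inside J)" "open (outside J)" "connected (outside J)"
    "bounded (inside J)" "\<not> bounded (outside J)" and fr: "frontier (inside J) = J" and "frontier (outside J) = J"
    using * by auto
  show "closure (inside J) = inside J \<union> J" using closure_Un_frontier[of "inside J"] fr by simp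
  show "compact J" using assms by (auto simp: J_def arcs_between_def compact_arc_image)
qed

lemma connected_subset_inside:
  assumes "connected K" "K \<inter> J = {}" "K \<inter> inside J \<noteq> {}"
  shows "K \<subseteq> inside J"
proof
  fix y assume "y \<in> K"
  obtain x where x: "x \<in> K" "x \<in> inside J" using assms by auto
  have "connected_component (- J) x y"
    using assms x \<open>y \<in> K\<close> unfolding connected_component_def by (intro exI[of _ K]) auto
  then show "y \<in> inside J" using inside_same_component x by blast
qed

lemma connected_subset_outside:
  assumes "connected K" "K \<inter> J = {}" "K \<inter> outside J \<noteq> {}"
  shows "K \<subseteq> outside J"
proof -
  have "K \<inter> inside J = {}"
    using connected_subset_inside[OF assms(1,2)] assms(3) inside_Int_outside[of J] by blast
  then show ?thesis using assms(2) inside_Un_outside[of J] by blast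
qed

lemma closure_meets_open:
  assumes "open S" "S \<inter> closure K \<noteq> {}"
  shows "K \<inter> S \<noteq> {}"
  using open_Int_closure_eq_empty[OF assms(1), of K] assms(2) by blast

definition theta :: "complex \<Rightarrow> complex \<Rightarrow> (real \<Rightarrow> complex) \<Rightarrow> (real \<Rightarrow> complex) \<Rightarrow> (real \<Rightarrow> complex) \<Rightarrow> bool" where
  "theta p q c1 c2 c3 \<longleftrightarrow> arcs_between p q c1 c2 \<and> arcs_between p q c1 c3 \<and> arcs_between p q c2 c3"

text \<open>The region inside \<open>c1\<close> and \<open>c2\<close> misses the curve formed by
  \<open>c1\<close> and \<open>c3\<close>, so by connectedness it lies inside that curve;
  \<open>c2\<close> is in its closure.\<close>

lemma theta_inside_subset:
  assumes th: "theta p q c1 c2 c3"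
    and dis: "path_image c3 \<inter> inside (path_image c1 \<union> path_image c2) = {}"
    and meet: "inside (path_image c1 \<union> path_image c2) \<inter> inside (path_image c1 \<union> path_image c3) \<noteq> {}"
  shows "path_image c2 - {p, q} \<subseteq> inside (path_image c1 \<union> path_image c3)"
proof -
  have a12: "arcs_between p q c1 c2" and a13: "arcs_between p q c1 c3" and a23: "arcs_between p q c2 c3"
    using th by (auto simp: theta_def)
  note J12 = Jordan_two_arcs[OF a12] and J13 = Jordan_two_arcs[OF a13]
  let ?J12 = "path_image c1 \<union> path_image c2" and ?J13 = "path_image c1 \<union> path_image c3"
  have "inside ?J12 \<inter> ?J13 = {}" using dis inside_no_overlap[of ?J12] by blast
  then have "inside ?J12 \<subseteq> inside ?J13" using connected_subset_inside[OF J12(3)] meet by blast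
  then have "closure (inside ?J12) \<subseteq> inside ?J13 \<union> ?J13" using J13(10) closure_mono by metis
  then have "path_image c2 \<subseteq> inside ?J13 \<union> ?J13" using J12(10) by blast
  moreover have "path_image c2 \<inter> ?J13 \<subseteq> {p, q}"
    using a12 a23 by (auto simp: arcs_between_def)
  ultimately show ?thesis by blast
qed

text \<open>Here \<open>c2\<close> splits the inside of the curve \<open>c1\<close>,
  \<open>c3\<close> into two regions. A set \<open>K\<close> that approaches \<open>c2\<close> is
  inside that curve, and being outside the first region it is confined to the one between
  \<open>c2\<close> and \<open>c3\<close>, whose closure cannot reach the interior of
  \<open>c1\<close>.\<close>

lemma theta_two_sides_aux:
  assumes th: "theta p q c1 c2 c3"
    and dis: "path_image c3 \<inter> inside (path_image c1 \<union> path_image c2) = {}"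
    and meet: "inside (path_image c1 \<union> path_image c2) \<inter> inside (path_image c1 \<union> path_image c3) \<noteq> {}"
    and K: "connected K" "K \<inter> (path_image c1 \<union> path_image c2 \<union> path_image c3) = {}"
      "K \<inter> inside (path_image c1 \<union> path_image c2) = {}"
    and cl: "closure K \<inter> (path_image c1 - {p, q}) \<noteq> {}" "closure K \<inter> (path_image c2 - {p, q}) \<noteq> {}"
  shows False
proof -
  have a12: "arcs_between p q c1 c2" and a13: "arcs_between p q c1 c3" and a23: "arcs_between p q c2 c3"
    using th by (auto simp: theta_def)
  note J13 = Jordan_two_arcs[OF a13]
  let ?J12 = "path_image c1 \<union> path_image c2" and ?J13 = "path_image c1 \<union> path_image c3"
    and ?J32 = "path_image c3 \<union> path_image c2"
  have c2: "path_image c2 - {p, q} \<subseteq> inside ?J13" by (rule theta_inside_subset[OF th dis meet])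
  then have "K \<inter> inside ?J13 \<noteq> {}" using closure_meets_open[OF J13(2)] cl(2) by blast
  moreover have "K \<inter> ?J13 = {}" using K(2) by blast
  ultimately have K13: "K \<subseteq> inside ?J13" using connected_subset_inside[OF K(1)] by simp
  have pq: "p \<noteq> q" using a12 arc_distinct_ends[of c1] by (auto simp: arcs_between_def)
  have "path_image c2 \<inter> inside ?J13 \<noteq> {}" using c2 cl(2) by blast
  then have spl: "inside ?J12 \<union> inside ?J32 \<union> (path_image c2 - {p, q}) = inside ?J13"
    using split_inside_simple_closed_curve[of c1 p q c3 c2] a12 a13 a23 pq
    by (auto simp: arcs_between_def arc_imp_simple_path Int_commute)
  then have "K \<subseteq> inside ?J32" using K13 K by blast
  then have "closure K \<subseteq> inside ?J32 \<union> ?J32"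
    using Jordan_two_arcs(10)[of p q c3 c2] a23 arcs_between_commute closure_mono by metis
  then obtain z where z: "z \<in> path_image c1" "z \<notin> {p, q}" "z \<in> inside ?J32 \<union> ?J32" using cl(1) by blast
  have "z \<notin> ?J32" using z(1,2) a12 a13 by (auto simp: arcs_between_def)
  then have "z \<in> inside ?J13" using z spl by blast
  then show False using z(1) inside_no_overlap[of ?J13] by blast
qed

text \<open>The region bounded by two arcs of a theta curve, if the third arc does not enter it, is the
  only one that touches both of them.\<close>

lemma theta_two_sides:
  assumes th: "theta p q c1 c2 c3"
    and dis: "path_image c3 \<inter> inside (path_image c1 \<union> path_image c2) = {}"
    and K: "connected K" "K \<inter> (path_image c1 \<union> path_image c2 \<union> path_image c3) = {}"
      "K \<inter> inside (path_image c1 \<union> path_image c2) = {}"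
    and cl: "closure K \<inter> (path_image c1 - {p, q}) \<noteq> {}" "closure K \<inter> (path_image c2 - {p, q}) \<noteq> {}"
  shows False
proof -
  have a12: "arcs_between p q c1 c2" and a13: "arcs_between p q c1 c3" and a23: "arcs_between p q c2 c3"
    using th by (auto simp: theta_def)
  note J12 = Jordan_two_arcs[OF a12] and J13 = Jordan_two_arcs[OF a13] and J23 = Jordan_two_arcs[OF a23]
  let ?J12 = "path_image c1 \<union> path_image c2" and ?J13 = "path_image c1 \<union> path_image c3"
    and ?J23 = "path_image c2 \<union> path_image c3"
  obtain x where x: "x \<in> inside ?J12" using J12(1) by blast
  have x13: "x \<notin> ?J13" and x23: "x \<notin> ?J23" using x dis inside_no_overlap[of ?J12] by blast+
  consider "x \<in> inside ?J13" | "x \<in> inside ?J23" | "x \<notin> inside ?J13" "x \<notin> inside ?J23" by blast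
  then show False
  proof cases
    case 1 
    then show False using theta_two_sides_aux[OF th dis _ K cl] x by blast
  next
    case 2
    have th': "theta p q c2 c1 c3" using th arcs_between_commute unfolding theta_def by blast
    show False using theta_two_sides_aux[OF th', of K] dis K cl x 2 by (auto simp: Un_commute Un_ac)
  next
    case 3
    \<comment> \<open>Excluded by Janiszewski's theorem: \<open>x\<close> could be joined to a far
      point \<open>y\<close> off each of the curves \<open>?J13\<close> and \<open>?J23\<close>.
      They meet in the connected set \<open>c3\<close>, so it could be joined off their union, and
      in particular off \<open>?J12\<close>, which surrounds it.\<close>
    have "bounded (inside ?J12 \<union> ?J12 \<union> (inside ?J13 \<union> ?J13) \<union> (inside ?J23 \<union> ?J23))"
      using J12(6) J13(6) J23(6) compact_imp_bounded[OF J12(11)] compact_imp_bounded[OF J13(11)]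
        compact_imp_bounded[OF J23(11)] by simp
    then obtain y where y: "y \<notin> inside ?J12 \<union> ?J12 \<union> (inside ?J13 \<union> ?J13) \<union> (inside ?J23 \<union> ?J23)"
      by (metis UNIV_eq_I not_bounded_UNIV)
    have o13: "x \<in> outside ?J13" "y \<in> outside ?J13" and o23: "x \<in> outside ?J23" "y \<in> outside ?J23"
      using x13 x23 y 3 inside_Un_outside[of ?J13] inside_Un_outside[of ?J23] by blast+
    have "connected_component (- ?J13) x y"
      unfolding connected_component_def using o13 J13(5) outside_no_overlap[of ?J13] by blast
    moreover have "connected_component (- ?J23) x y"
      unfolding connected_component_def using o23 J23(5) outside_no_overlap[of ?J23] by blast
    moreover have "?J13 \<inter> ?J23 = path_image c3"
      using a12 a13 by (auto simp: arcs_between_def)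
    then have "connected (?J13 \<inter> ?J23)" using a13 by (simp add: arcs_between_def connected_arc_image)
    ultimately have "connected_component (- (?J13 \<union> ?J23)) x y"
      using Janiszewski[OF J13(11) compact_imp_closed[OF J23(11)]] by blast
    then have "connected_component (- ?J12) x y"
      by (rule connected_component_of_subset) auto
    then show False using inside_same_component[OF _ x] y by blast
  qed
qed

lemma theta_three_sides_aux:
  assumes th: "theta p q c1 c2 c3"
    and dis: "path_image c3 \<inter> inside (path_image c1 \<union> path_image c2) = {}"
    and K: "connected K" "K \<inter> (path_image c1 \<union> path_image c2 \<union> path_image c3) = {}"
    and cl: "closure K \<inter> (path_image c1 - {p, q}) \<noteq> {}" "closure K \<inter> (path_image c2 - {p, q}) \<noteq> {}"
      "closure K \<inter> (path_image c3 - {p, q}) \<noteq> {}"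
  shows False
proof (cases "K \<inter> inside (path_image c1 \<union> path_image c2) = {}")
  case True
  then show False using theta_two_sides[OF th dis K _ cl(1,2)] by blast
next
  case False
  have a12: "arcs_between p q c1 c2" and a13: "arcs_between p q c1 c3" and a23: "arcs_between p q c2 c3"
    using th by (auto simp: theta_def)
  let ?J12 = "path_image c1 \<union> path_image c2"
  have "K \<inter> ?J12 = {}" using K(2) by blast
  then have "K \<subseteq> inside ?J12" using connected_subset_inside[OF K(1)] False by simp
  then have "closure K \<subseteq> inside ?J12 \<union> ?J12" using Jordan_two_arcs(10)[OF a12] closure_mono by metis
  then show False using cl(3) dis a13 a23 by (auto simp: arcs_between_def)
qed

text \<open>The topological core of the exclusion of \<open>K_{2,3}\<close> around a face. If
  \<open>c3\<close> enters the region between \<open>c1\<close> and \<open>c2\<close>, it cuts that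
  region, and then \<open>c1\<close> does not enter the part between \<open>c2\<close> and
  \<open>c3\<close>; so the roles of the arcs can be rotated into the first case.\<close>

lemma theta_three_sides:
  assumes th: "theta p q c1 c2 c3"
    and K: "connected K" "K \<inter> (path_image c1 \<union> path_image c2 \<union> path_image c3) = {}"
    and cl: "closure K \<inter> (path_image c1 - {p, q}) \<noteq> {}" "closure K \<inter> (path_image c2 - {p, q}) \<noteq> {}"
      "closure K \<inter> (path_image c3 - {p, q}) \<noteq> {}"
  shows False
proof (cases "path_image c3 \<inter> inside (path_image c1 \<union> path_image c2) = {}")
  case True
  then show False using theta_three_sides_aux[OF th _ K cl] by blast
next
  case False
  have a12: "arcs_between p q c1 c2" and a13: "arcs_between p q c1 c3" and a23: "arcs_between p q c2 c3"
    using th by (auto simp: theta_def)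
  have pq: "p \<noteq> q" using a12 arc_distinct_ends[of c1] by (auto simp: arcs_between_def)
  have "inside (path_image c2 \<union> path_image c3) \<subseteq> inside (path_image c1 \<union> path_image c2)"
    using split_inside_simple_closed_curve[of c1 p q c2 c3] a12 a13 a23 pq False
    by (auto simp: arcs_between_def arc_imp_simple_path Int_commute)
  then have "path_image c1 \<inter> inside (path_image c2 \<union> path_image c3) = {}"
    using inside_no_overlap[of "path_image c1 \<union> path_image c2"] by blast
  moreover have "theta p q c2 c3 c1" using th arcs_between_commute unfolding theta_def by blast
  ultimately show False using theta_three_sides_aux[of p q c2 c3 c1 K] K cl by (auto simp: Un_ac)
qed

section \<open>Faces of a plane graph and the edges on them\<close>

context plane_graph
begin

abbreviation "pim e \<equiv> path_image (\<gamma> e)"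

definition faces :: "complex set set" where "faces = components (- X)"

text \<open>The point of contact has to be interior to the edge: touching a mere end is not enough.
  This relation takes the place of boundary walks.\<close>

definition on_face :: "complex set \<Rightarrow> complex set \<Rightarrow> bool" where
  "on_face F e \<longleftrightarrow> closure F \<inter> open_edge e \<noteq> {}"

lemma compact_pim: "e \<in> E \<Longrightarrow> compact (pim e)"
  by (simp add: arcE compact_arc_image)

lemma compact_X: "compact X"
  unfolding X_def using finV finE compact_pim by (intro compact_Un compact_UN) (auto intro: finite_imp_compact)

lemma pim_sub_X: "e \<in> E \<Longrightarrow> pim e \<subseteq> X"
  by (auto simp: X_def)

lemma edge_sub_pim: "e \<in> E \<Longrightarrow> e \<subseteq> pim e"
  using VE by blast

lemma open_edge_eq: "e \<in> E \<Longrightarrow> open_edge e = \<gamma> e ` {0<..<1}"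
  using simple_path_endless[OF arc_imp_simple_path[OF arcE]] endsE by (metis open_edge_def)

lemma connected_open_edge: "e \<in> E \<Longrightarrow> connected (open_edge e)"
  using connected_simple_path_endless[OF arc_imp_simple_path[OF arcE]] endsE by (metis open_edge_def)

lemma open_edge_nonempty: "e \<in> E \<Longrightarrow> open_edge e \<noteq> {}"
  by (simp add: open_edge_eq)

lemma pim_sub_closure: 
  assumes "e \<in> E" shows "pim e \<subseteq> closure (open_edge e)"
proof -
  have "closure {0<..<1} = {0..(1::real)}" by simp
  moreover have "continuous_on {0..1} (\<gamma> e)" using arcE[OF assms] by (simp add: arc_def path_def)
  ultimately have "\<gamma> e ` closure {0<..<1} \<subseteq> closure (open_edge e)"
    by (intro image_closure_subset) (use closure_subset open_edge_eq[OF assms] in auto)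
  then show ?thesis by (simp add: path_image_def)
qed

lemma open_edge_Un_end: "e \<in> E \<Longrightarrow> connected (insert u (open_edge e))" if "u \<in> e"
proof -
  assume e: "e \<in> E"
  have "insert u (open_edge e) \<subseteq> closure (open_edge e)"
    using pim_sub_closure[OF e] edge_sub_pim[OF e] that closure_subset[of "open_edge e"] by blast
  then show ?thesis using connected_intermediate_closure[OF connected_open_edge[OF e]] by blast
qed

lemma faceD:
  assumes "F \<in> faces"
  shows "open F" "connected F" "F \<inter> X = {}" "F \<noteq> {}" "frontier F \<subseteq> X" "closure F \<subseteq> F \<union> X"
proof -
  have op: "open (- X)" using compact_X by (simp add: compact_imp_closed open_Compl)
  show "open F" "connected F" "F \<inter> X = {}" "F \<noteq> {}"
    using assms op open_components in_components_connected in_components_subset in_components_nonempty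
    unfolding faces_def by blast+
  have "frontier F \<subseteq> frontier (- X)" using assms frontier_of_components_subset unfolding faces_def by blast
  also have "\<dots> \<subseteq> X"
    using frontier_subset_closed[OF compact_imp_closed[OF compact_X]] by (simp add: frontier_complement)
  finally show fr: "frontier F \<subseteq> X" .
  show "closure F \<subseteq> F \<union> X" using fr closure_Un_frontier[of F] by blast
qed

text \<open>Off this closed set the only visible part of the drawing is the interior of
  \<open>e\<close>, which makes arguments near an interior point of \<open>e\<close> local.\<close>

definition rest :: "complex set \<Rightarrow> complex set" where
  "rest e = V \<union> (\<Union>f\<in>E - {e}. pim f)"

lemma closed_rest: "closed (rest e)"
  unfolding rest_def using finV finE compact_pim
  by (intro compact_imp_closed compact_Un compact_UN) (auto intro: finite_imp_compact)

lemma open_edge_rest: "e \<in> E \<Longrightarrow> open_edge e = X - rest e"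
  using open_edge_Int[of e] open_edge_V[of e] edge_sub[of e] unfolding X_def rest_def open_edge_def
  by blast

lemma openin_frontier_open_edge:
  assumes "e \<in> E" "F \<in> faces"
  shows "openin (top_of_set (frontier F)) (open_edge e \<inter> frontier F)"
proof -
  have "open_edge e \<inter> frontier F = frontier F \<inter> - rest e"
    using open_edge_rest[OF assms(1)] faceD(5)[OF assms(2)] by blast
  then show ?thesis using closed_rest[of e] by (metis openin_open_Int open_Compl)
qed

lemma on_face_frontier:
  assumes "F \<in> faces" "e \<in> E" "on_face F e"
  shows "open_edge e \<inter> frontier F \<noteq> {}"
proof -
  obtain z where z: "z \<in> closure F" "z \<in> open_edge e" using assms(3) by (auto simp: on_face_def)
  have "z \<notin> F" using z(2) open_edge_rest[OF assms(2)] faceD(3)[OF assms(1)] by auto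
  then show ?thesis using z faceD(1)[OF assms(1)] by (auto simp: frontier_def interior_open)
qed

text \<open>Pairs of frontier points that can be joined by an arc through the face are dense, and
  the interior of an edge is relatively open in the frontier. So the ends can be prescribed to lie
  on \<open>e\<close> and \<open>f\<close>, though not at chosen vertices; moving them there is left
  to the sliding of ends.\<close>

lemma cofacial_arc:
  assumes F: "F \<in> faces" and e: "e \<in> E" "on_face F e" and f: "f \<in> E" "on_face F f" and "e \<noteq> f"
  obtains \<sigma> where "arc \<sigma>" "pathstart \<sigma> \<in> open_edge e" "pathfinish \<sigma> \<in> open_edge f"
    "path_image \<sigma> - {pathstart \<sigma>, pathfinish \<sigma>} \<subseteq> - X"
proof -
  have "open_edge e \<inter> open_edge f = {}"
    using open_edge_Int[OF e(1) f(1) \<open>e \<noteq> f\<close>] by (auto simp: open_edge_def)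
  then have ne: "open_edge e \<inter> frontier F \<noteq> open_edge f \<inter> frontier F"
    using on_face_frontier[OF F e] by blast
  obtain g where g: "arc g" "pathstart g \<in> open_edge e \<inter> frontier F" "pathfinish g \<in> open_edge f \<inter> frontier F"
    "g ` {0<..<1} \<subseteq> F"
    using dense_accessible_frontier_point_pairs[OF faceD(1,2)[OF F] openin_frontier_open_edge[OF e(1) F]
        openin_frontier_open_edge[OF f(1) F] on_face_frontier[OF F e] on_face_frontier[OF F f] ne] .
  have "path_image g - {pathstart g, pathfinish g} = g ` {0<..<1}"
    using simple_path_endless arc_imp_simple_path g(1) by blast
  then have "path_image g - {pathstart g, pathfinish g} \<subseteq> - X" using g(4) faceD(3)[OF F] by blast
  then show ?thesis using that g by blast
qed

lemma cofacial_add: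
  assumes "F \<in> faces" "e \<in> E" "on_face F e" "f \<in> E" "on_face F f" "e \<noteq> f" "u \<in> e" "v \<in> f" "u \<noteq> v"
  shows "planar V (insert {u, v} E)"
proof -
  obtain \<sigma> where "arc \<sigma>" "pathstart \<sigma> \<in> open_edge e" "pathfinish \<sigma> \<in> open_edge f"
    "path_image \<sigma> - {pathstart \<sigma>, pathfinish \<sigma>} \<subseteq> - X"
    using cofacial_arc[OF assms(1-6)] .
  then show ?thesis using planar_add_through_arc[OF _ refl refl] assms by blast
qed

lemma cofacial_identify:
  assumes "F \<in> faces" "e \<in> E" "on_face F e" "f \<in> E" "on_face F f" "e \<noteq> f" "u \<in> e" "v \<in> f" "u \<noteq> v"
  shows "planar (V - {v}) (contract_edges (id(v := u)) E)"
proof -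
  have uv: "u \<in> V" "v \<in> V" using assms edge_sub by blast+
  have "planar (V - {v}) (contract_edges (id(v := u)) (insert {u, v} E))"
    using cofacial_add[OF assms] by (rule planar_contract) (use uv assms edge_sub edge_card in auto)
  moreover have "(id(v := u)) ` {u, v} = {u}" by (auto simp: fun_upd_def)
  then have "contract_edges (id(v := u)) (insert {u, v} E) = contract_edges (id(v := u)) E"
    by (auto simp only: contract_edges_def image_insert) auto
  ultimately show ?thesis by simp
qed

text \<open>In a small ball about \<open>z\<close> the drawing consists of \<open>e\<close> alone. A
  point of \<open>D\<close> in that ball lies in some face, and the segment from it to
  \<open>z\<close> has to leave this face through \<open>e\<close>. The set \<open>D\<close>
  prescribes the side of the edge on which the face is found.\<close>

lemma face_near_edge:
  assumes e: "e \<in> E" and z: "z \<in> open_edge e" "z \<in> closure D" and D: "D \<inter> pim e = {}"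
  obtains F where "F \<in> faces" "on_face F e" "F \<inter> D \<noteq> {}"
proof -
  have zX: "z \<in> X" using z(1) pim_sub_X[OF e] by (auto simp: open_edge_def)
  have "z \<in> - rest e" using open_edge_rest[OF e] z by blast
  then obtain r where r: "r > 0" "ball z r \<subseteq> - rest e"
    using closed_rest open_Compl openE by metis
  then obtain w where w: "w \<in> D" "dist w z < r" using z(2) closure_approachable by blast
  have ballX: "y \<in> open_edge e" if "y \<in> X" "y \<in> ball z r" for y
    using open_edge_rest[OF e] that r by blast
  have "w \<notin> X" using ballX[of w] w D by (auto simp: open_edge_def dist_commute)
  then obtain F where F: "F \<in> faces" "w \<in> F" unfolding faces_def
    by (metis ComplI UnionE Union_components)
  have "closed_segment w z \<inter> frontier F \<noteq> {}"
    using connected_Int_frontier[of "closed_segment w z" F] F zX faceD(3)[OF F(1)] by auto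
  then obtain y where y: "y \<in> closed_segment w z" "y \<in> frontier F" by auto
  have "closed_segment w z \<subseteq> ball z r"
    by (rule closed_segment_subset) (use w r in \<open>auto simp: dist_commute\<close>)
  then have "y \<in> open_edge e" using ballX y faceD(5)[OF F(1)] by blast
  moreover have "y \<in> closure F" using y by (simp add: frontier_def)
  ultimately have "on_face F e" by (auto simp: on_face_def)
  then show ?thesis using that F w by blast
qed

text \<open>An arc has empty interior, so its complement is dense and approaches every point of the
  edge.\<close>

lemma edge_on_some_face:
  assumes e: "e \<in> E"
  obtains F where "F \<in> faces" "on_face F e"
proof -
  obtain z where z: "z \<in> open_edge e" using open_edge_nonempty[OF e] by blast
  have "closure (- pim e) = UNIV"
    using arc_interior_empty[OF arcE[OF e]] by (simp add: closure_complement)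
  then show ?thesis using face_near_edge[OF e z, of "- pim e"] that by auto
qed

text \<open>By Janiszewski's theorem, a union of two sets that do not separate does not separate
  either if they meet in a connected set; edges at \<open>a\<close> meet only in
  \<open>a\<close>.\<close>

lemma connected_star_complement:
  assumes "finite T" "T \<subseteq> {e \<in> E. a \<in> e}"
  shows "connected (- (\<Union>e\<in>T. pim e))"
  using assms
proof (induction T)
  case empty
  have "connected (UNIV :: complex set)" by (rule convex_connected) simp
  then show ?case by simp
next
  case (insert e T)
  have e: "e \<in> E" "a \<in> e" using insert.prems by auto
  have int: "pim e \<inter> (\<Union>f\<in>T. pim f) \<subseteq> {a}"
  proof
    fix z assume z: "z \<in> pim e \<inter> (\<Union>f\<in>T. pim f)"
    then obtain f where f: "f \<in> T" "z \<in> pim f" by blast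
    then have fE: "f \<in> E" "a \<in> f" "e \<noteq> f" using insert by auto
    then have "z \<in> e \<inter> f" using EE[OF e(1) fE(1,3)] z f by blast
    moreover obtain b where "e = {a, b}" using edge_doubleton[OF edge_card[OF e(1)] e(2)] by blast
    moreover obtain c where "f = {a, c}" using edge_doubleton[OF edge_card[OF fE(1)] fE(2)] by blast
    ultimately show "z \<in> {a}" using fE(3) by auto
  qed
  have "connected (- (pim e \<union> (\<Union>f\<in>T. pim f)))"
  proof (rule Janiszewski_connected)
    show "compact (pim e)" by (rule compact_pim[OF e(1)])
    show "closed (\<Union>f\<in>T. pim f)"
      using insert compact_pim by (intro compact_imp_closed compact_UN) auto
    show "connected (pim e \<inter> (\<Union>f\<in>T. pim f))"
      using int by (metis connected_empty connected_sing subset_singletonD)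
    show "connected (- pim e)" using connected_arc_complement[OF arcE[OF e(1)]] by simp
    show "connected (- (\<Union>f\<in>T. pim f))" using insert by auto
  qed
  then show ?case by simp
qed

text \<open>A star does not separate the plane, so a face whose frontier only uses edges of a star at \<open>a\<close>
  is the whole complement of that star.\<close>

lemma face_star:
  assumes F: "F \<in> faces" and star: "\<And>e. e \<in> E \<Longrightarrow> on_face F e \<Longrightarrow> a \<in> e" and e: "e \<in> E"
  shows "a \<in> e"
proof -
  define T where "T = {e \<in> E. a \<in> e}"
  define S where "S = V \<union> (\<Union>e\<in>T. pim e)"
  have finT: "finite T" using finE by (simp add: T_def)
  have clT: "closed (\<Union>e\<in>T. pim e)"
    using finT compact_pim by (intro compact_imp_closed compact_UN) (auto simp: T_def)
  have "connected (- (\<Union>e\<in>T. pim e))"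
    using connected_star_complement[OF finT] by (auto simp: T_def)
  then have "connected (- (\<Union>e\<in>T. pim e) - V)"
    using connected_open_delete_finite[OF open_Compl[OF clT] _ _ finV] by simp
  moreover have "- (\<Union>e\<in>T. pim e) - V = - S" by (auto simp: S_def)
  ultimately have conn: "connected (- S)" by simp
  have "frontier F \<subseteq> S"
  proof
    fix z assume z: "z \<in> frontier F"
    then have "z \<in> X" using faceD(5)[OF F] by blast
    then consider "z \<in> V" | f where "f \<in> E" "z \<in> pim f" "z \<notin> V" by (auto simp: X_def)
    then show "z \<in> S"
    proof cases
      case 1 then show ?thesis by (simp add: S_def)
    next
      case 2
      then have "z \<in> open_edge f" using edge_sub by (auto simp: open_edge_def)
      then have "on_face F f" using z by (auto simp: on_face_def frontier_def)
      then show ?thesis using star 2 by (auto simp: S_def T_def)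
    qed
  qed
  moreover have "S \<subseteq> X" by (auto simp: S_def T_def X_def)
  moreover have "F \<inter> X = {}" "F \<noteq> {}" using faceD[OF F] by auto
  \<comment> \<open>The connected set \<open>- S\<close> meets \<open>F\<close> but not its
    frontier, so it is contained in \<open>F\<close>.\<close>
  ultimately have "- S - F = {}" using connected_Int_frontier[OF conn, of F] by blast
  then have XS: "X \<subseteq> S" using \<open>F \<inter> X = {}\<close> by blast
  obtain z where z: "z \<in> open_edge e" using open_edge_nonempty[OF e] by blast
  then have "z \<in> S" "z \<notin> V" using XS open_edge_V[OF e] pim_sub_X[OF e] by (auto simp: open_edge_def)
  then obtain f where f: "f \<in> T" "z \<in> pim f" by (auto simp: S_def)
  then have "e = f" using open_edge_Int[OF e, of f] z by (auto simp: T_def)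
  then show ?thesis using f by (simp add: T_def)
qed

end

section \<open>Identifying two vertices of the same side\<close>

text \<open>The outside of \<open>J\<close> is connected and unbounded and misses \<open>J'\<close>,
  so it belongs to the outside of \<open>J'\<close>. Points of \<open>J\<close> itself are excluded
  because they are limits of outside points while the inside of \<open>J'\<close> is open.\<close>

lemma inside_subset_inside:
  assumes a: "arcs_between p q c d" and J: "J = path_image c \<union> path_image d"
    and J': "J' \<subseteq> inside J \<union> J" "compact J'"
  shows "inside J' \<subseteq> inside J"
proof -
  note Jd = Jordan_two_arcs[OF a, folded J]
  have dis: "outside J \<inter> J' = {}" using J'(1) inside_Int_outside[of J] outside_no_overlap[of J] by blast
  have out: "outside J \<subseteq> outside J'"
  proof
    fix y assume y: "y \<in> outside J"
    then have "outside J \<subseteq> connected_component_set (- J') y"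
      using connected_component_maximal[OF y Jd(5)] dis by blast
    then have "\<not> bounded (connected_component_set (- J') y)" using Jd(7) bounded_subset by blast
    then show "y \<in> outside J'" using y dis by (auto simp: outside_def)
  qed
  have op: "open (inside J')" using J'(2) by (simp add: open_inside compact_imp_closed)
  show ?thesis
  proof
    fix y assume y: "y \<in> inside J'"
    then have "y \<notin> outside J" using out inside_Int_outside[of J'] by blast
    moreover have "y \<notin> J"
    proof
      assume "y \<in> J"
      then have "y \<in> closure (outside J)" using Jd(9) by (auto simp: frontier_def)
      then have "outside J \<inter> inside J' \<noteq> {}" using closure_meets_open[OF op] y by blast
      then show False using out inside_Int_outside[of J'] by blast
    qed
    ultimately show "y \<in> inside J" using inside_Un_outside[of J] by blast
  qed
qed

context plane_graph
begin

definition common :: "complex \<Rightarrow> complex \<Rightarrow> complex set" where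
  "common u v = {w. {u, w} \<in> E \<and> {v, w} \<in> E}"

definition P2 :: "complex \<Rightarrow> complex \<Rightarrow> complex \<Rightarrow> complex set" where
  "P2 a b c = pim {a, b} \<union> pim {b, c}"

text \<open>A 4-cycle in cyclic order, read as two paths of length 2 between the opposite corners
  \<open>a\<close> and \<open>a'\<close>; this matches \<open>arcs_between\<close>, so the Jordan
  curve facts apply to its point set \<open>Q\<close>.\<close>

definition quad :: "complex \<Rightarrow> complex \<Rightarrow> complex \<Rightarrow> complex \<Rightarrow> bool" where
  "quad a b a' b' \<longleftrightarrow> a \<noteq> a' \<and> b \<noteq> b' \<and> {a, b} \<in> E \<and> {b, a'} \<in> E \<and> {a, b'} \<in> E \<and> {b', a'} \<in> E"

abbreviation "Q a b a' b' \<equiv> P2 a b a' \<union> P2 a b' a'"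

lemma edge_neq: "{u, v} \<in> E \<Longrightarrow> u \<noteq> v"
  using edge_card by fastforce

lemma pim_Int: "e \<in> E \<Longrightarrow> f \<in> E \<Longrightarrow> z \<in> pim e \<Longrightarrow> z \<in> pim f \<Longrightarrow> e = f \<or> z \<in> e \<inter> f"
  using EE by blast

lemma path2_arc:
  assumes "{a, b} \<in> E" "{b, c} \<in> E" "a \<noteq> c"
  obtains g where "arc g" "pathstart g = a" "pathfinish g = c" "path_image g = P2 a b c"
proof -
  obtain g where g: "arc g" "pathstart g = a" "pathfinish g = b" "path_image g = pim {a, b}"
    using edge_arc[OF assms(1)] .
  obtain h where h: "arc h" "pathstart h = b" "pathfinish h = c" "path_image h = pim {b, c}"
    using edge_arc[OF assms(2)] .
  have "{a, b} \<noteq> {b, c}" using assms(3) by (auto simp: doubleton_eq_iff)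
  then have "pim {a, b} \<inter> pim {b, c} \<subseteq> {b}"
    using EE[OF assms(1,2)] assms(3) by auto
  then have "arc (g +++ h)" using g h by (intro arc_join) auto
  then show ?thesis using that[of "g +++ h"] g h by (simp add: P2_def path_image_join)
qed

lemma P2_Int:
  assumes "{a, b} \<in> E" "{b, a'} \<in> E" "{a, b'} \<in> E" "{b', a'} \<in> E" "a \<noteq> a'" "b \<noteq> b'"
  shows "P2 a b a' \<inter> P2 a b' a' = {a, a'}"
proof
  have "a \<noteq> b" "a' \<noteq> b" "a \<noteq> b'" "a' \<noteq> b'" using assms edge_neq by metis+
  then have ne: "{a, b} \<noteq> {a, b'}" "{a, b} \<noteq> {b', a'}" "{b, a'} \<noteq> {a, b'}" "{b, a'} \<noteq> {b', a'}"
    using assms by (auto simp: doubleton_eq_iff)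
  show "P2 a b a' \<inter> P2 a b' a' \<subseteq> {a, a'}"
    using EE[OF assms(1,3) ne(1)] EE[OF assms(1,4) ne(2)] EE[OF assms(2,3) ne(3)] EE[OF assms(2,4) ne(4)]
      \<open>a \<noteq> b\<close> \<open>a' \<noteq> b\<close> \<open>a \<noteq> b'\<close> \<open>a' \<noteq> b'\<close> assms(5,6) unfolding P2_def by blast
  show "{a, a'} \<subseteq> P2 a b a' \<inter> P2 a b' a'"
    using edge_sub_pim[OF assms(1)] edge_sub_pim[OF assms(2)] edge_sub_pim[OF assms(3)] edge_sub_pim[OF assms(4)]
    by (auto simp: P2_def)
qed

lemma quad_arcs:
  assumes "quad a b a' b'"
  obtains c d where "arcs_between a a' c d" "path_image c = P2 a b a'" "path_image d = P2 a b' a'"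
proof -
  have q: "{a, b} \<in> E" "{b, a'} \<in> E" "{a, b'} \<in> E" "{b', a'} \<in> E" "a \<noteq> a'" "b \<noteq> b'"
    using assms by (auto simp: quad_def)
  obtain c where "arc c" "pathstart c = a" "pathfinish c = a'" "path_image c = P2 a b a'"
    using path2_arc[OF q(1,2,5)] .
  moreover obtain d where "arc d" "pathstart d = a" "pathfinish d = a'" "path_image d = P2 a b' a'"
    using path2_arc[OF q(3,4,5)] .
  ultimately show ?thesis using that P2_Int[OF q] by (auto simp: arcs_between_def)
qed

lemma Q_Int_V:
  assumes "quad a b a' b'" shows "Q a b a' b' \<inter> V = {a, b, a', b'}"
  using assms VE unfolding quad_def P2_def by blast

lemma Q_sub_X: "quad a b a' b' \<Longrightarrow> Q a b a' b' \<subseteq> X"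
  using pim_sub_X by (auto simp: quad_def P2_def)

lemma edge_Int_Q:
  assumes "quad a b a' b'" "{u, v} \<in> E" "u \<notin> Q a b a' b'"
  shows "pim {u, v} \<inter> Q a b a' b' \<subseteq> {v}"
proof
  fix z assume z: "z \<in> pim {u, v} \<inter> Q a b a' b'"
  then obtain g where g: "g \<in> E" "z \<in> pim g" "pim g \<subseteq> Q a b a' b'"
    using assms(1) unfolding quad_def P2_def by blast
  then have "u \<notin> g" using assms(3) edge_sub_pim by blast
  then show "z \<in> {v}" using pim_Int[OF assms(2) g(1), of z] z g(2) by auto
qed

text \<open>Without its end \<open>v\<close> the edge is connected and misses the cycle, so it
  cannot cross it.\<close>

lemma edge_from_inside:
  assumes q: "quad a b a' b'" and uv: "{u, v} \<in> E" and u: "u \<in> inside (Q a b a' b')"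
  shows "open_edge {u, v} \<subseteq> inside (Q a b a' b')" "pim {u, v} \<subseteq> inside (Q a b a' b') \<union> Q a b a' b'"
proof -
  let ?J = "Q a b a' b'"
  have uJ: "u \<notin> ?J" using u inside_no_overlap[of ?J] by blast
  have "insert u (open_edge {u, v}) \<inter> ?J = {}"
    using edge_Int_Q[OF q uv uJ] uJ by (auto simp: open_edge_def)
  then have sub: "insert u (open_edge {u, v}) \<subseteq> inside ?J"
    using connected_subset_inside[OF open_edge_Un_end[OF _ uv]] u by blast
  then show "open_edge {u, v} \<subseteq> inside ?J" by blast
  obtain c d where cd: "arcs_between a a' c d" "path_image c = P2 a b a'" "path_image d = P2 a b' a'"
    using quad_arcs[OF q] .
  have "pim {u, v} \<subseteq> closure (inside ?J)"
    using pim_sub_closure[OF uv] closure_mono[of "open_edge {u, v}" "inside ?J"] sub by blast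
  then show "pim {u, v} \<subseteq> inside ?J \<union> ?J" using Jordan_two_arcs(10)[OF cd(1)] cd by simp
qed

lemma edge_from_outside:
  assumes q: "quad a b a' b'" and uv: "{u, v} \<in> E" and u: "u \<in> outside (Q a b a' b')"
  shows "open_edge {u, v} \<subseteq> outside (Q a b a' b')"
proof -
  let ?J = "Q a b a' b'"
  have uJ: "u \<notin> ?J" using u outside_no_overlap[of ?J] by blast
  have "insert u (open_edge {u, v}) \<inter> ?J = {}"
    using edge_Int_Q[OF q uv uJ] uJ by (auto simp: open_edge_def)
  then show ?thesis
    using connected_subset_outside[OF open_edge_Un_end[OF _ uv]] u by blast
qed

end

section \<open>Bipartite plane graphs and innermost 4-cycles\<close>

locale plane_bipartite = plane_graph +
  fixes s :: "complex \<Rightarrow> bool"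
  assumes col: "\<And>u v. {u, v} \<in> E \<Longrightarrow> s u \<noteq> s v"
begin

text \<open>On a 4-cycle any two corners of different colours are consecutive. Hence a 4-cycle of a
  bipartite graph has no chords.\<close>

lemma quad_edge:
  assumes q: "quad a b a' b'" and "x \<in> {a, b, a', b'}" "y \<in> {a, b, a', b'}" "s x \<noteq> s y"
  shows "{x, y} \<in> E" "pim {x, y} \<subseteq> Q a b a' b'"
proof -
  have c: "s a \<noteq> s b" "s b \<noteq> s a'" "s a \<noteq> s b'" "s b' \<noteq> s a'"
    using q col by (auto simp: quad_def)
  have "{x, y} = {a, b} \<or> {x, y} = {b, a'} \<or> {x, y} = {a, b'} \<or> {x, y} = {b', a'}"
    using assms(2-4) c by (auto simp: insert_commute)
  then have "{x, y} \<in> E \<and> pim {x, y} \<subseteq> Q a b a' b'"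
    using q unfolding quad_def P2_def by (elim disjE) auto
  then show "{x, y} \<in> E" "pim {x, y} \<subseteq> Q a b a' b'" by auto
qed

lemma edge_color:
  assumes "e \<in> E"
  obtains v where "v \<in> e" "s v = t"
proof -
  obtain u w where "e = {u, w}" using edge_card[OF assms] by (auto simp: card_2_iff)
  then show ?thesis using that col assms by blast
qed

text \<open>Now suppose that no two cofacial vertices of the same side can be identified because they all
  have at least three common neighbours.\<close>

context
  assumes noiso: "V = \<Union>E"
    and nostar: "\<And>a. \<exists>e\<in>E. a \<notin> e"
    and many: "\<And>F e f u v. F \<in> faces \<Longrightarrow> e \<in> E \<Longrightarrow> on_face F e \<Longrightarrow> f \<in> E \<Longrightarrow> on_face F f \<Longrightarrow>
      u \<in> e \<Longrightarrow> v \<in> f \<Longrightarrow> u \<noteq> v \<Longrightarrow> s u = s v \<Longrightarrow> 3 \<le> card (common u v)"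
begin

text \<open>As the graph is no star, \<open>face_star\<close> gives an edge on the face that avoids
  \<open>u\<close>; the end of this edge with the colour of \<open>u\<close> is the vertex
  wanted.\<close>

lemma face_other_end:
  assumes "F \<in> faces"
  obtains f v where "f \<in> E" "on_face F f" "v \<in> f" "v \<noteq> u" "s v = s u"
proof -
  obtain f where f: "f \<in> E" "on_face F f" "u \<notin> f"
    using face_star[OF assms, of u] nostar[of u] by blast
  obtain v where v: "v \<in> f" "s v = s u" using edge_color[OF f(1)] by blast
  then show ?thesis using that f by blast
qed

lemma third_common:
  assumes "3 \<le> card (common u v)"
  obtains w where "w \<in> common u v" "w \<noteq> x" "w \<noteq> y"
proof -
  have "\<not> common u v \<subseteq> {x, y}"
  proof
    assume "common u v \<subseteq> {x, y}"
    then have "card (common u v) \<le> card {x, y}" by (intro card_mono) auto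
    also have "\<dots> \<le> 2" by (simp add: card_insert_if)
    finally show False using assms by simp
  qed
  then show ?thesis using that by blast
qed

lemma quad_of_common:
  assumes "3 \<le> card (common u v)" "u \<noteq> v"
  obtains w w' where "quad u w v w'"
proof -
  obtain w where w: "w \<in> common u v" using third_common[OF assms(1)] by blast
  obtain w' where w': "w' \<in> common u v" "w' \<noteq> w" using third_common[OF assms(1)] by blast
  show ?thesis using that[of w w'] w w' assms(2) by (auto simp: quad_def common_def insert_commute)
qed

text \<open>A face at \<open>u\<close> lies inside the cycle and sees a second vertex
  \<open>v\<close> of the colour of \<open>u\<close>. Their common neighbours yield a 4-cycle
  through \<open>u\<close> and \<open>v\<close> that stays in the closed region. It has
  \<open>u\<close> on it rather than inside, so it encloses fewer vertices.\<close>

lemma quad_smaller: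
  assumes q: "quad a b a' b'" and u: "u \<in> V" "u \<in> inside (Q a b a' b')"
  obtains c d c' d' where "quad c d c' d'" "card (V \<inter> inside (Q c d c' d')) < card (V \<inter> inside (Q a b a' b'))"
proof -
  let ?J = "Q a b a' b'"
  obtain c d where cd: "arcs_between a a' c d" "path_image c = P2 a b a'" "path_image d = P2 a b' a'"
    using quad_arcs[OF q] .
  have Jcd: "?J = path_image c \<union> path_image d" using cd by simp
  note Jd = Jordan_two_arcs[OF cd(1), folded Jcd]
  obtain e where e: "e \<in> E" "u \<in> e" using noiso u by blast
  obtain x where x: "e = {u, x}" using edge_doubleton[OF edge_card[OF e(1)] e(2)] by blast
  obtain F where F: "F \<in> faces" "on_face F e" using edge_on_some_face[OF e(1)] .
  have "open_edge e \<subseteq> inside ?J" using edge_from_inside(1)[OF q] e x u by blast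
  then have "inside ?J \<inter> closure F \<noteq> {}" using F(2) by (auto simp: on_face_def)
  then have "F \<inter> inside ?J \<noteq> {}" using closure_meets_open[OF Jd(2)] by simp
  moreover have "F \<inter> ?J = {}" using faceD(3)[OF F(1)] Q_sub_X[OF q] by blast
  ultimately have "F \<subseteq> inside ?J" using connected_subset_inside[OF faceD(2)[OF F(1)]] by simp
  then have clF: "closure F \<subseteq> inside ?J \<union> ?J" using closure_mono Jd(10) by metis
  obtain f v where f: "f \<in> E" "on_face F f" "v \<in> f" "v \<noteq> u" "s v = s u"
    using face_other_end[OF F(1)] .
  have vJ: "v \<in> inside ?J \<union> ?J"
  proof (rule ccontr)
    assume "v \<notin> inside ?J \<union> ?J"
    then have "v \<in> outside ?J" using inside_Un_outside[of ?J] by blast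
    moreover obtain y where "f = {v, y}" using edge_doubleton[OF edge_card[OF f(1)] f(3)] by blast
    ultimately have "open_edge f \<subseteq> outside ?J" using edge_from_outside[OF q] f(1) by blast
    then show False using f(2) clF inside_Int_outside[of ?J] outside_no_overlap[of ?J]
      unfolding on_face_def by blast
  qed
  obtain w w' where q': "quad u w v w'"
    using quad_of_common many[OF F(1) e(1) F(2) f(1,2) e(2) f(3)] f by metis
  \<comment> \<open>An edge with an end strictly inside cannot leave the region. If both
    \<open>y\<close> and \<open>v\<close> are corners of the cycle, the edge between them is one of
    its four edges.\<close>
  have two: "pim {u, y} \<subseteq> inside ?J \<union> ?J \<and> pim {y, v} \<subseteq> inside ?J \<union> ?J" if y: "{u, y} \<in> E" "{y, v} \<in> E" for y
  proof
    show uy: "pim {u, y} \<subseteq> inside ?J \<union> ?J" using edge_from_inside(2)[OF q y(1) u(2)] .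
    have vy: "{v, y} \<in> E" using y by (simp add: insert_commute)
    have yJ: "y \<in> inside ?J \<union> ?J" using uy edge_sub_pim[OF y(1)] by blast
    have V: "y \<in> V" "v \<in> V" using edge_sub[OF y(2)] by auto
    consider "v \<in> inside ?J" | "y \<in> inside ?J" | "y \<in> ?J" "v \<in> ?J" using yJ vJ by blast
    then show "pim {y, v} \<subseteq> inside ?J \<union> ?J"
    proof cases
      case 1 then show ?thesis using edge_from_inside(2)[OF q vy] by (simp add: insert_commute)
    next
      case 2 then show ?thesis using edge_from_inside(2)[OF q y(2)] by simp
    next
      case 3
      then have "y \<in> {a, b, a', b'}" "v \<in> {a, b, a', b'}" using Q_Int_V[OF q] V by blast+
      then show ?thesis using quad_edge(2)[OF q, of y v] col[OF y(2)] by blast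
    qed
  qed
  have sub: "Q u w v w' \<subseteq> inside ?J \<union> ?J"
    using two[of w] two[of w'] q' unfolding quad_def P2_def by blast
  have "compact (Q u w v w')" using q' compact_pim by (auto simp: quad_def P2_def intro!: compact_Un)
  then have ins: "inside (Q u w v w') \<subseteq> inside ?J" using inside_subset_inside[OF cd(1) Jcd sub] by simp
  have "u \<in> Q u w v w'" using Q_Int_V[OF q'] by blast
  then have "u \<notin> inside (Q u w v w')" using inside_no_overlap[of "Q u w v w'"] by blast
  then have "V \<inter> inside (Q u w v w') \<subset> V \<inter> inside ?J" using ins u by blast
  then have "card (V \<inter> inside (Q u w v w')) < card (V \<inter> inside ?J)"
    using finV by (intro psubset_card_mono) auto
  then show ?thesis using that q' by blast
qed

text \<open>A cycle enclosing no vertex bounds a region inside a single face, so both diagonals join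
  cofacial vertices and have third common neighbours \<open>b''\<close> and \<open>a''\<close>. The
  path through \<open>b''\<close> completes the cycle to a theta curve, and the path through
  \<open>a''\<close> then connects two of its arcs without passing through the region between them,
  against \<open>theta_two_sides\<close>.\<close>

lemma quad_nonempty:
  assumes q: "quad a b a' b'"
  shows "V \<inter> inside (Q a b a' b') \<noteq> {}"
proof
  let ?J = "Q a b a' b'"
  assume empty: "V \<inter> inside ?J = {}"
  have qE: "{a, b} \<in> E" "{b, a'} \<in> E" "{a, b'} \<in> E" "{b', a'} \<in> E" "a \<noteq> a'" "b \<noteq> b'"
    using q by (auto simp: quad_def)
  obtain c d where cd: "arcs_between a a' c d" "path_image c = P2 a b a'" "path_image d = P2 a b' a'"
    using quad_arcs[OF q] .
  have Jcd: "?J = path_image c \<union> path_image d" using cd by simp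
  note Jd = Jordan_two_arcs[OF cd(1), folded Jcd]
  \<comment> \<open>An edge that enters the region without a vertex there has both ends on the
    cycle; being no chord, it is an edge of the cycle.\<close>
  have DX: "inside ?J \<inter> X = {}"
  proof (rule ccontr)
    assume "inside ?J \<inter> X \<noteq> {}"
    then obtain z e where z: "z \<in> inside ?J" "e \<in> E" "z \<in> pim e" using empty by (auto simp: X_def)
    obtain x y where xy: "e = {x, y}" using edge_card[OF z(2)] by (auto simp: card_2_iff)
    have zV: "z \<notin> V" using z(1) empty by blast
    then have zo: "z \<in> open_edge e" using z edge_sub by (auto simp: open_edge_def)
    have V: "x \<in> V" "y \<in> V" using edge_sub[OF z(2)] xy by auto
    then have xyi: "x \<notin> inside ?J" "y \<notin> inside ?J" using empty by auto
    have yx: "{y, x} = e" using xy by auto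
    have zout: "z \<notin> outside ?J" using z(1) inside_Int_outside[of ?J] by blast
    have "x \<notin> outside ?J" using edge_from_outside[OF q, of x y] z(2) zo zout xy by blast
    moreover have "y \<notin> outside ?J"
      using edge_from_outside[OF q, of y x, unfolded yx] z(2) zo zout by blast
    ultimately have "x \<in> ?J" "y \<in> ?J" using xyi inside_Un_outside[of ?J] by blast+
    then have "x \<in> {a, b, a', b'}" "y \<in> {a, b, a', b'}" using Q_Int_V[OF q] V by blast+
    then have "pim e \<subseteq> ?J" using quad_edge(2)[OF q, of x y] col[of x y] z(2) xy by blast
    then show False using z inside_no_overlap[of ?J] by blast
  qed
  then have "inside ?J \<subseteq> - X" by blast
  then obtain F where F: "F \<in> faces" "inside ?J \<subseteq> F"
    unfolding faces_def using exists_component_superset[OF _ _ Jd(3)] Jd(1) by blast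
  have "?J \<subseteq> closure F" using Jd(10) closure_mono[OF F(2)] by blast
  then have on: "on_face F g" if "g \<in> E" "pim g \<subseteq> ?J" for g
    using that open_edge_nonempty[OF that(1)] by (auto simp: on_face_def open_edge_def)
  have on4: "on_face F {a, b}" "on_face F {b', a'}"
    using on qE unfolding P2_def by blast+
  have sc: "s a = s a'" "s b = s b'" using col qE by blast+
  obtain b'' where b'': "b'' \<in> common a a'" "b'' \<noteq> b" "b'' \<noteq> b'"
    using third_common[OF many[OF F(1) qE(1) on4(1) qE(4) on4(2), of a a']] qE sc by blast
  obtain a'' where a'': "a'' \<in> common b b'" "a'' \<noteq> a" "a'' \<noteq> a'"
    using third_common[OF many[OF F(1) qE(1) on4(1) qE(4) on4(2), of b b']] qE sc by blast
  have bE: "{a, b''} \<in> E" "{b'', a'} \<in> E" using b'' by (auto simp: common_def insert_commute)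
  have aE: "{b, a''} \<in> E" "{a'', b'} \<in> E" using a'' by (auto simp: common_def insert_commute)
  obtain h where h: "arc h" "pathstart h = a" "pathfinish h = a'" "path_image h = P2 a b'' a'"
    using path2_arc[OF bE qE(5)] .
  obtain k where k: "arc k" "pathstart k = b" "pathfinish k = b'" "path_image k = P2 b a'' b'"
    using path2_arc[OF aE qE(6)] .
  define K where "K = P2 b a'' b' - {b, b'}"
  have th: "theta a a' c d h"
    using cd h P2_Int[OF qE(1,2) bE qE(5)] P2_Int[OF qE(3,4) bE qE(5)] b''
    by (auto simp: theta_def arcs_between_def)
  have dis: "path_image h \<inter> inside (path_image c \<union> path_image d) = {}"
    using DX pim_sub_X[OF bE(1)] pim_sub_X[OF bE(2)] h(4) unfolding P2_def Jcd[symmetric] by blast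
  have K1: "connected K"
    using connected_simple_path_endless[OF arc_imp_simple_path[OF k(1)]] k by (simp add: K_def)
  have sa: "s a'' = s a" "s b'' = s b" using col[OF aE(1)] col[OF bE(1)] col[OF qE(1)] by auto
  have sab: "s a \<noteq> s b" using col[OF qE(1)] .
  \<comment> \<open>\<open>a''\<close> is on no edge of the path from \<open>a\<close> over
    \<open>x\<close> to \<open>a'\<close>, so a shared point could only be the other end
    \<open>b\<close> or \<open>b'\<close>, and these are removed from \<open>K\<close>.\<close>
  have Kp: "K \<inter> P2 a x a' = {}" if x: "{a, x} \<in> E" "{x, a'} \<in> E" for x
  proof (rule ccontr)
    assume "K \<inter> P2 a x a' \<noteq> {}"
    then obtain z g1 g2 where z: "z \<in> pim g1" "z \<in> pim g2" "z \<notin> {b, b'}"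
      and g: "g1 = {b, a''} \<or> g1 = {a'', b'}" "g2 = {a, x} \<or> g2 = {x, a'}"
      unfolding K_def P2_def by blast
    have gE: "g1 \<in> E" "g2 \<in> E" using g aE x by auto
    have xn: "s x \<noteq> s a" using col[OF x(1)] by simp
    have "g1 = g2 \<or> z \<in> g1 \<inter> g2" using pim_Int[OF gE z(1,2)] .
    moreover have "a'' \<notin> g2" using g(2) a''(2,3) xn sa by auto
    ultimately show False using g(1) z(3) by auto
  qed
  have K2: "K \<inter> (path_image c \<union> path_image d \<union> path_image h) = {}"
    using Kp[OF qE(1,2)] Kp[OF qE(3,4)] Kp[OF bE] cd h by blast
  have "P2 b a'' b' \<subseteq> X" using pim_sub_X aE by (simp add: P2_def)
  then have K3: "K \<inter> inside (path_image c \<union> path_image d) = {}"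
    using DX unfolding K_def Jcd[symmetric] by blast
  have oe: "open_edge {b, a''} \<subseteq> K" "open_edge {a'', b'} \<subseteq> K"
    unfolding K_def P2_def using open_edge_V[OF aE(1)] open_edge_V[OF aE(2)] edge_sub[OF aE(1)] edge_sub[OF aE(2)]
    by (auto simp: open_edge_def)
  have "b \<in> closure K"
    using closure_mono[OF oe(1)] pim_sub_closure[OF aE(1)] edge_sub_pim[OF aE(1)] by blast
  moreover have "b' \<in> closure K"
    using closure_mono[OF oe(2)] pim_sub_closure[OF aE(2)] edge_sub_pim[OF aE(2)] by blast
  moreover have "b \<in> path_image c" "b' \<in> path_image d"
    using edge_sub_pim[OF qE(1)] edge_sub_pim[OF qE(3)] cd by (auto simp: P2_def)
  moreover have "b \<notin> {a, a'}" "b' \<notin> {a, a'}" using sab sc by auto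
  ultimately show False
    using theta_two_sides[OF th dis K1 K2 K3] by blast
qed

text \<open>Infinite descent on the number of enclosed vertices, started from the cycle given by any
  two cofacial vertices of one colour.\<close>

lemma no_edges: False
proof -
  obtain e where e: "e \<in> E" using nostar by blast
  obtain F where F: "F \<in> faces" "on_face F e" using edge_on_some_face[OF e] .
  obtain u where u: "u \<in> e" using edge_color[OF e] by blast
  obtain f v where f: "f \<in> E" "on_face F f" "v \<in> f" "v \<noteq> u" "s v = s u"
    using face_other_end[OF F(1)] .
  obtain w w' where q: "quad u w v w'"
    using quad_of_common many[OF F(1) e F(2) f(1,2) u f(3)] f by metis
  have "\<not> quad a b a' b'" if "card (V \<inter> inside (Q a b a' b')) = n" for a b a' b' n
    using that
  proof (induction n arbitrary: a b a' b' rule: less_induct)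
    case (less n)
    show ?case
    proof
      assume q: "quad a b a' b'"
      obtain u where u: "u \<in> V" "u \<in> inside (Q a b a' b')" using quad_nonempty[OF q] by blast
      obtain c d c' d' where "quad c d c' d'" "card (V \<inter> inside (Q c d c' d')) < card (V \<inter> inside (Q a b a' b'))"
        using quad_smaller[OF q u] .
      then show False using less by blast
    qed
  qed
  then show False using q by blast
qed

end

theorem exists_identifiable_pair:
  assumes "V = \<Union>E" "\<And>a. \<exists>e\<in>E. a \<notin> e"
  obtains u v where "u \<in> V" "v \<in> V" "u \<noteq> v" "s u = s v" "card (common u v) \<le> 2"
    "planar (V - {v}) (contract_edges (id(v := u)) E)"
proof (rule ccontr)
  assume neg: "\<not> thesis"
  note found = that
  have *: "3 \<le> card (common u v)" if "F \<in> faces" "e \<in> E" "on_face F e" "f \<in> E" "on_face F f"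
    "u \<in> e" "v \<in> f" "u \<noteq> v" "s u = s v" for F e f u v
  proof (rule ccontr)
    note h = that
    assume "\<not> 3 \<le> card (common u v)"
    then have "card (common u v) \<le> 2" by simp
    moreover have "e \<noteq> f"
    proof
      assume "e = f"
      then obtain w where "e = {u, w}" using edge_doubleton[OF edge_card[OF h(2)] h(6)] by blast
      then show False using h \<open>e = f\<close> col[of u w] by auto
    qed
    then have "planar (V - {v}) (contract_edges (id(v := u)) E)"
      using cofacial_identify[of F e f u v] h by blast
    moreover have "u \<in> V" "v \<in> V" using h edge_sub by blast+
    ultimately show False using h(8,9) neg found by blast
  qed
  show False by (rule no_edges[OF assms]) (rule *)
qed

end

section \<open>Euler's inequality\<close>

lemma same_component:
  assumes "K \<in> components S" "L \<in> components S" "x \<in> K" "y \<in> L" "connected_component S x y"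
  shows "K = L"
  using assms by (metis components_iff connected_component_eq mem_Collect_eq)

lemma component_connected:
  assumes "K \<in> components S" "x \<in> K" "y \<in> K"
  shows "connected_component S x y"
  using assms in_components_connected in_components_subset unfolding connected_component_def by blast

lemma component_superset:
  assumes "K \<in> components (- (Y \<union> Z))"
  obtains W where "W \<in> components (- Y)" "K \<subseteq> W"
proof -
  have "K \<subseteq> - Y" "- Y \<noteq> {}" "connected K"
    using assms in_components_subset in_components_nonempty in_components_connected by fastforce+
  then show ?thesis using that exists_component_superset by blast
qed

text \<open>The arc meets \<open>Y\<close> in a single point, a connected set, so by Janiszewski's
  theorem two points that are joined off \<open>Y\<close> remain joined. Each old component thus
  contains at most one new one.\<close>

lemma components_add_pendant_arc:
  fixes Y :: "complex set"
  assumes Y: "compact Y" and g: "arc g" "path_image g \<inter> Y = {p}" and fin: "finite (components (- Y))"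
  shows "finite (components (- (Y \<union> path_image g)))"
    "card (components (- (Y \<union> path_image g))) \<le> card (components (- Y))"
proof -
  let ?N = "- (Y \<union> path_image g)"
  have "\<forall>K \<in> components ?N. \<exists>W. W \<in> components (- Y) \<and> K \<subseteq> W"
    using component_superset by blast
  then obtain h where h: "\<And>K. K \<in> components ?N \<Longrightarrow> h K \<in> components (- Y) \<and> K \<subseteq> h K" by metis
  have inj: "inj_on h (components ?N)"
  proof (rule inj_onI)
    fix K L assume K: "K \<in> components ?N" and L: "L \<in> components ?N" and eq: "h K = h L"
    obtain x y where xy: "x \<in> K" "y \<in> L" using K L in_components_nonempty by blast
    have 1: "connected_component (- Y) x y"
      using component_connected[of "h K" "- Y" x y] h[OF K] h[OF L] eq xy by auto
    have "x \<in> - path_image g" "y \<in> - path_image g"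
      using xy K L in_components_subset by fastforce+
    moreover have "connected (- path_image g)" using connected_arc_complement[OF g(1)] by simp
    ultimately have 2: "connected_component (- path_image g) x y"
      unfolding connected_component_def by blast
    have "connected_component (- (path_image g \<union> Y)) x y"
      using Janiszewski[OF compact_arc_image[OF g(1)] compact_imp_closed[OF Y] _ 2 1] g(2) by simp
    then show "K = L" using same_component[OF K L xy] by (simp add: Un_commute)
  qed
  have sub: "h ` components ?N \<subseteq> components (- Y)" using h by blast
  show "finite (components ?N)" using inj_on_finite[OF inj sub fin] .
  show "card (components ?N) \<le> card (components (- Y))" using card_inj_on_le[OF inj sub fin] .
qed

text \<open>An arc \<open>b\<close> in \<open>Y\<close> closes \<open>g\<close> to a Jordan curve
  \<open>C\<close>. Only the component \<open>W0\<close> crossed by \<open>g\<close> can break up,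
  and the two sides of \<open>C\<close> allow for at most two pieces; this is the additional
  1.\<close>

lemma components_add_arc:
  fixes Y :: "complex set"
  assumes Y: "compact Y" "path_connected Y" and g: "arc g" "pathstart g = p" "pathfinish g = q"
    and int: "path_image g \<inter> Y = {p, q}" and fin: "finite (components (- Y))"
  shows "finite (components (- (Y \<union> path_image g)))"
    "card (components (- (Y \<union> path_image g))) \<le> card (components (- Y)) + 1"
proof -
  let ?N = "- (Y \<union> path_image g)"
  have pq: "p \<noteq> q" using arc_distinct_ends[OF g(1)] g by simp
  then obtain b where b: "arc b" "path_image b \<subseteq> Y" "pathstart b = p" "pathfinish b = q"
    using Y(2) int unfolding path_connected_arcwise by blast
  have b_in: "p \<in> path_image b" "q \<in> path_image b"
    using b pathstart_in_path_image pathfinish_in_path_image by metis+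
  define C where "C = path_image g \<union> path_image b"
  have ab: "arcs_between p q g b" using g b int b_in by (auto simp: arcs_between_def)
  note Cd = Jordan_two_arcs[OF ab, folded C_def]
  have CY: "C \<inter> Y = path_image b" 
    unfolding C_def Int_Un_distrib2 int using b(2) b_in by auto
  have CuY: "C \<union> Y = Y \<union> path_image g" using b by (auto simp: C_def)
  have conn_o: "connected (path_image g - {p, q})"
    using connected_simple_path_endless[OF arc_imp_simple_path[OF g(1)]] g by simp
  have ne: "path_image g - {p, q} \<noteq> {}"
    using simple_path_endless[OF arc_imp_simple_path[OF g(1)]] g by simp
  have "path_image g - {p, q} \<subseteq> - Y" using int by blast
  then obtain W0 where W0: "W0 \<in> components (- Y)" "path_image g - {p, q} \<subseteq> W0"
    using exists_component_superset[OF _ _ conn_o] ne by blast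
  let ?K1 = "{K \<in> components ?N. K \<subseteq> W0}" and ?K2 = "{K \<in> components ?N. \<not> K \<subseteq> W0}"
  \<comment> \<open>Two pieces on the same side of \<open>C\<close> coincide: their points are
    joined off \<open>C\<close> and off \<open>Y\<close>, and \<open>C\<close> meets
    \<open>Y\<close> in the connected set \<open>b\<close>.\<close>
  have inj: "inj_on (\<lambda>K. K \<subseteq> inside C) ?K1"
  proof (rule inj_onI)
    fix K L assume KL: "K \<in> ?K1" "L \<in> ?K1" and eq: "(K \<subseteq> inside C) = (L \<subseteq> inside C)"
    have K: "K \<in> components ?N" "K \<subseteq> W0" and L: "L \<in> components ?N" "L \<subseteq> W0" using KL by simp_all
    obtain x y where xy: "x \<in> K" "y \<in> L"
      using in_components_nonempty[OF K(1)] in_components_nonempty[OF L(1)] by blast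
    have 1: "connected_component (- Y) x y"
      using component_connected[OF W0(1)] subsetD[OF K(2) xy(1)] subsetD[OF L(2) xy(2)] by simp
    have dis: "K \<inter> C = {}" "L \<inter> C = {}"
      using in_components_subset[OF K(1)] in_components_subset[OF L(1)] CuY by auto
    have side: "M \<subseteq> inside C \<or> M \<subseteq> outside C" if "M \<in> components ?N" "M \<inter> C = {}" for M
    proof (cases "M \<inter> inside C = {}")
      case True
      then show ?thesis using that(2) inside_Un_outside[of C] by blast
    next
      case False
      then show ?thesis using connected_subset_inside[OF in_components_connected[OF that(1)] that(2)] by simp
    qed
    have "K \<subseteq> inside C \<or> K \<subseteq> outside C" "L \<subseteq> inside C \<or> L \<subseteq> outside C"
      using side[OF K(1) dis(1)] side[OF L(1) dis(2)] by simp_all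
    then have both: "K \<subseteq> inside C \<and> L \<subseteq> inside C \<or> K \<subseteq> outside C \<and> L \<subseteq> outside C"
      using eq xy inside_Int_outside[of C] by blast
    have sub: "inside C \<subseteq> - C" "outside C \<subseteq> - C"
      using inside_no_overlap[of C] outside_no_overlap[of C] by blast+
    from both have 2: "connected_component (- C) x y"
    proof
      assume "K \<subseteq> inside C \<and> L \<subseteq> inside C"
      then show ?thesis unfolding connected_component_def
        using Cd(3) sub(1) xy by (intro exI[of _ "inside C"]) auto
    next
      assume "K \<subseteq> outside C \<and> L \<subseteq> outside C"
      then show ?thesis unfolding connected_component_def
        using Cd(5) sub(2) xy by (intro exI[of _ "outside C"]) auto
    qed
    have "connected_component (- (C \<union> Y)) x y"
      using Janiszewski[OF Cd(11) compact_imp_closed[OF Y(1)] _ 2 1] CY b(1) by (simp add: connected_arc_image)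
    then show "K = L" using same_component[OF K(1) L(1) xy] CuY by simp
  qed
  have fin1: "finite ?K1" by (rule inj_on_finite[OF inj, of UNIV]) auto
  have c1: "card ?K1 \<le> 2" using card_inj_on_le[OF inj, of UNIV] by simp
  \<comment> \<open>The other components of the complement of \<open>Y\<close> are not touched by
    \<open>g\<close> and survive as they are.\<close>
  have sub2: "?K2 \<subseteq> components (- Y) - {W0}"
  proof
    fix K assume "K \<in> ?K2"
    then have K: "K \<in> components ?N" "\<not> K \<subseteq> W0" by auto
    obtain W where W: "W \<in> components (- Y)" "K \<subseteq> W" using component_superset[OF K(1)] .
    have WW: "W \<noteq> W0" using W K by blast
    then have "W \<inter> W0 = {}" using W W0 components_nonoverlap by metis
    moreover have "W \<subseteq> - Y" using W(1) in_components_subset by blast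
    ultimately have "W \<subseteq> ?N" using W0(2) int by blast
    then have "W \<subseteq> K"
      using components_maximal[OF K(1) in_components_connected[OF W(1)]] W(2) in_components_nonempty[OF K(1)] by blast
    then have "K = W" using W(2) by (rule equalityI[rotated])
    then show "K \<in> components (- Y) - {W0}" using W(1) WW by simp
  qed
  then have fin2: "finite ?K2" by (rule finite_subset) (simp add: fin)
  have "card ?K2 \<le> card (components (- Y) - {W0})" using sub2 fin by (intro card_mono) auto
  then have c2: "card ?K2 \<le> card (components (- Y)) - 1" using W0(1) fin by simp
  have pos: "card (components (- Y)) > 0" using W0(1) fin card_gt_0_iff by blast
  have eq: "components ?N = ?K1 \<union> ?K2" by blast
  show "finite (components ?N)" by (subst eq) (intro finite_UnI fin1 fin2)
  have "card (components ?N) \<le> card ?K1 + card ?K2" by (subst eq) (rule card_Un_le)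
  then show "card (components ?N) \<le> card (components (- Y)) + 1" using c1 c2 pos by linarith
qed

section \<open>Euler's inequality by adding edges one at a time\<close>

context plane_graph
begin

definition graph_connected :: bool where
  "graph_connected \<longleftrightarrow> (\<forall>W. W \<subseteq> V \<and> W \<noteq> {} \<and> (\<forall>e\<in>E. e \<inter> W \<noteq> {} \<longrightarrow> e \<subseteq> W) \<longrightarrow> W = V)"

text \<open>The invariant of an exploration of the graph from one vertex. Path connectedness is kept
  because closing a cycle uses an arc within the part already reached; finiteness is kept because
  \<open>card\<close> is 0 on infinite sets.\<close>

definition euler_part :: "complex set \<Rightarrow> complex set set \<Rightarrow> bool" where
  "euler_part W T \<longleftrightarrow> W \<subseteq> V \<and> T \<subseteq> E \<and> W \<noteq> {} \<and> (\<forall>e\<in>T. e \<subseteq> W) \<and> path_connected (W \<union> (\<Union>e\<in>T. pim e)) \<and>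
     finite (components (- (W \<union> (\<Union>e\<in>T. pim e)))) \<and>
     card (components (- (W \<union> (\<Union>e\<in>T. pim e)))) + card W \<le> card T + 2"

lemma euler_part_start:
  assumes "v \<in> V" shows "euler_part {v} {}"
proof -
  have "connected (- {v})"
    using connected_open_delete_finite[of UNIV "{v}"] by (simp add: Compl_eq_Diff_UNIV convex_connected)
  moreover have "- {v} \<noteq> {}" by (metis Compl_UNIV_eq double_complement finite.intros infinite_UNIV_char_0)
  ultimately have "components (- {v}) = {- {v}}" by (simp add: components_eq_sing_iff)
  then show ?thesis using assms by (simp add: euler_part_def)
qed

text \<open>If the other end of \<open>e\<close> is already reached, there is one more edge and at
  most one more face; otherwise there is one more edge and one more vertex, and the faces do not
  increase.\<close>

lemma euler_part_step:
  assumes W: "euler_part W T" and e: "e \<in> E" "e \<notin> T" "e \<inter> W \<noteq> {}"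
  shows "euler_part (W \<union> e) (insert e T)"
proof -
  define Y where "Y = W \<union> (\<Union>e\<in>T. pim e)"
  have R: "W \<subseteq> V" "T \<subseteq> E" "W \<noteq> {}" "\<And>f. f \<in> T \<Longrightarrow> f \<subseteq> W" "path_connected Y" "finite (components (- Y))"
    "card (components (- Y)) + card W \<le> card T + 2"
    using W by (auto simp: euler_part_def Y_def)
  have fT: "finite T" "finite W" using R finE finV finite_subset by blast+
  have cY: "compact Y" unfolding Y_def using fT compact_pim R(2)
    by (intro compact_Un compact_UN) (auto intro: finite_imp_compact)
  have eV: "e \<subseteq> V" using edge_sub e by blast
  have Y': "W \<union> e \<union> (\<Union>f\<in>insert e T. pim f) = Y \<union> pim e"
    using edge_sub_pim[OF e(1)] by (auto simp: Y_def)
  have int: "pim e \<inter> Y = e \<inter> W"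
  proof
    show "pim e \<inter> Y \<subseteq> e \<inter> W"
    proof
      fix z assume z: "z \<in> pim e \<inter> Y"
      then consider "z \<in> W" | f where "f \<in> T" "z \<in> pim f" by (auto simp: Y_def)
      then show "z \<in> e \<inter> W"
      proof cases
        case 1 then show ?thesis using z VE[OF e(1)] R(1) by blast
      next
        case 2
        then have "z \<in> e \<inter> f" using EE[OF e(1), of f] R(2) e(2) z by blast
        then show ?thesis using R(4) 2 by blast
      qed
    qed
    show "e \<inter> W \<subseteq> pim e \<inter> Y" using edge_sub_pim[OF e(1)] by (auto simp: Y_def)
  qed
  have pc: "path_connected (Y \<union> pim e)"
    by (intro path_connected_Un R(5) path_connected_path_image)
      (use int e arcE[OF e(1)] in \<open>auto simp: arc_imp_path Int_commute\<close>)
  obtain u where u: "u \<in> e" "u \<in> W" using e(3) by blast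
  obtain v where v: "e = {u, v}" "u \<noteq> v" using edge_doubleton[OF edge_card[OF e(1)] u(1)] .
  have main: "finite (components (- (Y \<union> pim e))) \<and>
     card (components (- (Y \<union> pim e))) + card (W \<union> e) \<le> card (insert e T) + 2"
  proof (cases "v \<in> W")
    case True
    obtain g where g: "arc g" "pathstart g = u" "pathfinish g = v" "path_image g = pim e"
      using edge_arc e(1) v by metis
    have "path_image g \<inter> Y = {u, v}" using int g True u v by auto
    note a = components_add_arc[OF cY R(5) g(1-3) this R(6), unfolded g(4)]
    have "W \<union> e = W" using True u v by auto
    then show ?thesis using a R(7) e(2) fT by simp
  next
    case False
    have "pim e \<inter> Y = {u}" using int False u v by auto
    note a = components_add_pendant_arc[OF cY arcE[OF e(1)] this R(6)]
    have "W \<union> e = insert v W" using u v by auto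
    then show ?thesis using a R(7) e(2) fT False by simp
  qed
  have "W \<union> e \<subseteq> V" "insert e T \<subseteq> E" "W \<union> e \<noteq> {}" "\<forall>f\<in>insert e T. f \<subseteq> W \<union> e"
    using R eV e(1) by auto
  then show ?thesis using main pc unfolding euler_part_def Y' by blast
qed

lemma euler_inequality:
  assumes "graph_connected" "V \<noteq> {}"
  shows "finite faces" "card faces + card V \<le> card E + 2"
proof -
  have "\<exists>W T. euler_part W T \<and> (\<forall>e\<in>E. e \<inter> W \<noteq> {} \<longrightarrow> e \<in> T)" if "euler_part W T" for W T
    using that
  proof (induction "card E - card T" arbitrary: W T rule: less_induct)
    case less
    show ?case
    proof (cases "\<forall>e\<in>E. e \<inter> W \<noteq> {} \<longrightarrow> e \<in> T")
      case True then show ?thesis using less.prems by blast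
    next
      case False
      then obtain e where e: "e \<in> E" "e \<notin> T" "e \<inter> W \<noteq> {}" by blast
      have TE: "T \<subseteq> E" "insert e T \<subseteq> E" using less.prems e by (auto simp: euler_part_def)
      have "finite T" using TE finE finite_subset by blast
      then have "card (insert e T) = Suc (card T)" using e by simp
      moreover have "card (insert e T) \<le> card E" using TE finE by (intro card_mono) auto
      ultimately have "card E - card (insert e T) < card E - card T" by simp
      then show ?thesis using less.hyps euler_part_step[OF less.prems e] by blast
    qed
  qed
  then obtain W T where WT: "euler_part W T" "\<forall>e\<in>E. e \<inter> W \<noteq> {} \<longrightarrow> e \<in> T"
    using euler_part_start assms(2) by blast
  then have sub: "W \<subseteq> V" "W \<noteq> {}" "T \<subseteq> E" "\<forall>e\<in>T. e \<subseteq> W" by (auto simp: euler_part_def)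
  have "\<forall>e\<in>E. e \<inter> W \<noteq> {} \<longrightarrow> e \<subseteq> W" using WT(2) sub(4) by blast
  then have "W = V" using assms(1) sub(1,2) unfolding graph_connected_def by blast
  moreover have "T = E"
  proof
    show "E \<subseteq> T"
    proof
      fix e assume e: "e \<in> E"
      then have "e \<inter> W \<noteq> {}" using edge_sub[OF e] edge_card[OF e] \<open>W = V\<close> by (auto simp: card_2_iff)
      then show "e \<in> T" using WT(2) e by blast
    qed
  qed (use sub in auto)
  ultimately show "finite faces" "card faces + card V \<le> card E + 2"
    using WT(1) by (auto simp: euler_part_def faces_def X_def)
qed

end

section \<open>Maximal planar bipartite graphs\<close>

lemma connected_Un_closure:
  assumes "connected F" "connected S" "closure F \<inter> S \<noteq> {}"
  shows "connected (F \<union> S)"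
proof -
  obtain z where z: "z \<in> closure F" "z \<in> S" using assms(3) by blast
  have "connected (insert z F)"
    using connected_intermediate_closure[OF assms(1), of "insert z F"] z closure_subset by blast
  then have "connected (insert z F \<union> S)" using assms(2) z by (intro connected_Un) auto
  moreover have "insert z F \<union> S = F \<union> S" using z by blast
  ultimately show ?thesis by simp
qed

context plane_graph
begin

text \<open>That \<open>e\<close> lies on \<open>F\<close> does not put its end \<open>b\<close>
  into the closure of \<open>F\<close>. If \<open>e\<close> is not part of the path,
  \<open>F\<close> is therefore enlarged by the interior of \<open>e\<close>, which reaches
  \<open>b\<close> and avoids all edges at \<open>a\<close> and \<open>a'\<close>.\<close>

lemma face_reaches_path2:
  assumes F: "F \<in> faces" and e: "e \<in> E" "on_face F e" "b \<in> e" and ab: "{a, b} \<in> E" "{b, a'} \<in> E"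
  obtains K where "connected K" "F \<subseteq> K" "\<And>g. g \<in> E \<Longrightarrow> g \<inter> {a, a'} \<noteq> {} \<Longrightarrow> K \<inter> pim g = {}"
    "closure K \<inter> (P2 a b a' - {a, a'}) \<noteq> {}"
proof (cases "e \<inter> {a, a'} = {}")
  case False
  have ba: "b \<noteq> a" "b \<noteq> a'" using edge_neq[OF ab(1)] edge_neq[OF ab(2)] by auto
  obtain x where "e = {b, x}" using edge_doubleton[OF edge_card[OF e(1)] e(3)] by blast
  then have "e = {a, b} \<or> e = {b, a'}" using False ba by (auto simp: insert_commute)
  then have "open_edge e \<subseteq> P2 a b a' - {a, a'}"
    using open_edge_V[OF e(1)] edge_sub[OF ab(1)] edge_sub[OF ab(2)]
    unfolding P2_def open_edge_def by blast
  then have "closure F \<inter> (P2 a b a' - {a, a'}) \<noteq> {}" using e(2) unfolding on_face_def by blast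
  moreover have "F \<inter> pim g = {}" if "g \<in> E" for g using faceD(3)[OF F] pim_sub_X[OF that] by blast
  ultimately show ?thesis using that[of F] faceD(2)[OF F] by blast
next
  case True
  have "b \<noteq> a" "b \<noteq> a'" using edge_neq[OF ab(1)] edge_neq[OF ab(2)] by auto
  let ?K = "F \<union> open_edge e"
  have "connected ?K"
    using connected_Un_closure[OF faceD(2)[OF F] connected_open_edge[OF e(1)]] e(2) by (simp add: on_face_def)
  moreover have "?K \<inter> pim g = {}" if "g \<in> E" "g \<inter> {a, a'} \<noteq> {}" for g
  proof -
    have "e \<noteq> g" using True that by blast
    then show ?thesis using open_edge_Int[OF e(1) that(1)] faceD(3)[OF F] pim_sub_X[OF that(1)] by blast
  qed
  moreover have "b \<in> closure ?K"
    using pim_sub_closure[OF e(1)] edge_sub_pim[OF e(1)] e(3) closure_mono[of "open_edge e" ?K] by blast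
  moreover have "b \<in> P2 a b a' - {a, a'}"
    using edge_sub_pim[OF ab(1)] \<open>b \<noteq> a\<close> \<open>b \<noteq> a'\<close> by (auto simp: P2_def)
  ultimately show ?thesis using that[of ?K] by blast
qed

text \<open>The three enlargements share \<open>F\<close>, so their union is connected; it avoids
  the theta curve of the three paths and approaches each of them, against
  \<open>theta_three_sides\<close>.\<close>

lemma face_not_three:
  assumes F: "F \<in> faces"
    and e: "\<And>i. i \<in> {1, 2, 3::nat} \<Longrightarrow> e i \<in> E \<and> on_face F (e i) \<and> b i \<in> e i"
    and ab: "\<And>i. i \<in> {1, 2, 3} \<Longrightarrow> {a, b i} \<in> E \<and> {b i, a'} \<in> E"
    and neq: "a \<noteq> a'" "b 1 \<noteq> b 2" "b 1 \<noteq> b 3" "b 2 \<noteq> b 3"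
  shows False
proof -
  have "\<exists>K. connected K \<and> F \<subseteq> K \<and> (\<forall>g. g \<in> E \<longrightarrow> g \<inter> {a, a'} \<noteq> {} \<longrightarrow> K \<inter> pim g = {}) \<and>
    closure K \<inter> (P2 a (b i) a' - {a, a'}) \<noteq> {}" if "i \<in> {1, 2, 3}" for i
  proof -
    have "e i \<in> E" "on_face F (e i)" "b i \<in> e i" "{a, b i} \<in> E" "{b i, a'} \<in> E"
      using e[OF that] ab[OF that] by auto
    from face_reaches_path2[OF F this] show ?thesis by metis
  qed
  then obtain K where K: "\<And>i. i \<in> {1, 2, 3} \<Longrightarrow> connected (K i) \<and> F \<subseteq> K i \<and>
     (\<forall>g. g \<in> E \<longrightarrow> g \<inter> {a, a'} \<noteq> {} \<longrightarrow> K i \<inter> pim g = {}) \<and>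
    closure (K i) \<inter> (P2 a (b i) a' - {a, a'}) \<noteq> {}" by metis
  have "\<exists>c. arc c \<and> pathstart c = a \<and> pathfinish c = a' \<and> path_image c = P2 a (b i) a'" if "i \<in> {1, 2, 3}" for i
    using path2_arc[of a "b i" a'] ab[OF that] neq(1) by metis
  then obtain c where c: "\<And>i. i \<in> {1, 2, 3} \<Longrightarrow>
    arc (c i) \<and> pathstart (c i) = a \<and> pathfinish (c i) = a' \<and> path_image (c i) = P2 a (b i) a'" by metis
  have Int: "P2 a (b i) a' \<inter> P2 a (b j) a' = {a, a'}" if "i \<in> {1, 2, 3}" "j \<in> {1, 2, 3}" "b i \<noteq> b j" for i j
    using P2_Int[of a "b i" a' "b j"] ab[OF that(1)] ab[OF that(2)] that(3) neq(1) by simp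
  have between: "arcs_between a a' (c i) (c j)" if "i \<in> {1, 2, 3}" "j \<in> {1, 2, 3}" "b i \<noteq> b j" for i j
    using c[OF that(1)] c[OF that(2)] Int[OF that] by (simp add: arcs_between_def)
  have th: "theta a a' (c 1) (c 2) (c 3)" using between neq by (simp add: theta_def)
  define L where "L = (\<Union>i\<in>{1, 2, 3}. K i)"
  have conn: "connected L"
    unfolding L_def
  proof (rule connected_Union)
    show "\<And>S. S \<in> K ` {1, 2, 3} \<Longrightarrow> connected S" using K by auto
    have "F \<subseteq> \<Inter> (K ` {1, 2, 3})" using K by auto
    then show "\<Inter> (K ` {1, 2, 3}) \<noteq> {}" using faceD(4)[OF F] by blast
  qed
  have LP: "L \<inter> P2 a (b i) a' = {}" if i: "i \<in> {1, 2, 3}" for i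
  proof -
    have "K j \<inter> pim {a, b i} = {} \<and> K j \<inter> pim {b i, a'} = {}" if j: "j \<in> {1, 2, 3}" for j
      using K[OF j] ab[OF i] by auto
    then show ?thesis unfolding L_def P2_def by blast
  qed
  have disj: "L \<inter> (path_image (c 1) \<union> path_image (c 2) \<union> path_image (c 3)) = {}"
    using LP[of 1] LP[of 2] LP[of 3] c[of 1] c[of 2] c[of 3] by auto
  have cl: "closure L \<inter> (path_image (c i) - {a, a'}) \<noteq> {}" if i: "i \<in> {1, 2, 3}" for i
  proof -
    have "closure (K i) \<subseteq> closure L" using i by (intro closure_mono) (auto simp: L_def)
    then show ?thesis using K[OF i] c[OF i] by auto
  qed
  show False by (rule theta_three_sides[OF th conn disj cl[of 1] cl[of 2] cl[of 3]]) simp_all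
qed

text \<open>If the graph falls apart into \<open>W\<close> and the rest, a shortest segment between the two parts of the
  drawing can be turned into an additional edge.\<close>

lemma disconnected_add_edge:
  assumes W: "W \<subseteq> V" "W \<noteq> {}" "W \<noteq> V" and cl: "\<And>e. e \<in> E \<Longrightarrow> e \<inter> W \<noteq> {} \<Longrightarrow> e \<subseteq> W"
  obtains u v where "u \<in> W" "v \<in> V - W" "planar V (insert {u, v} E)"
proof -
  define T where "T = {e \<in> E. e \<subseteq> W}"
  define T' where "T' = {e \<in> E. e \<inter> W = {}}"
  define Y where "Y = W \<union> (\<Union>e\<in>T. pim e)"
  define Z where "Z = (V - W) \<union> (\<Union>e\<in>T'. pim e)"
  have ETT: "E = T \<union> T'" using cl by (auto simp: T_def T'_def)
  have XYZ: "X = Y \<union> Z" unfolding X_def Y_def Z_def using ETT W(1) by auto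
  have fin: "finite T" "finite T'" "finite W" using finE finV W(1) finite_subset by (auto simp: T_def T'_def)
  have cY: "compact Y" unfolding Y_def using fin compact_pim
    by (intro compact_Un compact_UN) (auto intro: finite_imp_compact simp: T_def)
  have cZ: "compact Z" unfolding Z_def using fin finV compact_pim
    by (intro compact_Un compact_UN) (auto intro: finite_imp_compact simp: T'_def)
  have YZ: "Y \<inter> Z = {}"
  proof (rule ccontr)
    assume "Y \<inter> Z \<noteq> {}"
    then obtain z where z: "z \<in> Y" "z \<in> Z" by blast
    consider "z \<in> W" "z \<in> V - W" | f where "z \<in> W" "f \<in> T'" "z \<in> pim f" | e where "e \<in> T" "z \<in> pim e" "z \<in> V - W"
      | e f where "e \<in> T" "z \<in> pim e" "f \<in> T'" "z \<in> pim f"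
      using z by (auto simp: Y_def Z_def)
    then show False
    proof cases
      case 2
      then have "z \<in> f" using VE[of f] W(1) by (auto simp: T'_def)
      then show False using 2 by (auto simp: T'_def)
    next
      case 3
      then have "z \<in> e" using VE[of e] by (auto simp: T_def)
      then show False using 3 by (auto simp: T_def)
    next
      case (4 e f)
      have "e \<noteq> {}" using 4 edge_card[of e] by (auto simp: T_def)
      then have "e \<noteq> f" using 4 by (auto simp: T_def T'_def)
      then have "z \<in> e \<inter> f" using pim_Int[of e f z] 4 by (auto simp: T_def T'_def)
      then show False using 4 by (auto simp: T_def T'_def)
    qed auto
  qed
  have ne: "Y \<noteq> {}" "Z \<noteq> {}" using W by (auto simp: Y_def Z_def)
  obtain x y where xy: "x \<in> Y" "y \<in> Z" "dist x y = setdist Y Z"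
    using setdist_compact_closed[OF cY compact_imp_closed[OF cZ] ne] by blast
  have xny: "x \<noteq> y" using xy YZ by blast
  let ?\<sigma> = "linepath x y"
  have arc: "arc ?\<sigma>" using xny by (rule arc_linepath)
  have dis: "path_image ?\<sigma> - {x, y} \<subseteq> - X"
  proof
    fix z assume z: "z \<in> path_image ?\<sigma> - {x, y}"
    then have zo: "z \<in> open_segment x y" by (auto simp: open_segment_def)
    then have d: "dist z y < dist x y" "dist x z < dist x y"
      using dist_in_open_segment[OF zo] by (auto simp: dist_commute)
    have "z \<notin> Y" using d(1) xy setdist_le_dist[of z Y y Z] by auto
    moreover have "z \<notin> Z" using d(2) xy setdist_le_dist[of x Y z Z] by auto
    ultimately show "z \<in> - X" using XYZ by blast
  qed
  have attach: "x \<in> W \<or> (\<exists>e\<in>E. e \<subseteq> W \<and> x \<in> open_edge e)"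
    using xy(1) by (auto simp: Y_def T_def open_edge_def)
  have attach': "y \<in> V - W \<or> (\<exists>f\<in>E. f \<inter> W = {} \<and> y \<in> open_edge f)"
    using xy(2) edge_sub by (auto simp: Z_def T'_def open_edge_def)
  have ends: "pathstart ?\<sigma> = x" "pathfinish ?\<sigma> = y" by auto
  have edge_ne: "\<exists>u. u \<in> e" if "e \<in> E" for e using edge_card[OF that] by (auto simp: card_2_iff)
  consider "x \<in> W" "y \<in> V - W" | e where "e \<in> E" "e \<subseteq> W" "x \<in> open_edge e" "y \<in> V - W"
    | f where "x \<in> W" "f \<in> E" "f \<inter> W = {}" "y \<in> open_edge f"
    | e f where "e \<in> E" "e \<subseteq> W" "x \<in> open_edge e" "f \<in> E" "f \<inter> W = {}" "y \<in> open_edge f"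
    using attach attach' by blast
  then show ?thesis
  proof cases
    case 1
    have "{x, y} \<notin> E" using cl[of "{x, y}"] 1 by auto
    then have "planar V (insert {x, y} E)"
      using plane_graph.planar[OF add_arc[OF arc ends _ _ _ dis]] 1 W(1) by blast
    then show ?thesis using that 1 by blast
  next
    case (2 e)
    then obtain u where u: "u \<in> e" using edge_ne by blast
    then have "planar V (insert {u, y} E)"
      using planar_slide[OF arc ends _ 2(1,3) u _ dis] 2 by blast
    then show ?thesis using that[of u y] 2 u by blast
  next
    case (3 f)
    then obtain v where v: "v \<in> f" using edge_ne by blast
    have "planar V (insert {v, x} E)"
    proof (rule planar_slide[of "linepath y x" y x f v])
      show "path_image (linepath y x) - {y, x} \<subseteq> - X"
        using dis by (simp add: closed_segment_commute insert_commute)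
      show "x \<in> V" "v \<noteq> x" using 3 v W(1) by auto
    qed (use 3 v xny in \<open>auto simp: arc_linepath\<close>)
    then show ?thesis using that[of x v] 3 v edge_sub[of f] by (auto simp: insert_commute)
  next
    case (4 e f)
    obtain u where u: "u \<in> e" using edge_ne[OF 4(1)] by blast
    obtain v where v: "v \<in> f" using edge_ne[OF 4(4)] by blast
    note uv = u v
    have "e \<noteq> f" "u \<noteq> v" using uv 4(2,5) by blast+
    then have "planar V (insert {u, v} E)"
      using planar_add_through_arc[OF arc ends 4(1,3) uv(1) 4(4,6) uv(2) _ _ dis] by blast
    then show ?thesis using that[of u v] 4(2,5) uv edge_sub[OF 4(4)] by blast
  qed
qed

end

section \<open>Faces and edge count of maximal graphs\<close>

context plane_bipartite
begin

lemma bipartite_insert: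
  fixes s' :: "complex \<Rightarrow> bool"
  assumes col': "\<And>x y. {x, y} \<in> insert {u, v} E \<Longrightarrow> s' x \<noteq> s' y" and uv: "u \<in> V" "v \<in> V"
  shows "bipartite V (insert {u, v} E)"
  unfolding bipartite_def bipartition_def
proof (intro exI conjI ballI)
  show "V = {x \<in> V. s' x} \<union> {x \<in> V. \<not> s' x}" by blast
  show "{x \<in> V. s' x} \<inter> {x \<in> V. \<not> s' x} = {}" by blast
  fix e assume e: "e \<in> insert {u, v} E"
  have eV: "e \<subseteq> V" using e uv edge_sub by blast
  obtain x y where xy: "e = {x, y}" using e edge_card by (metis card_2_iff insertE)
  then have "s' x \<noteq> s' y" using col' e by simp
  then show "\<exists>a\<in>{x \<in> V. s' x}. \<exists>b\<in>{x \<in> V. \<not> s' x}. e = {a, b}"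
    using xy eV by (cases "s' x") (force simp: insert_commute)+
qed

context
  assumes max: "maximal_planar_bipartite V E"
begin

text \<open>If no edge leaves \<open>W\<close>, the colours on \<open>W\<close> can be exchanged
  freely, so an edge from \<open>W\<close> to the rest never spoils bipartiteness, whichever ends it
  has; the topological construction supplies one that keeps planarity.\<close>

lemma maximal_connected: graph_connected
  unfolding graph_connected_def
proof (intro allI impI, elim conjE, rule ccontr)
  fix W assume W: "W \<subseteq> V" "W \<noteq> {}" and cl: "\<forall>e\<in>E. e \<inter> W \<noteq> {} \<longrightarrow> e \<subseteq> W" and neq: "W \<noteq> V"
  have cl': "e \<subseteq> W" if "e \<in> E" "e \<inter> W \<noteq> {}" for e using cl that by simp
  obtain u v where uv: "u \<in> W" "v \<in> V - W" "planar V (insert {u, v} E)"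
    using disconnected_add_edge[OF W neq cl'] .
  have uv': "u \<noteq> v" "{u, v} \<notin> E" using uv cl'[of "{u, v}"] by auto
  define flip where "flip = (s u = s v)"
  define t where "t = (\<lambda>x. if x \<in> W \<and> flip then \<not> s x else s x)"
  have tuv: "t u \<noteq> t v" using uv by (auto simp: t_def flip_def)
  have "bipartite V (insert {u, v} E)"
  proof (rule bipartite_insert[of u v t])
    fix x y assume "{x, y} \<in> insert {u, v} E"
    then consider "{x, y} = {u, v}" | "{x, y} \<in> E" by blast
    then show "t x \<noteq> t y"
    proof cases
      case 1 then show ?thesis using tuv by (auto simp: doubleton_eq_iff)
    next
      case 2
      have "x \<in> W \<longleftrightarrow> y \<in> W" using bspec[OF cl 2] by auto
      then show ?thesis using col[OF 2] by (auto simp: t_def)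
    qed
  qed (use uv W in auto)
  then show False
    using max uv uv' W unfolding maximal_planar_bipartite_def by blast
qed

lemma maximal_no_isolated:
  assumes "v \<in> V" "V \<noteq> {v}"
  obtains e where "e \<in> E" "v \<in> e"
  using maximal_connected assms unfolding graph_connected_def by blast

text \<open>An absent edge between the two vertices could be drawn through the face without spoiling
  the colouring.\<close>

lemma maximal_face_complete:
  assumes F: "F \<in> faces" and e: "e \<in> E" "on_face F e" "u \<in> e" and f: "f \<in> E" "on_face F f" "v \<in> f" and "s u \<noteq> s v"
  shows "{u, v} \<in> E"
proof (cases "e = f")
  case True
  then show ?thesis using edge_doubleton[OF edge_card[OF e(1)] e(3)] e f \<open>s u \<noteq> s v\<close> by (metis insertE singletonD)
next
  case False
  have uv: "u \<noteq> v" "u \<in> V" "v \<in> V" using e f edge_sub \<open>s u \<noteq> s v\<close> by auto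
  have "planar V (insert {u, v} E)" using cofacial_add[OF F e(1,2) f(1,2) False e(3) f(3) uv(1)] .
  moreover have "bipartite V (insert {u, v} E)"
    using bipartite_insert[of u v s] col \<open>s u \<noteq> s v\<close> uv by (auto simp: doubleton_eq_iff)
  ultimately show ?thesis using max uv unfolding maximal_planar_bipartite_def by blast
qed

context
  assumes two: "\<And>v. v \<in> V \<Longrightarrow> \<exists>w\<in>V. w \<noteq> v \<and> s w = s v" and ne: "V \<noteq> {}"
begin

text \<open>The assumption \<open>two\<close> sets aside the stars \<open>K_{1,m}\<close>, which are
  maximal but have fewer than \<open>2 n - 4\<close> edges for \<open>m >= 3\<close>. A second
  vertex on the side of \<open>a\<close> is not isolated, and its edge cannot end in
  \<open>a\<close>.\<close>

lemma maximal_no_star: "\<exists>e\<in>E. a \<notin> e"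
proof (rule ccontr)
  assume star: "\<not> (\<exists>e\<in>E. a \<notin> e)"
  have *: "\<exists>w\<in>V. w \<noteq> v" if "v \<in> V" for v using two that by blast
  show False
  proof (cases "a \<in> V")
    case True
    then obtain w where w: "w \<in> V" "w \<noteq> a" "s w = s a" using two by blast
    then obtain e where e: "e \<in> E" "w \<in> e" using maximal_no_isolated[of w] * by blast
    then have "a \<in> e" using star by blast
    then have "e = {w, a}" using edge_doubleton[OF edge_card[OF e(1)] e(2)] w(2) by (metis insertE singletonD)
    then show False using col e(1) w(3) by blast
  next
    case False
    obtain v where v: "v \<in> V" using ne by blast
    then obtain e where "e \<in> E" using maximal_no_isolated[of v] * by blast
    then show False using star False edge_sub by blast
  qed
qed

lemma maximal_face_other_end:
  assumes "F \<in> faces"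
  obtains f v where "f \<in> E" "on_face F f" "v \<in> f" "v \<noteq> u" "s v = t"
proof -
  have nonempty: "\<exists>f\<in>E. on_face F f \<and> u \<notin> f" for u
    using face_star[OF assms, of u] maximal_no_star[of u] by blast
  show ?thesis
  proof (cases "s u = t")
    case True
    obtain f where f: "f \<in> E" "on_face F f" "u \<notin> f" using nonempty by blast
    obtain v where v: "v \<in> f" "s v = t" using edge_color[OF f(1)] by blast
    then show ?thesis using that f by blast
  next
    case False
    obtain f where f: "f \<in> E" "on_face F f" using nonempty by blast
    obtain v where v: "v \<in> f" "s v = t" using edge_color[OF f(1)] by blast
    then show ?thesis using that f False by blast
  qed
qed

text \<open>Every face also sees two vertices of the opposite colour. Together with three vertices
  of one colour they would span a \<open>K_{2,3}\<close>, since all pairs of different colours on a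
  face are joined.\<close>

lemma maximal_face_side_le_2:
  assumes F: "F \<in> faces"
  shows "card {v. s v = t \<and> (\<exists>e\<in>E. on_face F e \<and> v \<in> e)} \<le> 2"
proof (rule ccontr)
  let ?S = "{v. s v = t \<and> (\<exists>e\<in>E. on_face F e \<and> v \<in> e)}"
  assume "\<not> card ?S \<le> 2"
  then have c3: "3 \<le> card ?S" by simp
  obtain B where B: "B \<subseteq> ?S" "card B = 3" "finite B" by (rule obtain_subset_with_card_n[OF c3])
  obtain x y z where "B = {x, y, z}" and neq: "x \<noteq> y" "x \<noteq> z" "y \<noteq> z"
    using B(2) unfolding card_3_iff by blast
  then have xyz: "x \<in> ?S" "y \<in> ?S" "z \<in> ?S" using B(1) by simp_all
  define b where "b = (\<lambda>i::nat. if i = 1 then x else if i = 2 then y else z)"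
  have b: "b i \<in> ?S" for i using xyz by (auto simp: b_def)
  then have "\<forall>i. \<exists>e. e \<in> E \<and> on_face F e \<and> b i \<in> e" by blast
  then obtain e where e: "\<And>i. e i \<in> E \<and> on_face F (e i) \<and> b i \<in> e i" by metis
  obtain f a where a: "f \<in> E" "on_face F f" "a \<in> f" "s a = (\<not> t)" using maximal_face_other_end[OF F] by metis
  obtain f' a' where a': "f' \<in> E" "on_face F f'" "a' \<in> f'" "a' \<noteq> a" "s a' = (\<not> t)"
    using maximal_face_other_end[OF F] .
  have ab: "{a, b i} \<in> E \<and> {b i, a'} \<in> E" for i
  proof
    have sb: "s (b i) = t" using b by blast
    show "{a, b i} \<in> E"
      using maximal_face_complete[OF F a(1-3), of "e i" "b i"] e[of i] a(4) sb by simp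
    show "{b i, a'} \<in> E"
      using maximal_face_complete[OF F _ _ _ a'(1-3), of "e i" "b i"] e[of i] a'(5) sb by simp
  qed
  show False
    by (rule face_not_three[OF F, of e b a a']) (use e ab a'(4) neq in \<open>auto simp: b_def\<close>)
qed

lemma maximal_face_edges_le_4:
  assumes F: "F \<in> faces"
  shows "card {e \<in> E. on_face F e} \<le> 4"
proof -
  let ?S = "\<lambda>t. {v. s v = t \<and> (\<exists>e\<in>E. on_face F e \<and> v \<in> e)}"
  have fin: "finite (?S t)" for t by (rule finite_subset[OF _ finV]) (use edge_sub in auto)
  have "{e \<in> E. on_face F e} \<subseteq> (\<lambda>(x, y). {x, y}) ` (?S True \<times> ?S False)"
  proof
    fix e assume "e \<in> {e \<in> E. on_face F e}"
    then have e: "e \<in> E" "on_face F e" by auto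
    obtain x where x: "x \<in> e" "s x = True" using edge_color[OF e(1)] .
    obtain y where y: "e = {x, y}" using edge_doubleton[OF edge_card[OF e(1)] x(1)] by blast
    then have "\<not> s y" using col[of x y] e(1) x(2) by simp
    then have "(x, y) \<in> ?S True \<times> ?S False" using x y e by auto
    then show "e \<in> (\<lambda>(x, y). {x, y}) ` (?S True \<times> ?S False)"
      unfolding y by (rule rev_image_eqI) simp
  qed
  then have "card {e \<in> E. on_face F e} \<le> card (?S True \<times> ?S False)"
    using fin[of True] fin[of False] by (intro surj_card_le finite_cartesian_product) auto
  also have "\<dots> = card (?S True) * card (?S False)" by (rule card_cartesian_product)
  also have "\<dots> \<le> 2 * 2" by (intro mult_le_mono maximal_face_side_le_2 F)
  finally show ?thesis by simp
qed

text \<open>A face at \<open>e\<close> sees a further vertex of each colour, and completeness makes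
  the four vertices a 4-cycle through \<open>e\<close>. Every point of a Jordan curve is a limit of
  both its sides, so \<open>e\<close> has one face inside and another that is not inside.\<close>

lemma maximal_edge_two_faces:
  assumes e: "e \<in> E"
  obtains F1 F2 where "F1 \<in> faces" "F2 \<in> faces" "F1 \<noteq> F2" "on_face F1 e" "on_face F2 e"
proof -
  obtain F where F: "F \<in> faces" "on_face F e" using edge_on_some_face[OF e] .
  obtain u v where uv: "e = {u, v}" using edge_card[OF e] by (auto simp: card_2_iff)
  have suv: "s u \<noteq> s v" using col e uv by blast
  obtain f u' where f: "f \<in> E" "on_face F f" "u' \<in> f" "u' \<noteq> u" "s u' = s u"
    using maximal_face_other_end[OF F(1)] .
  obtain g v' where g: "g \<in> E" "on_face F g" "v' \<in> g" "v' \<noteq> v" "s v' = s v"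
    using maximal_face_other_end[OF F(1)] .
  note mc = maximal_face_complete[OF F(1)]
  have "{v, u'} \<in> E" using mc[OF e F(2) _ f(1,2,3), of v] uv suv f(5) by simp
  moreover have "{u, v'} \<in> E" using mc[OF e F(2) _ g(1,2,3), of u] uv suv g(5) by simp
  moreover have "{v', u'} \<in> E" using mc[OF g(1,2,3) f(1,2,3)] suv f(5) g(5) by simp
  ultimately have q: "quad u v u' v'" using e uv f(4) g(4) by (auto simp: quad_def)
  obtain c d where cd: "arcs_between u u' c d" "path_image c = P2 u v u'" "path_image d = P2 u v' u'"
    using quad_arcs[OF q] .
  let ?J = "Q u v u' v'"
  have Jcd: "?J = path_image c \<union> path_image d" using cd by simp
  note Jd = Jordan_two_arcs[OF cd(1), folded Jcd]
  obtain z where z: "z \<in> open_edge e" using open_edge_nonempty[OF e] by blast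
  have eJ: "pim e \<subseteq> ?J" unfolding uv P2_def by blast
  have zJ: "z \<in> ?J" using z eJ by (auto simp: open_edge_def)
  have zi: "z \<in> closure (inside ?J)" using zJ Jd(8) unfolding frontier_def by blast
  have zo: "z \<in> closure (outside ?J)" using zJ Jd(9) unfolding frontier_def by blast
  have dis: "inside ?J \<inter> pim e = {}" "outside ?J \<inter> pim e = {}"
    using eJ inside_no_overlap[of ?J] outside_no_overlap[of ?J] by blast+
  obtain F1 where F1: "F1 \<in> faces" "on_face F1 e" "F1 \<inter> inside ?J \<noteq> {}"
    using face_near_edge[OF e z zi dis(1)] .
  obtain F2 where F2: "F2 \<in> faces" "on_face F2 e" "F2 \<inter> outside ?J \<noteq> {}"
    using face_near_edge[OF e z zo dis(2)] .
  have "F1 \<inter> ?J = {}" using faceD(3)[OF F1(1)] Q_sub_X[OF q] by blast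
  then have "F1 \<subseteq> inside ?J" using connected_subset_inside[OF faceD(2)[OF F1(1)]] F1(3) by simp
  then have "F1 \<noteq> F2" using F2(3) inside_Int_outside[of ?J] by blast
  then show ?thesis using that F1 F2 by blast
qed

text \<open>Double counting of incidences gives at most twice as many edges as faces, and Euler's
  inequality bounds the faces by \<open>card E + 2 - card V\<close>.\<close>

lemma maximal_edge_count: "2 * card V \<le> card E + 4"
proof -
  note eu = euler_inequality[OF maximal_connected ne]
  have "2 * card E = (\<Sum>e\<in>E. 2)" by simp
  also have "\<dots> \<le> (\<Sum>e\<in>E. card {F \<in> faces. on_face F e})"
  proof (rule sum_mono)
    fix e assume "e \<in> E"
    then obtain F1 F2 where F: "F1 \<in> faces" "F2 \<in> faces" "F1 \<noteq> F2" "on_face F1 e" "on_face F2 e"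
      using maximal_edge_two_faces by blast
    have "card {F1, F2} \<le> card {F \<in> faces. on_face F e}"
      using F eu(1) by (intro card_mono) auto
    then show "2 \<le> card {F \<in> faces. on_face F e}" using F(3) by simp
  qed
  also have "\<dots> = (\<Sum>F\<in>faces. card {e \<in> E. on_face F e})"
    by (rule sum_multicount_gen[OF finE eu(1)]) simp
  also have "\<dots> \<le> (\<Sum>F\<in>faces. 4)" by (intro sum_mono maximal_face_edges_le_4)
  also have "\<dots> = 4 * card faces" by simp
  finally show ?thesis using eu(2) by linarith
qed

end

end

end

section \<open>Polynomial functions and independent rows\<close>

text \<open>Working with the induced real functions lets closure under sums and products replace
  calculations with formal polynomials.\<close>

definition rat_polyfun :: "'i set \<Rightarrow> (('i \<Rightarrow> real) \<Rightarrow> real) \<Rightarrow> bool" where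
  "rat_polyfun I f \<longleftrightarrow> (\<exists>P :: ('i \<Rightarrow>\<^sub>0 nat) \<Rightarrow>\<^sub>0 rat.
     (\<forall>m\<in>Poly_Mapping.keys P. Poly_Mapping.keys m \<subseteq> I) \<and> (\<forall>x. f x = eval_rat_poly x P))"

definition monom_eval :: "('i \<Rightarrow> real) \<Rightarrow> ('i \<Rightarrow>\<^sub>0 nat) \<Rightarrow> real" where
  "monom_eval x m = (\<Prod>i\<in>Poly_Mapping.keys m. x i ^ Poly_Mapping.lookup m i)"

lemma monom_eval_superset:
  assumes "finite S" "Poly_Mapping.keys m \<subseteq> S"
  shows "monom_eval x m = (\<Prod>i\<in>S. x i ^ Poly_Mapping.lookup m i)"
  unfolding monom_eval_def
  by (rule prod.mono_neutral_left) (use assms in \<open>auto simp: in_keys_iff\<close>)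

lemma monom_eval_add: "monom_eval x (m + n) = monom_eval x m * monom_eval x n"
proof -
  let ?S = "Poly_Mapping.keys m \<union> Poly_Mapping.keys n"
  have "Poly_Mapping.keys (m + n) \<subseteq> ?S" by (rule Poly_Mapping.keys_add)
  then show ?thesis
    by (simp add: monom_eval_superset[of ?S] lookup_add power_add prod.distrib)
qed

lemma eval_rat_poly_superset:
  assumes "finite S" "Poly_Mapping.keys P \<subseteq> S"
  shows "eval_rat_poly x P = (\<Sum>m\<in>S. of_rat (Poly_Mapping.lookup P m) * monom_eval x m)"
  unfolding eval_rat_poly_def monom_eval_def
  by (rule sum.mono_neutral_left) (use assms in \<open>auto simp: in_keys_iff\<close>)

lemma eval_rat_poly_add: "eval_rat_poly x (P + Q) = eval_rat_poly x P + eval_rat_poly x Q"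
proof -
  let ?S = "Poly_Mapping.keys P \<union> Poly_Mapping.keys Q"
  have "Poly_Mapping.keys (P + Q) \<subseteq> ?S" by (rule Poly_Mapping.keys_add)
  then show ?thesis
    by (simp add: eval_rat_poly_superset[of ?S] lookup_add of_rat_add distrib_right sum.distrib)
qed

lemma eval_rat_poly_single:
  "eval_rat_poly x (Poly_Mapping.single m c) = of_rat c * monom_eval x m"
  by (simp add: eval_rat_poly_superset[of "{m}"])

lemma rat_polyfun_single:
  assumes "Poly_Mapping.keys m \<subseteq> I"
  shows "rat_polyfun I (\<lambda>x. of_rat c * monom_eval x m)"
  unfolding rat_polyfun_def
  by (rule exI[of _ "Poly_Mapping.single m c"]) (use assms in \<open>auto simp: eval_rat_poly_single\<close>)

lemma rat_polyfun_add:
  assumes "rat_polyfun I f" "rat_polyfun I g"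
  shows "rat_polyfun I (\<lambda>x. f x + g x)"
proof -
  obtain P Q where P: "\<forall>m\<in>Poly_Mapping.keys P. Poly_Mapping.keys m \<subseteq> I" "\<forall>x. f x = eval_rat_poly x P"
    and Q: "\<forall>m\<in>Poly_Mapping.keys Q. Poly_Mapping.keys m \<subseteq> I" "\<forall>x. g x = eval_rat_poly x Q"
    using assms unfolding rat_polyfun_def by blast
  have "\<forall>m\<in>Poly_Mapping.keys (P + Q). Poly_Mapping.keys m \<subseteq> I"
    using P(1) Q(1) Poly_Mapping.keys_add[of P Q] by blast
  then show ?thesis unfolding rat_polyfun_def
    by (intro exI[of _ "P + Q"]) (simp add: P(2) Q(2) eval_rat_poly_add)
qed

lemma rat_polyfun_const: "rat_polyfun I (\<lambda>x. of_rat c)"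
  using rat_polyfun_single[of 0 I c] by (simp add: monom_eval_def)

lemma rat_polyfun_0: "rat_polyfun I (\<lambda>x. 0)" and rat_polyfun_1: "rat_polyfun I (\<lambda>x. 1)"
  using rat_polyfun_const[of I 0] rat_polyfun_const[of I 1] by simp_all

lemma rat_polyfun_var:
  assumes "i \<in> I" shows "rat_polyfun I (\<lambda>x. x i)"
  using rat_polyfun_single[of "Poly_Mapping.single i 1" I 1] assms by (simp add: monom_eval_def)

lemma rat_polyfun_sum:
  assumes "\<And>j. j \<in> S \<Longrightarrow> rat_polyfun I (f j)"
  shows "rat_polyfun I (\<lambda>x. \<Sum>j\<in>S. f j x)"
  using assms by (induction S rule: infinite_finite_induct) (auto intro: rat_polyfun_add rat_polyfun_0)

lemma rat_polyfun_mult: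
  assumes "rat_polyfun I f" "rat_polyfun I g"
  shows "rat_polyfun I (\<lambda>x. f x * g x)"
proof -
  obtain P Q where P: "\<forall>m\<in>Poly_Mapping.keys P. Poly_Mapping.keys m \<subseteq> I" "\<forall>x. f x = eval_rat_poly x P"
    and Q: "\<forall>m\<in>Poly_Mapping.keys Q. Poly_Mapping.keys m \<subseteq> I" "\<forall>x. g x = eval_rat_poly x Q"
    using assms unfolding rat_polyfun_def by blast
  have "f x * g x = (\<Sum>m\<in>Poly_Mapping.keys P. \<Sum>n\<in>Poly_Mapping.keys Q.
      of_rat (Poly_Mapping.lookup P m * Poly_Mapping.lookup Q n) * monom_eval x (m + n))" for x
    using P(2) Q(2)
    by (simp add: eval_rat_poly_def sum_product monom_eval_add of_rat_mult flip: monom_eval_def)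
      (simp add: mult_ac)
  moreover have "rat_polyfun I (\<lambda>x. \<Sum>m\<in>Poly_Mapping.keys P. \<Sum>n\<in>Poly_Mapping.keys Q.
      of_rat (Poly_Mapping.lookup P m * Poly_Mapping.lookup Q n) * monom_eval x (m + n))"
  proof (intro rat_polyfun_sum rat_polyfun_single)
    fix m n assume "m \<in> Poly_Mapping.keys P" "n \<in> Poly_Mapping.keys Q"
    then have "Poly_Mapping.keys m \<union> Poly_Mapping.keys n \<subseteq> I" using P Q by blast
    then show "Poly_Mapping.keys (m + n) \<subseteq> I" using Poly_Mapping.keys_add[of m n] by blast
  qed
  ultimately show ?thesis by presburger
qed

lemma rat_polyfun_diff:
  assumes "rat_polyfun I f" "rat_polyfun I g"
  shows "rat_polyfun I (\<lambda>x. f x - g x)"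
proof -
  have "rat_polyfun I (\<lambda>x. f x + of_rat (- 1) * g x)"
    by (intro rat_polyfun_add rat_polyfun_mult rat_polyfun_const assms)
  then show ?thesis by (simp add: of_rat_minus)
qed

text \<open>The point \<open>x0\<close> only witnesses that the polynomial is not zero; this is how
  a special position decides about all generic ones.\<close>

lemma rat_polyfun_generic:
  assumes "rat_polyfun I f" "f x0 \<noteq> 0" "algebraically_independent_rat I x"
  shows "f x \<noteq> 0"
proof
  assume 0: "f x = 0"
  obtain P where P: "\<forall>m\<in>Poly_Mapping.keys P. Poly_Mapping.keys m \<subseteq> I" "\<forall>x. f x = eval_rat_poly x P"
    using assms(1) unfolding rat_polyfun_def by blast
  have "P = 0" using assms(3) P 0 unfolding algebraically_independent_rat_def by metis
  then show False using assms(2) P(2) by (simp add: eval_rat_poly_def)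
qed

lemma rat_polyfun_line:
  assumes "rat_polyfun I f"
  obtains p where "\<And>t. f (\<lambda>i. a i + t * d i) = poly p t"
proof -
  obtain P where P: "\<forall>x. f x = eval_rat_poly x P" using assms unfolding rat_polyfun_def by blast
  show ?thesis
    by (rule that[of "\<Sum>m\<in>Poly_Mapping.keys P. smult (of_rat (Poly_Mapping.lookup P m))
          (\<Prod>i\<in>Poly_Mapping.keys m. [:a i, d i:] ^ Poly_Mapping.lookup m i)"])
      (simp add: P eval_rat_poly_def poly_sum poly_prod)
qed

text \<open>On the line through \<open>a\<close> and \<open>b\<close> both functions are univariate
  polynomials, one nonzero at \<open>t = 0\<close> and the other at \<open>t = 1\<close>; their
  product has finitely many roots.\<close>

lemma rat_polyfun_both_nonzero:
  assumes f: "rat_polyfun I f" "f a \<noteq> 0" and g: "rat_polyfun J g" "g b \<noteq> 0"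
  obtains x where "f x \<noteq> 0" "g x \<noteq> 0"
proof -
  define d where "d = (\<lambda>i. b i - a i)"
  obtain p where p: "\<And>t. f (\<lambda>i. a i + t * d i) = poly p t" using rat_polyfun_line[OF f(1)] by blast
  obtain q where q: "\<And>t. g (\<lambda>i. a i + t * d i) = poly q t" using rat_polyfun_line[OF g(1)] by blast
  have "p \<noteq> 0" using p[of 0] f(2) by auto
  moreover have "q \<noteq> 0" using q[of 1] g(2) by (auto simp: d_def)
  ultimately have "finite {t. poly (p * q) t = 0}" by (intro poly_roots_finite) simp
  then obtain t where "poly (p * q) t \<noteq> 0"
    by (metis (mono_tags, lifting) ex_new_if_finite infinite_UNIV_char_0 mem_Collect_eq)
  then show ?thesis using that[of "\<lambda>i. a i + t * d i"] p q by auto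
qed

section \<open>Linear independence of families of rows\<close>

definition rows_free :: "'e set \<Rightarrow> 'c set \<Rightarrow> ('e \<Rightarrow> 'c \<Rightarrow> real) \<Rightarrow> bool" where
  "rows_free S C r \<longleftrightarrow> (\<forall>w. (\<forall>c\<in>C. (\<Sum>e\<in>S. w e * r e c) = 0) \<longrightarrow> (\<forall>e\<in>S. w e = 0))"

text \<open>Gaussian elimination, without divisions, turns the independence of finitely many rows into the
  non-vanishing of a single polynomial.\<close>

lemma rows_free_polynomial:
  assumes "finite S" "\<And>e c. e \<in> S \<Longrightarrow> c \<in> C \<Longrightarrow> rat_polyfun I (\<lambda>x. r x e c)" "rows_free S C (r x0)"
  shows "\<exists>g. rat_polyfun I g \<and> g x0 \<noteq> 0 \<and> (\<forall>x. g x \<noteq> 0 \<longrightarrow> rows_free S C (r x))"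
  using assms
proof (induction S arbitrary: r rule: finite_induct)
  case empty
  have "rows_free {} C (r x)" for x by (simp add: rows_free_def)
  then show ?case using rat_polyfun_1[of I] by (intro exI[of _ "\<lambda>x. 1"]) auto
next
  case (insert e0 S)
  obtain c0 where c0: "c0 \<in> C" "r x0 e0 c0 \<noteq> 0"
  proof (rule ccontr)
    assume "\<not> thesis"
    then have "\<forall>c\<in>C. r x0 e0 c = 0" using that by blast
    then have "\<forall>c\<in>C. (\<Sum>e\<in>insert e0 S. (if e = e0 then 1 else 0) * r x0 e c) = 0"
      using insert.hyps by (auto intro!: sum.neutral)
    then have "\<forall>e\<in>insert e0 S. (if e = e0 then 1 else 0::real) = 0"
      using insert.prems(2) unfolding rows_free_def by (elim allE impE) auto
    then show False by simp
  qed
  \<comment> \<open>Cross multiplication with the pivot clears column \<open>c0\<close> and keeps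
    all entries polynomial. The polynomial obtained in the end is the product of the successive
    pivots.\<close>
  define r' where "r' = (\<lambda>x e c. r x e0 c0 * r x e c - r x e c0 * r x e0 c)"
  have r'_sum: "(\<Sum>e\<in>S. w e * r' x e c) = r x e0 c0 * (\<Sum>e\<in>S. w e * r x e c) - (\<Sum>e\<in>S. w e * r x e c0) * r x e0 c" for w x c
    by (simp add: r'_def sum_distrib_left sum_distrib_right sum_subtractf algebra_simps)
  have "rows_free S C (r' x0)"
    unfolding rows_free_def
  proof (intro allI impI ballI)
    fix w e assume w: "\<forall>c\<in>C. (\<Sum>e\<in>S. w e * r' x0 e c) = 0" and e: "e \<in> S"
    \<comment> \<open>A relation between reduced rows is lifted to the original ones: the weights
      are scaled by the pivot, and the weight of \<open>e0\<close> cancels column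
      \<open>c0\<close>.\<close>
    define w' where "w' = (\<lambda>e. if e = e0 then - (\<Sum>e\<in>S. w e * r x0 e c0) else w e * r x0 e0 c0)"
    have "(\<Sum>e\<in>insert e0 S. w' e * r x0 e c) = 0" if "c \<in> C" for c
    proof -
      have "(\<Sum>e\<in>S. w' e * r x0 e c) = (\<Sum>e\<in>S. r x0 e0 c0 * (w e * r x0 e c))"
        using insert.hyps by (intro sum.cong) (auto simp: w'_def)
      then have "(\<Sum>e\<in>insert e0 S. w' e * r x0 e c) = (\<Sum>e\<in>S. w e * r' x0 e c)"
        using insert.hyps unfolding r'_sum by (simp add: w'_def sum_distrib_left)
      then show ?thesis using w that by simp
    qed
    then have "w' e = 0" using insert.prems(2) e unfolding rows_free_def by blast
    moreover have "e \<noteq> e0" using e insert.hyps by blast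
    ultimately show "w e = 0" using c0(2) by (simp add: w'_def)
  qed
  moreover have "rat_polyfun I (\<lambda>x. r' x e c)" if "e \<in> S" "c \<in> C" for e c
    unfolding r'_def using that c0(1) insert.prems(1)
    by (intro rat_polyfun_diff rat_polyfun_mult) auto
  ultimately obtain g where g: "rat_polyfun I g" "g x0 \<noteq> 0" "\<And>x. g x \<noteq> 0 \<Longrightarrow> rows_free S C (r' x)"
    using insert.IH[of r'] by blast
  show ?case
  proof (intro exI[of _ "\<lambda>x. r x e0 c0 * g x"] conjI allI impI)
    show "rat_polyfun I (\<lambda>x. r x e0 c0 * g x)"
      using c0(1) insert.prems(1) g(1) by (intro rat_polyfun_mult) auto
    show "r x0 e0 c0 * g x0 \<noteq> 0" using c0 g by simp
    fix x assume nz: "r x e0 c0 * g x \<noteq> 0"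
    show "rows_free (insert e0 S) C (r x)"
      unfolding rows_free_def
    proof (intro allI impI)
      fix w assume w: "\<forall>c\<in>C. (\<Sum>e\<in>insert e0 S. w e * r x e c) = 0"
      then have w0: "(\<Sum>e\<in>S. w e * r x e c) = - w e0 * r x e0 c" if "c \<in> C" for c
        using insert.hyps that by (simp add: eq_neg_iff_add_eq_0 add.commute)
      have "(\<Sum>e\<in>S. w e * r' x e c) = 0" if "c \<in> C" for c
        unfolding r'_sum w0[OF that] w0[OF c0(1)] by (simp add: algebra_simps)
      then have wS: "\<forall>e\<in>S. w e = 0" using g(3)[of x] nz unfolding rows_free_def by auto
      then have "w e0 * r x e0 c0 = 0" using w0[OF c0(1)] by simp
      then show "\<forall>e\<in>insert e0 S. w e = 0" using wS nz by auto
    qed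
  qed
qed

text \<open>Elimination with one equation per element of \<open>C\<close> and one unknown per
  element of \<open>S\<close>: each step spends an equation and at most one unknown.\<close>

lemma underdetermined_solution:
  assumes "finite C" "finite S" "card C < card S"
  shows "\<exists>w :: 'e \<Rightarrow> real. (\<exists>e\<in>S. w e \<noteq> 0) \<and> (\<forall>c\<in>C. (\<Sum>e\<in>S. w e * r e c) = 0)"
  using assms
proof (induction C arbitrary: S r rule: finite_induct)
  case empty
  then obtain e where "e \<in> S" by fastforce
  then show ?case by (intro exI[of _ "\<lambda>_. 1"]) auto
next
  case (insert c C)
  show ?case
  proof (cases "\<forall>e\<in>S. r e c = 0")
    case True
    have "card C < card S" using insert by simp
    from insert.IH[OF insert.prems(1) this] obtain w :: "'e \<Rightarrow> real"
      where "\<exists>e\<in>S. w e \<noteq> 0" "\<forall>c\<in>C. (\<Sum>e\<in>S. w e * r e c) = 0" by blast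
    then show ?thesis using True by (intro exI[of _ w]) auto
  next
    case False
    then obtain e0 where e0: "e0 \<in> S" "r e0 c \<noteq> 0" by blast
    define r' where "r' = (\<lambda>e d. r e d - r e c / r e0 c * r e0 d)"
    have "card C < card (S - {e0})" using insert e0 by simp
    from insert.IH[OF _ this, of r'] obtain w :: "'e \<Rightarrow> real"
      where w: "\<exists>e\<in>S - {e0}. w e \<noteq> 0" "\<forall>d\<in>C. (\<Sum>e\<in>S - {e0}. w e * r' e d) = 0"
      using insert.prems by auto
    define w' where "w' = (\<lambda>e. if e = e0 then - (\<Sum>e\<in>S - {e0}. w e * r e c) / r e0 c else w e)"
    have sum: "(\<Sum>e\<in>S. w' e * r e d) = (\<Sum>e\<in>S - {e0}. w e * r' e d)" for d
    proof -
      have "(\<Sum>e\<in>S. w' e * r e d) = w' e0 * r e0 d + (\<Sum>e\<in>S - {e0}. w' e * r e d)"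
        using insert.prems e0 by (simp add: sum.remove)
      also have "(\<Sum>e\<in>S - {e0}. w' e * r e d) = (\<Sum>e\<in>S - {e0}. w e * r e d)"
        by (intro sum.cong) (auto simp: w'_def)
      also have "w' e0 * r e0 d = - (\<Sum>e\<in>S - {e0}. w e * (r e c / r e0 c * r e0 d))"
        by (simp add: w'_def sum_distrib_right sum_divide_distrib mult.assoc)
      finally show ?thesis by (simp add: r'_def right_diff_distrib sum_subtractf)
    qed
    have "(\<Sum>e\<in>S. w' e * r e c) = 0" unfolding sum using e0 by (simp add: r'_def)
    then have "\<forall>d\<in>insert c C. (\<Sum>e\<in>S. w' e * r e d) = 0" using w(2) sum by simp
    moreover have "\<exists>e\<in>S. w' e \<noteq> 0" using w(1) by (auto simp: w'_def)
    ultimately show ?thesis by blast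
  qed
qed

section \<open>Transfer to abstract vertices\<close>

lemma image_edges_cancel:
  assumes "inj_on p V" "\<And>e. e \<in> E \<Longrightarrow> e \<subseteq> V"
  shows "(`) (inv_into V p) ` (`) p ` E = E"
proof -
  have "(`) (inv_into V p) ` (`) p ` E = (\<lambda>e. e) ` E"
    unfolding image_image[of "(`) (inv_into V p)"]
    by (intro image_cong refl) (use inv_into_image_cancel[OF assms(1)] assms(2) in auto)
  then show ?thesis by simp
qed

lemma image_edge_iff:
  assumes "inj_on p V" "\<And>e. e \<in> E \<Longrightarrow> e \<subseteq> V" "u \<in> V" "v \<in> V"
  shows "{p u, p v} \<in> (`) p ` E \<longleftrightarrow> {u, v} \<in> E"
proof
  assume "{p u, p v} \<in> (`) p ` E"
  then obtain e where e: "e \<in> E" "p ` {u, v} = p ` e" by auto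
  then have "{u, v} = e" using inj_on_image_eq_iff[OF assms(1), of "{u, v}" e] assms by auto
  then show "{u, v} \<in> E" using e by simp
next
  assume "{u, v} \<in> E"
  then show "{p u, p v} \<in> (`) p ` E" using imageI[of "{u, v}" E "(`) p"] by simp
qed

lemma plane_graph_image:
  assumes "finite V" "\<And>e. e \<in> E \<Longrightarrow> e \<subseteq> V \<and> card e = 2" and d: "plane_drawing V E p \<gamma>"
  shows "plane_graph (p ` V) ((`) p ` E) (\<lambda>e. \<gamma> (inv_into V p ` e))"
proof -
  have inj: "inj_on p V" using d by (simp add: plane_drawing_def)
  have i: "inv_into V p ` p ` e = e" if "e \<in> E" for e using inv_into_image_cancel[OF inj] assms(2) that by blast
  have dE: "arc (\<gamma> e)" "{pathstart (\<gamma> e), pathfinish (\<gamma> e)} = p ` e" "path_image (\<gamma> e) \<inter> p ` V = p ` e" if "e \<in> E" for e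
    using d that unfolding plane_drawing_def by simp_all
  show ?thesis
  proof
    show "finite (p ` V)" using assms(1) by simp
  next
    fix e assume "e \<in> (`) p ` E"
    then obtain e' where e': "e' \<in> E" "e = p ` e'" by blast
    show "e \<subseteq> p ` V" using e' assms(2) by blast
    show "card e = 2" using e' assms(2) card_image[OF inj_on_subset[OF inj]] by metis
    show "arc (\<gamma> (inv_into V p ` e))" "path_image (\<gamma> (inv_into V p ` e)) \<inter> p ` V = e"
      "{pathstart (\<gamma> (inv_into V p ` e)), pathfinish (\<gamma> (inv_into V p ` e))} = e"
      using dE[OF e'(1)] i[OF e'(1)] e'(2) by simp_all
  next
    fix e f assume "e \<in> (`) p ` E" "f \<in> (`) p ` E" "e \<noteq> f"
    then obtain e' f' where e': "e' \<in> E" "e = p ` e'" and f': "f' \<in> E" "f = p ` f'" and "e' \<noteq> f'" by blast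
    then have "path_image (\<gamma> e') \<inter> path_image (\<gamma> f') \<subseteq> p ` (e' \<inter> f')"
      using d unfolding plane_drawing_def by blast
    then show "path_image (\<gamma> (inv_into V p ` e)) \<inter> path_image (\<gamma> (inv_into V p ` f)) \<subseteq> e \<inter> f"
      using i[OF e'(1)] i[OF f'(1)] e'(2) f'(2) by auto
  qed
qed

lemma plane_bipartite_image:
  assumes "finite V" "\<And>e. e \<in> E \<Longrightarrow> e \<subseteq> V \<and> card e = 2" and d: "plane_drawing V E p \<gamma>"
    and col: "\<And>u v. {u, v} \<in> E \<Longrightarrow> s u \<noteq> s v"
  shows "plane_bipartite (p ` V) ((`) p ` E) (\<lambda>e. \<gamma> (inv_into V p ` e)) (s \<circ> inv_into V p)"
proof -
  interpret plane_graph "p ` V" "(`) p ` E" "\<lambda>e. \<gamma> (inv_into V p ` e)"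
    by (rule plane_graph_image[OF assms(1-3)])
  have inj: "inj_on p V" using d by (simp add: plane_drawing_def)
  show ?thesis
  proof
    fix u v assume uv: "{u, v} \<in> (`) p ` E"
    then have "{u, v} \<subseteq> p ` V" using edge_sub by blast
    then obtain x y where xy: "x \<in> V" "y \<in> V" "u = p x" "v = p y" by blast
    then have "{x, y} \<in> E" using uv image_edge_iff[OF inj, of E x y] assms(2) by auto
    then show "(s \<circ> inv_into V p) u \<noteq> (s \<circ> inv_into V p) v"
      using col xy inv_into_f_f[OF inj] by simp
  qed
qed

lemma contract_edges_image:
  assumes "\<And>e. e \<in> E \<Longrightarrow> r' ` p ` e = p ` r ` e" "\<And>e. e \<in> E \<Longrightarrow> card (p ` r ` e) = card (r ` e)"
  shows "contract_edges r' ((`) p ` E) = (`) p ` contract_edges r E"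
proof (intro equalityI subsetI)
  fix f assume "f \<in> contract_edges r' ((`) p ` E)"
  then obtain e where e: "e \<in> E" "f = r' ` p ` e" "card f = 2" unfolding contract_edges_def by blast
  then have "card (r ` e) = 2" using assms by metis
  then have "r ` e \<in> contract_edges r E" using e(1) by (simp add: contract_edges_def)
  then show "f \<in> (`) p ` contract_edges r E" using e(2) assms(1)[OF e(1)] by blast
next
  fix f assume "f \<in> (`) p ` contract_edges r E"
  then obtain e where e: "e \<in> E" "f = p ` r ` e" "card (r ` e) = 2" unfolding contract_edges_def by blast
  then have "f = r' ` p ` e" "card f = 2" using assms by metis+
  then show "f \<in> contract_edges r' ((`) p ` E)" using e(1) by (simp add: contract_edges_def)
qed

text \<open>The drawn copy of the graph is coloured through the inverse of the placement; the pair
  found there and the drawing of the identified graph are pulled back.\<close>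

lemma planar_identifiable_pair:
  fixes E :: "'v set set"
  assumes fin: "finite V" and E: "\<And>e. e \<in> E \<Longrightarrow> e \<subseteq> V \<and> card e = 2" and pl: "planar V E"
    and col: "\<And>u v. {u, v} \<in> E \<Longrightarrow> s u \<noteq> s v"
    and V: "V = \<Union>E" and nostar: "\<And>a. \<exists>e\<in>E. a \<notin> e"
  obtains u v where "u \<in> V" "v \<in> V" "u \<noteq> v" "s u = (s v :: bool)" "card {w. {u, w} \<in> E \<and> {v, w} \<in> E} \<le> 2"
    "planar (V - {v}) (contract_edges (id(v := u)) E)"
proof -
  obtain p \<gamma> where d: "plane_drawing V E p \<gamma>" using pl by (auto simp: planar_def)
  have inj: "inj_on p V" using d by (simp add: plane_drawing_def)
  let ?i = "inv_into V p"
  interpret G: plane_bipartite "p ` V" "(`) p ` E" "\<lambda>e. \<gamma> (?i ` e)" "s \<circ> ?i"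
    by (rule plane_bipartite_image[OF fin E d col])
  have iff: "{p u, p v} \<in> (`) p ` E \<longleftrightarrow> {u, v} \<in> E" if "u \<in> V" "v \<in> V" for u v
    using image_edge_iff[OF inj _ that] E by blast
  have "p ` V = \<Union>((`) p ` E)" using V by auto
  moreover have "\<exists>e\<in>(`) p ` E. a \<notin> e" for a
  proof (cases "a \<in> p ` V")
    case True
    then obtain x where x: "x \<in> V" "a = p x" by blast
    obtain e where e: "e \<in> E" "x \<notin> e" using nostar by blast
    then have "a \<notin> p ` e" using x E[OF e(1)] inj by (meson inj_on_image_mem_iff)
    then show ?thesis using e by blast
  next
    case False
    obtain e where e: "e \<in> E" using nostar by blast
    then have "a \<notin> p ` e" using False E by blast
    then show ?thesis using e by blast
  qed
  ultimately obtain u' v' where uv': "u' \<in> p ` V" "v' \<in> p ` V" "u' \<noteq> v'" "(s \<circ> ?i) u' = (s \<circ> ?i) v'"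
    "card (G.common u' v') \<le> 2" "planar (p ` V - {v'}) (contract_edges (id(v' := u')) ((`) p ` E))"
    using G.exists_identifiable_pair by metis
  obtain u v where uv: "u \<in> V" "v \<in> V" "u' = p u" "v' = p v" using uv' by blast
  have s: "s u = s v" using uv'(4) uv inv_into_f_f[OF inj] by simp
  let ?C = "{w. {u, w} \<in> E \<and> {v, w} \<in> E}"
  have CV: "?C \<subseteq> V" using E by blast
  have "G.common u' v' = p ` ?C"
  proof
    show "p ` ?C \<subseteq> G.common u' v'" using iff uv CV by (auto simp: G.common_def)
    show "G.common u' v' \<subseteq> p ` ?C"
    proof
      fix w' assume w': "w' \<in> G.common u' v'"
      then have "w' \<in> p ` V" using G.edge_sub by (auto simp: G.common_def)
      then obtain w where w: "w \<in> V" "w' = p w" by blast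
      then have "w \<in> ?C" using w' iff uv by (auto simp: G.common_def)
      then show "w' \<in> p ` ?C" using w by blast
    qed
  qed
  then have c: "card ?C \<le> 2" using uv'(5) card_image[OF inj_on_subset[OF inj CV]] by simp
  let ?r = "id(v := u)" and ?r' = "id(v' := u')"
  have r: "?r' (p x) = p (?r x)" if "x \<in> V" for x
    using that uv inj by (auto simp: inj_on_def)
  have rV: "?r x \<in> V" if "x \<in> V" for x using that uv by auto
  have im: "?r' ` p ` e = p ` ?r ` e" if "e \<in> E" for e
    unfolding image_image by (intro image_cong refl r) (use E[OF that] in blast)
  have cE: "e \<subseteq> V" if e: "e \<in> contract_edges ?r E" for e
  proof -
    obtain e' where e': "e' \<in> E" "e = ?r ` e'" using e unfolding contract_edges_def by blast
    then show ?thesis using E[OF e'(1)] rV by blast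
  qed
  have cc: "contract_edges ?r' ((`) p ` E) = (`) p ` contract_edges ?r E"
  proof -
    have card: "card (p ` ?r ` e) = card (?r ` e)" if "e \<in> E" for e
    proof (rule card_image)
      have "?r ` e \<subseteq> V" using E[OF that] rV by blast
      then show "inj_on p (?r ` e)" by (rule inj_on_subset[OF inj])
    qed
    show ?thesis by (rule contract_edges_image) (use im card in blast)+
  qed
  have inji: "inj_on ?i (p ` V)" by (rule inj_on_inv_into) simp
  have "planar (?i ` (p ` V - {v'})) ((`) ?i ` contract_edges ?r' ((`) p ` E))"
  proof (rule planar_image[OF uv'(6)])
    show "inj_on ?i (p ` V - {v'})" using inji by (rule inj_on_subset) blast
    fix e assume e: "e \<in> contract_edges ?r' ((`) p ` E)"
    then obtain f where f: "f \<in> contract_edges ?r E" "e = p ` f" using cc by blast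
    have "v \<notin> f"
    proof -
      obtain g where "f = ?r ` g" using f(1) unfolding contract_edges_def by blast
      moreover have "?r x \<noteq> v" for x using uv' uv by (cases "x = v") auto
      ultimately show ?thesis by (metis imageE)
    qed
    then have "v' \<notin> e" using f cE[OF f(1)] uv inj by (meson inj_on_image_mem_iff)
    then show "e \<subseteq> p ` V - {v'}" using f cE[OF f(1)] by blast
  qed
  moreover have "?i ` (p ` V - {v'}) = V - {v}"
  proof -
    have "p ` V - {v'} = p ` (V - {v})" using uv inj by (auto simp: inj_on_def)
    then show ?thesis using inv_into_image_cancel[OF inj, of "V - {v}"] by simp
  qed
  moreover have "(`) ?i ` contract_edges ?r' ((`) p ` E) = contract_edges ?r E"
    unfolding cc using image_edges_cancel[OF inj cE] .
  ultimately have "planar (V - {v}) (contract_edges ?r E)" by simp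
  moreover have "u \<noteq> v" using uv uv' by blast
  ultimately show ?thesis using that uv(1,2) s c by blast
qed

lemma bipartite_image:
  assumes "inj_on p V" "\<And>e. e \<in> E \<Longrightarrow> e \<subseteq> V" "bipartite V E"
  shows "bipartite (p ` V) ((`) p ` E)"
proof -
  obtain A B where AB: "V = A \<union> B" "A \<inter> B = {}" "\<forall>e\<in>E. \<exists>a\<in>A. \<exists>b\<in>B. e = {a, b}"
    using assms(3) by (auto simp: bipartite_def bipartition_def)
  have "p ` A \<inter> p ` B = {}" using assms(1) AB(1,2) by (auto simp: inj_on_def)
  moreover have "\<exists>a\<in>p ` A. \<exists>b\<in>p ` B. e = {a, b}" if e: "e \<in> (`) p ` E" for e
  proof -
    obtain f where f: "f \<in> E" "e = p ` f" using e by blast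
    then obtain a b where "a \<in> A" "b \<in> B" "f = {a, b}" using AB(3) by blast
    then show ?thesis using f by auto
  qed
  ultimately show ?thesis using AB(1) unfolding bipartite_def bipartition_def by (metis image_Un)
qed

text \<open>An edge that could be added to the image would, by the inverse map, be one that could be
  added to the original graph.\<close>

lemma maximal_planar_bipartite_image:
  assumes inj: "inj_on p V" and E: "\<And>e. e \<in> E \<Longrightarrow> e \<subseteq> V" and max: "maximal_planar_bipartite V E"
  shows "maximal_planar_bipartite (p ` V) ((`) p ` E)"
proof -
  have "planar (p ` V) ((`) p ` E)" "bipartite (p ` V) ((`) p ` E)"
    using max planar_image[OF _ inj E] bipartite_image[OF inj E] unfolding maximal_planar_bipartite_def by blast+
  moreover have "\<not> planar (p ` V) (insert {u', v'} ((`) p ` E)) \<or> \<not> bipartite (p ` V) (insert {u', v'} ((`) p ` E))"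
    if h: "u' \<in> p ` V" "v' \<in> p ` V" "u' \<noteq> v'" "{u', v'} \<notin> (`) p ` E" for u' v'
  proof (rule ccontr)
    assume neg: "\<not> ?thesis"
    let ?i = "inv_into V p"
    obtain u v where uv: "u \<in> V" "v \<in> V" "u' = p u" "v' = p v" using h(1,2) by blast
    let ?E = "insert {u, v} E"
    have E': "e \<subseteq> V" if "e \<in> ?E" for e using that uv E by auto
    have im: "insert {u', v'} ((`) p ` E) = (`) p ` ?E" using uv by simp
    have inji: "inj_on ?i (p ` V)" by (rule inj_on_inv_into) simp
    have sub: "e \<subseteq> p ` V" if "e \<in> (`) p ` ?E" for e
      using that E' by blast
    have "planar (?i ` p ` V) ((`) ?i ` (`) p ` ?E)" "bipartite (?i ` p ` V) ((`) ?i ` (`) p ` ?E)"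
      using planar_image[OF _ inji sub] bipartite_image[OF inji sub] neg unfolding im by blast+
    moreover have "?i ` p ` V = V" using inv_into_image_cancel[OF inj] by simp
    moreover have "(`) ?i ` (`) p ` ?E = ?E" using image_edges_cancel[OF inj E'] .
    ultimately have "planar V ?E" "bipartite V ?E" by simp_all
    moreover have "u \<noteq> v" using h(3) uv by auto
    moreover have "{u, v} \<notin> E" using h(4) uv image_edge_iff[OF inj E uv(1,2)] by simp
    ultimately show False using max uv unfolding maximal_planar_bipartite_def by blast
  qed
  ultimately show ?thesis unfolding maximal_planar_bipartite_def by blast
qed

lemma maximal_planar_bipartite_no_isolated:
  fixes E :: "'v set set" and s :: "'v \<Rightarrow> bool"
  assumes fin: "finite V" and E: "\<And>e. e \<in> E \<Longrightarrow> e \<subseteq> V \<and> card e = 2" and max: "maximal_planar_bipartite V E"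
    and col: "\<And>u v. {u, v} \<in> E \<Longrightarrow> s u \<noteq> s v" and v: "v \<in> V" "V \<noteq> {v}"
  obtains e where "e \<in> E" "v \<in> e"
proof -
  obtain p \<gamma> where d: "plane_drawing V E p \<gamma>"
    using max by (auto simp: planar_def maximal_planar_bipartite_def)
  have inj: "inj_on p V" using d by (simp add: plane_drawing_def)
  interpret G: plane_bipartite "p ` V" "(`) p ` E" "\<lambda>e. \<gamma> (inv_into V p ` e)" "s \<circ> inv_into V p"
    by (rule plane_bipartite_image[OF fin E d col])
  have max': "maximal_planar_bipartite (p ` V) ((`) p ` E)"
    using maximal_planar_bipartite_image[OF inj _ max] E by blast
  have "p ` V \<noteq> {p v}" using v inj by (auto simp: inj_on_def)
  then obtain e where e: "e \<in> (`) p ` E" "p v \<in> e"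
    using G.maximal_no_isolated[OF max', of "p v"] v(1) by blast
  then obtain f where f: "f \<in> E" "e = p ` f" by blast
  then have "v \<in> f" using e(2) E[OF f(1)] v(1) inj by (meson inj_on_image_mem_iff)
  then show ?thesis using that f by blast
qed

lemma maximal_planar_bipartite_edge_count:
  fixes E :: "'v set set" and s :: "'v \<Rightarrow> bool"
  assumes fin: "finite V" and E: "\<And>e. e \<in> E \<Longrightarrow> e \<subseteq> V \<and> card e = 2" and max: "maximal_planar_bipartite V E"
    and col: "\<And>u v. {u, v} \<in> E \<Longrightarrow> s u \<noteq> s v"
    and two: "\<And>v. v \<in> V \<Longrightarrow> \<exists>w\<in>V. w \<noteq> v \<and> s w = s v" and ne: "V \<noteq> {}"
  shows "2 * card V \<le> card E + 4"
proof -
  obtain p \<gamma> where d: "plane_drawing V E p \<gamma>"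
    using max by (auto simp: planar_def maximal_planar_bipartite_def)
  have inj: "inj_on p V" using d by (simp add: plane_drawing_def)
  interpret G: plane_bipartite "p ` V" "(`) p ` E" "\<lambda>e. \<gamma> (inv_into V p ` e)" "s \<circ> inv_into V p"
    by (rule plane_bipartite_image[OF fin E d col])
  have max': "maximal_planar_bipartite (p ` V) ((`) p ` E)"
    using maximal_planar_bipartite_image[OF inj _ max] E by blast
  have "2 * card (p ` V) \<le> card ((`) p ` E) + 4"
  proof (rule G.maximal_edge_count[OF max'])
    show "p ` V \<noteq> {}" using ne by simp
    fix v' assume "v' \<in> p ` V"
    then obtain v where v: "v \<in> V" "v' = p v" by blast
    then obtain w where w: "w \<in> V" "w \<noteq> v" "s w = s v" using two by blast
    then have "p w \<noteq> v'" using v inj by (auto simp: inj_on_def)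
    then show "\<exists>w'\<in>p ` V. w' \<noteq> v' \<and> (s \<circ> inv_into V p) w' = (s \<circ> inv_into V p) v'"
      using w v inv_into_f_f[OF inj] by (intro bexI[of _ "p w"]) auto
  qed
  moreover have "card (p ` V) = card V" using card_image[OF inj] .
  moreover have "card ((`) p ` E) \<le> card E"
    by (rule card_image_le) (rule finite_subset[of _ "Pow V"], use E fin in auto)
  ultimately show ?thesis by linarith
qed

section \<open>Stresses and rigidity\<close>

text \<open>A row of the rigidity matrix: in the block of an end \<open>y\<close> stands the
  position of the other end. The sum over \<open>e - {y}\<close> has a single term and merely names
  that end.\<close>

definition edge_row :: "('v \<Rightarrow> 'k \<Rightarrow> real) \<Rightarrow> 'v set \<Rightarrow> 'v \<times> 'k \<Rightarrow> real" where
  "edge_row pos e = (\<lambda>(y, k). if y \<in> e then \<Sum>z\<in>e - {y}. pos z k else 0)"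

lemma edge_row_doubleton:
  assumes "a \<noteq> b"
  shows "edge_row pos {a, b} (y, k) = (if y = a then pos b k else if y = b then pos a k else 0)"
proof -
  have "{a, b} - {a} = {b}" "{a, b} - {b} = {a}" using assms by auto
  then show ?thesis by (simp add: edge_row_def)
qed

text \<open>Column \<open>(u, k)\<close> of a combination of rows is the k-th coordinate of the
  stress balance at \<open>u\<close>; so relations between the rows are stresses.\<close>

lemma edge_row_sum:
  assumes fin: "finite E" and E: "\<And>e. e \<in> E \<Longrightarrow> card e = 2"
  shows "(\<Sum>e\<in>E. w e * edge_row pos e (u, k)) = (\<Sum>v\<in>{v. {u, v} \<in> E}. w {u, v} * pos v k)"
proof -
  have neq: "u \<noteq> v" if "{u, v} \<in> E" for v using E[OF that] by auto
  have set: "{e \<in> E. u \<in> e} = (\<lambda>v. {u, v}) ` {v. {u, v} \<in> E}"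
  proof (intro equalityI subsetI)
    fix e assume "e \<in> {e \<in> E. u \<in> e}"
    then have e: "e \<in> E" "u \<in> e" by auto
    obtain v where "e = {u, v}" using edge_doubleton[OF E[OF e(1)] e(2)] by blast
    then show "e \<in> (\<lambda>v. {u, v}) ` {v. {u, v} \<in> E}" using e(1) by blast
  qed auto
  have inj: "inj_on (\<lambda>v. {u, v}) {v. {u, v} \<in> E}" by (auto simp: inj_on_def doubleton_eq_iff)
  have "(\<Sum>e\<in>E. w e * edge_row pos e (u, k)) = (\<Sum>e\<in>{e \<in> E. u \<in> e}. w e * edge_row pos e (u, k))"
    by (rule sum.mono_neutral_right) (use fin in \<open>auto simp: edge_row_def\<close>)
  also have "\<dots> = (\<Sum>v\<in>{v. {u, v} \<in> E}. w {u, v} * edge_row pos {u, v} (u, k))"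
    unfolding set by (subst sum.reindex[OF inj]) simp
  also have "\<dots> = (\<Sum>v\<in>{v. {u, v} \<in> E}. w {u, v} * pos v k)"
    by (rule sum.cong) (use neq in \<open>auto simp: edge_row_doubleton\<close>)
  finally show ?thesis .
qed

text \<open>The base case of the induction. A leaf has a single edge, so balance there is the weight
  of this edge times the position of \<open>a\<close>, which is nonzero.\<close>

lemma star_rows_free:
  assumes fin: "finite E" and E: "\<And>e. e \<in> E \<Longrightarrow> card e = 2 \<and> a \<in> e"
  shows "rows_free E UNIV (edge_row (\<lambda>_ (_ :: 2). 1))"
  unfolding rows_free_def
proof (intro allI impI ballI)
  fix w e assume w: "\<forall>c\<in>UNIV. (\<Sum>e\<in>E. w e * edge_row (\<lambda>_ (_ :: 2). 1) e c) = 0" and e: "e \<in> E"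
  obtain b where b: "e = {a, b}" "a \<noteq> b" using edge_doubleton E[OF e] by metis
  have "{v. {b, v} \<in> E} = {a}" using E b e by (fastforce simp: insert_commute)
  then have "(\<Sum>e\<in>E. w e * edge_row (\<lambda>_ (_ :: 2). 1) e (b, 1)) = w {b, a}"
    using edge_row_sum[OF fin, of w "\<lambda>_ (_ :: 2). 1" b 1] E by simp
  then show "w e = 0" using w b by (simp add: insert_commute)
qed

text \<open>Identification adds the block of \<open>v\<close> to the block of \<open>u\<close>,
  provided both are placed at the same point, which is what \<open>pos \<circ> r\<close>
  does.\<close>

lemma edge_row_contract:
  fixes u v :: 'v and pos :: "'v \<Rightarrow> 'k \<Rightarrow> real"
  assumes uv: "u \<noteq> v" and e: "card e = 2" "\<not> {u, v} \<subseteq> e"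
  defines "r \<equiv> id(v := u)"
  shows "y \<noteq> u \<Longrightarrow> y \<noteq> v \<Longrightarrow> edge_row pos (r ` e) (y, k) = edge_row (pos \<circ> r) e (y, k)"
    "edge_row pos (r ` e) (u, k) = edge_row (pos \<circ> r) e (u, k) + edge_row (pos \<circ> r) e (v, k)"
    "edge_row pos (r ` e) (v, k) = 0"
    "card (r ` e) = 2"
proof -
  obtain x z where xz: "e = {x, z}" "x \<noteq> z" using e(1) by (auto simp: card_2_iff)
  have r: "r v = u" "\<And>x. x \<noteq> v \<Longrightarrow> r x = x" by (auto simp: r_def)
  have rxz: "r x \<noteq> r z" using xz e(2) r by (metis insert_commute subset_refl)
  have im: "r ` e = {r x, r z}" using xz by simp
  show "card (r ` e) = 2" using im rxz by simp
  show "edge_row pos (r ` e) (v, k) = 0"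
    unfolding im edge_row_doubleton[OF rxz] using r uv by (metis (full_types))
  show "edge_row pos (r ` e) (y, k) = edge_row (pos \<circ> r) e (y, k)" if "y \<noteq> u" "y \<noteq> v"
    unfolding im edge_row_doubleton[OF rxz] unfolding xz(1) edge_row_doubleton[OF xz(2)]
    using r that by (cases "x = v"; cases "z = v") (auto simp: r)
  show "edge_row pos (r ` e) (u, k) = edge_row (pos \<circ> r) e (u, k) + edge_row (pos \<circ> r) e (v, k)"
    unfolding im edge_row_doubleton[OF rxz] unfolding xz(1) edge_row_doubleton[OF xz(2)]
    using r uv e(2) xz by (cases "x = v"; cases "z = v"; cases "x = u"; cases "z = u") (auto simp: r)
qed

lemma select_two:
  shows "x \<in> E \<Longrightarrow> y \<in> E \<Longrightarrow> {e \<in> E. e = x \<or> e = y} = {x, y}"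
    and "x \<in> E \<Longrightarrow> y \<notin> E \<Longrightarrow> {e \<in> E. e = x \<or> e = y} = {x}"
    and "y \<in> E \<Longrightarrow> x \<notin> E \<Longrightarrow> {e \<in> E. e = x \<or> e = y} = {y}"
  by auto

text \<open>Placing \<open>v\<close> at the position of \<open>u\<close>, every stress of the graph descends to the graph in which the
  two are identified, so it is supported on the common neighbours of \<open>u\<close> and \<open>v\<close>.\<close>

lemma split_rows_free:
  fixes E :: "'v set set" and pos :: "'v \<Rightarrow> 'k \<Rightarrow> real"
  assumes fin: "finite E" and E: "\<And>e. e \<in> E \<Longrightarrow> card e = 2 \<and> \<not> {u, v} \<subseteq> e" and uv: "u \<noteq> v"
    and free: "rows_free (contract_edges (id(v := u)) E) UNIV (edge_row pos)"
    and common: "rows_free {b. {u, b} \<in> E \<and> {v, b} \<in> E} UNIV pos"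
  shows "rows_free E UNIV (edge_row (pos \<circ> id(v := u)))"
  unfolding rows_free_def
proof (intro allI impI)
  define r where "r = id(v := u)"
  have r: "r v = u" "\<And>x. x \<noteq> v \<Longrightarrow> r x = x" by (auto simp: r_def)
  let ?pos = "pos \<circ> r" and ?E = "contract_edges r E" and ?C = "{b. {u, b} \<in> E \<and> {v, b} \<in> E}"
  fix w assume "\<forall>c\<in>UNIV. (\<Sum>e\<in>E. w e * edge_row (pos \<circ> id(v := u)) e c) = 0"
  then have w: "(\<Sum>e\<in>E. w e * edge_row ?pos e (y, k)) = 0" for y k by (simp add: r_def)
  have row1: "edge_row pos (r ` e) (y, k) = edge_row ?pos e (y, k)" if "e \<in> E" "y \<noteq> u" "y \<noteq> v" for e y k
    unfolding r_def by (rule edge_row_contract(1)[OF uv]) (use E[OF that(1)] that in blast)+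
  have row2: "edge_row pos (r ` e) (u, k) = edge_row ?pos e (u, k) + edge_row ?pos e (v, k)" if "e \<in> E" for e k
    unfolding r_def by (rule edge_row_contract(2)[OF uv]) (use E[OF that(1)] in blast)+
  have row3: "edge_row pos (r ` e) (v, k) = 0" if "e \<in> E" for e k
    unfolding r_def by (rule edge_row_contract(3)[OF uv]) (use E[OF that(1)] in blast)+
  have row4: "card (r ` e) = 2" if "e \<in> E" for e
    unfolding r_def by (rule edge_row_contract(4)[OF uv]) (use E[OF that(1)] in blast)+
  have imE: "?E = (`) r ` E" using row4 by (auto simp: contract_edges_def)
  \<comment> \<open>The stress on the identified graph: merged edges carry the sum of their weights.
    It is balanced, hence zero by \<open>free\<close>.\<close>
  define w' where "w' = (\<lambda>f. \<Sum>e\<in>{e \<in> E. r ` e = f}. w e)"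
  have "(\<Sum>f\<in>?E. w' f * edge_row pos f (y, k)) = 0" for y k
  proof -
    have "(\<Sum>f\<in>?E. w' f * edge_row pos f (y, k)) = (\<Sum>f\<in>(`) r ` E. \<Sum>e\<in>{e \<in> E. r ` e = f}. w e * edge_row pos (r ` e) (y, k))"
      unfolding imE w'_def by (simp add: sum_distrib_right)
    also have "\<dots> = (\<Sum>e\<in>E. w e * edge_row pos (r ` e) (y, k))"
      by (rule sum.group[OF fin]) (use fin in auto)
    also have "\<dots> = 0"
    proof -
      consider "y = u" | "y = v" | "y \<noteq> u" "y \<noteq> v" by blast
      then show ?thesis
      proof cases
        case 1
        have "(\<Sum>e\<in>E. w e * edge_row pos (r ` e) (u, k)) = (\<Sum>e\<in>E. w e * edge_row ?pos e (u, k)) + (\<Sum>e\<in>E. w e * edge_row ?pos e (v, k))"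
          by (simp add: row2 distrib_left sum.distrib)
        then show ?thesis using w 1 by simp
      next
        case 2
        then show ?thesis by (simp add: row3)
      next
        case 3
        have "(\<Sum>e\<in>E. w e * edge_row pos (r ` e) (y, k)) = (\<Sum>e\<in>E. w e * edge_row ?pos e (y, k))"
          by (rule sum.cong) (simp_all add: row1 3)
        then show ?thesis using w by simp
      qed
    qed
    finally show ?thesis .
  qed
  then have "\<forall>c\<in>UNIV. (\<Sum>f\<in>?E. w' f * edge_row pos f c) = 0" by auto
  then have "\<forall>f\<in>?E. w' f = 0" using free[folded r_def] unfolding rows_free_def by blast
  then have w'0: "w' (r ` e) = 0" if "e \<in> E" for e using that imE by simp
  have neq: "b \<noteq> u" "b \<noteq> v" if "{u, b} \<in> E \<or> {v, b} \<in> E" for b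
    using that E[of "{u, b}"] E[of "{v, b}"] uv by (auto simp: insert_commute)
  have away: "w e = 0" if e: "e \<in> E" "u \<notin> e" "v \<notin> e" for e
  proof -
    have re: "r ` e = e" using e r by (force simp: image_iff)
    have "{f \<in> E. r ` f = e} = {e}"
    proof -
      have "f = e" if f: "f \<in> E" "r ` f = e" for f
      proof -
        have "v \<notin> f" using f e(2) r(1) by blast
        then have "r ` f = f" using r by (force simp: image_iff)
        then show ?thesis using f by simp
      qed
      then show ?thesis using e re by blast
    qed
    then show ?thesis using w'0[OF e(1)] re by (simp add: w'_def)
  qed
  have pre: "{e \<in> E. r ` e = {u, b}} = {e \<in> E. e = {u, b} \<or> e = {v, b}}" if b: "b \<noteq> u" "b \<noteq> v" for b
  proof -
    have fwd: "e = {u, b} \<or> e = {v, b}" if e: "e \<in> E" "r ` e = {u, b}" for e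
    proof -
      obtain x z where xz: "e = {x, z}" "x \<noteq> z" using E[OF e(1)] by (auto simp: card_2_iff)
      have "{r x, r z} = {u, b}" using e xz by simp
      then show ?thesis using xz r b by (cases "x = v"; cases "z = v") (auto simp: doubleton_eq_iff insert_commute)
    qed
    have "r ` {u, b} = {u, b}" "r ` {v, b} = {u, b}" using r b uv by auto
    then show ?thesis by (intro Collect_cong) (use fwd in metis)
  qed
  \<comment> \<open>A common neighbour is the only place where two edges merge, so only there can
    weights cancel instead of vanishing.\<close>
  have both: "w {u, b} + w {v, b} = 0" if b: "{u, b} \<in> E" "{v, b} \<in> E" for b
  proof -
    have n: "b \<noteq> u" "b \<noteq> v" using neq[of b] b by auto
    have "r ` {u, b} = {u, b}" using r n b uv by auto
    moreover have "{e \<in> E. r ` e = {u, b}} = {{u, b}, {v, b}}"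
      unfolding pre[OF n] by (rule select_two(1)[OF b])
    moreover have "{u, b} \<noteq> {v, b}" using uv n b by (auto simp: doubleton_eq_iff)
    ultimately show ?thesis using w'0[OF b(1)] by (simp add: w'_def)
  qed
  have only_u: "w {u, b} = 0" if b: "{u, b} \<in> E" "{v, b} \<notin> E" for b
  proof -
    have n: "b \<noteq> u" "b \<noteq> v" using neq[of b] b by auto
    have "r ` {u, b} = {u, b}" using r n b uv by auto
    moreover have "{e \<in> E. r ` e = {u, b}} = {{u, b}}"
      unfolding pre[OF n] by (rule select_two(2)[OF b])
    ultimately show ?thesis using w'0[OF b(1)] by (simp add: w'_def)
  qed
  have only_v: "w {v, b} = 0" if b: "{v, b} \<in> E" "{u, b} \<notin> E" for b
  proof -
    have n: "b \<noteq> u" "b \<noteq> v" using neq[of b] b by auto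
    have "r ` {v, b} = {u, b}" using r n b uv by auto
    moreover have "{e \<in> E. r ` e = {u, b}} = {{v, b}}"
      unfolding pre[OF n] by (rule select_two(3)[OF b])
    ultimately show ?thesis using w'0[OF b(1)] by (simp add: w'_def)
  qed
  have finN: "finite {b. {u, b} \<in> E}"
  proof (rule finite_subset)
    show "{b. {u, b} \<in> E} \<subseteq> \<Union>E" by blast
    show "finite (\<Union>E)" using fin E by (intro finite_Union) (auto simp: card_2_iff)
  qed
  have "(\<Sum>b\<in>?C. w {u, b} * pos b k) = 0" for k
  proof -
    have "(\<Sum>b\<in>?C. w {u, b} * pos b k) = (\<Sum>b\<in>?C. w {u, b} * ?pos b k)"
      using neq r by (intro sum.cong) auto
    also have "\<dots> = (\<Sum>b\<in>{b. {u, b} \<in> E}. w {u, b} * ?pos b k)"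
      by (rule sum.mono_neutral_left) (use finN only_u in auto)
    also have "\<dots> = (\<Sum>e\<in>E. w e * edge_row ?pos e (u, k))"
      using edge_row_sum[OF fin, of w ?pos u k] E by simp
    finally show ?thesis using w by simp
  qed
  then have wC: "\<forall>b\<in>?C. w {u, b} = 0" using common[unfolded rows_free_def, rule_format, of "\<lambda>b. w {u, b}"] by blast
  show "\<forall>e\<in>E. w e = 0"
  proof
    fix e assume e: "e \<in> E"
    consider "u \<in> e" | "v \<in> e" | "u \<notin> e" "v \<notin> e" by blast
    then show "w e = 0"
    proof cases
      case 1
      then obtain b where b: "e = {u, b}" using edge_doubleton E[OF e] by metis
      then show ?thesis using e wC only_u by (cases "{v, b} \<in> E") auto
    next
      case 2
      then obtain b where b: "e = {v, b}" using edge_doubleton E[OF e] by metis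
      show ?thesis
      proof (cases "{u, b} \<in> E")
        case True
        then have "w {u, b} = 0" using wC e b by blast
        then show ?thesis using both[of b] True e b by simp
      next
        case False
        then show ?thesis using only_v e b by blast
      qed
    next
      case 3
      then show ?thesis using away e by blast
    qed
  qed
qed

lemma edge_row_polyfun:
  assumes "\<And>v k. v \<in> e \<Longrightarrow> rat_polyfun I (\<lambda>x. pos x v k)"
  shows "rat_polyfun I (\<lambda>x. edge_row (pos x) e c)"
proof -
  obtain y k where c: "c = (y, k)" by (cases c)
  show ?thesis
  proof (cases "y \<in> e")
    case True
    then show ?thesis unfolding c edge_row_def using assms by (auto intro: rat_polyfun_sum)
  next
    case False
    then show ?thesis unfolding c edge_row_def using rat_polyfun_0 by simp
  qed
qed

text \<open>Distinct unit vectors suffice; the bound 2 is the dimension of the space.\<close>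

lemma two_vectors_free:
  fixes C :: "'v set"
  assumes "finite C" "card C \<le> 2"
  obtains pos :: "'v \<Rightarrow> 2 \<Rightarrow> real" where "rows_free C UNIV pos"
proof -
  have "card C \<le> card (UNIV :: 2 set)" using assms by simp
  then obtain f :: "'v \<Rightarrow> 2" where f: "inj_on f C"
    using card_le_inj[OF assms(1), of "UNIV :: 2 set"] by auto
  have "rows_free C UNIV (\<lambda>v k. if k = f v then 1 else 0 :: real)"
    unfolding rows_free_def
  proof (intro allI impI ballI)
    fix w b assume w: "\<forall>c\<in>UNIV. (\<Sum>e\<in>C. w e * (if c = f e then 1 else 0 :: real)) = 0" and b: "b \<in> C"
    have "(\<Sum>e\<in>C. w e * (if f b = f e then 1 else 0)) = (\<Sum>e\<in>C. if e = b then w e else 0)"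
      using f b by (intro sum.cong) (auto simp: inj_on_def)
    also have "\<dots> = w b" using assms(1) b by simp
    finally show "w b = 0" using w by simp
  qed
  then show ?thesis using that by blast
qed

text \<open>Induction on the number of vertices, taken as the union of the edges so that none is
  isolated. The positions given by the induction hypothesis may make the common neighbours of
  \<open>u\<close> and \<open>v\<close> dependent, which is why the position has to be perturbed
  before splitting.\<close>

theorem planar_bipartite_rows_free:
  fixes E :: "'v set set" and s :: "'v \<Rightarrow> bool"
  assumes "finite E" "\<And>e. e \<in> E \<Longrightarrow> card e = 2" "planar (\<Union>E) E" "\<And>u v. {u, v} \<in> E \<Longrightarrow> s u \<noteq> s v"
  shows "\<exists>pos :: 'v \<Rightarrow> 2 \<Rightarrow> real. rows_free E UNIV (edge_row pos)"
  using assms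
proof (induction "card (\<Union>E)" arbitrary: E rule: less_induct)
  case less
  have finV: "finite (\<Union>E)" using less.prems(1,2) by (intro finite_Union) (auto simp: card_2_iff)
  show ?case
  proof (cases "\<exists>a. \<forall>e\<in>E. a \<in> e")
    case True
    then show ?thesis using star_rows_free[OF less.prems(1)] less.prems(2) by blast
  next
    case False
    have EV: "e \<subseteq> \<Union>E \<and> card e = 2" if "e \<in> E" for e using that less.prems(2) by blast
    have nostar: "\<exists>e\<in>E. a \<notin> e" for a using False by blast
    obtain u v where uv: "u \<in> \<Union>E" "v \<in> \<Union>E" "u \<noteq> v" "s u = s v" "card {w. {u, w} \<in> E \<and> {v, w} \<in> E} \<le> 2"
      "planar (\<Union>E - {v}) (contract_edges (id(v := u)) E)"
      by (rule planar_identifiable_pair[of "\<Union>E" E s, OF finV EV less.prems(3,4) refl nostar])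
    define r where "r = id(v := u)"
    have r: "r v = u" "\<And>x. x \<noteq> v \<Longrightarrow> r x = x" by (auto simp: r_def)
    have nuv: "\<not> {u, v} \<subseteq> e" if "e \<in> E" for e
    proof
      assume "{u, v} \<subseteq> e"
      then have "{u, v} = e" using less.prems(2)[OF that] uv(3)
        by (metis card_2_iff card_subset_eq card.infinite zero_neq_numeral)
      then show False using less.prems(4)[of u v] that uv(4) by blast
    qed
    let ?E = "contract_edges r E"
    have rs: "s (r x) = s x" for x using r uv(4) by (cases "x = v") auto
    have subV: "\<Union>?E \<subseteq> \<Union>E - {v}"
    proof
      fix x assume "x \<in> \<Union>?E"
      then obtain e y where "e \<in> E" "y \<in> e" "x = r y" unfolding contract_edges_def by blast
      then show "x \<in> \<Union>E - {v}" using uv r by (cases "y = v") auto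
    qed
    have "card (\<Union>?E) \<le> card (\<Union>E - {v})" using subV finV by (intro card_mono) auto
    also have "\<dots> < card (\<Union>E)" using uv(2) finV by (meson card_Diff1_less)
    finally have smaller: "card (\<Union>?E) < card (\<Union>E)" .
    have finE: "finite ?E" using less.prems(1) by (simp add: contract_edges_def)
    have cardE: "card e = 2" if "e \<in> ?E" for e using that by (simp add: contract_edges_def)
    have plE: "planar (\<Union>?E) ?E"
      using planar_subgraph[OF uv(6)[folded r_def] subV subset_refl] by blast
    have colE: "s x \<noteq> s y" if xy: "{x, y} \<in> ?E" for x y
    proof -
      obtain e where e: "e \<in> E" "{x, y} = r ` e" using xy unfolding contract_edges_def by blast
      obtain x' y' where e': "e = {x', y'}" using less.prems(2)[OF e(1)] by (auto simp: card_2_iff)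
      then have "s x' \<noteq> s y'" using less.prems(4) e(1) by blast
      moreover have "{x, y} = {r x', r y'}" using e e' by simp
      ultimately show ?thesis using rs by (metis doubleton_eq_iff)
    qed
    obtain pos0 :: "'v \<Rightarrow> 2 \<Rightarrow> real" where pos0: "rows_free ?E UNIV (edge_row pos0)"
      using less.hyps[OF smaller finE cardE plE colE] by blast
    let ?C = "{b. {u, b} \<in> E \<and> {v, b} \<in> E}"
    have finC: "finite ?C" by (rule finite_subset[OF _ finV]) blast
    obtain pos1 :: "'v \<Rightarrow> 2 \<Rightarrow> real" where pos1: "rows_free ?C UNIV pos1"
      using two_vectors_free[OF finC uv(5)] .
    let ?P = "\<lambda>(x :: 'v \<times> 2 \<Rightarrow> real) v k. x (v, k)"
    have poly: "rat_polyfun UNIV (\<lambda>x. ?P x v k)" for v k by (rule rat_polyfun_var) simp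
    obtain g where g: "rat_polyfun UNIV g" "g (case_prod pos0) \<noteq> 0"
      "\<And>x. g x \<noteq> 0 \<Longrightarrow> rows_free ?E UNIV (edge_row (?P x))"
      using rows_free_polynomial[OF finE, of UNIV UNIV "\<lambda>x. edge_row (?P x)" "case_prod pos0"]
        edge_row_polyfun[of _ UNIV ?P] poly pos0 by auto
    obtain h where h: "rat_polyfun UNIV h" "h (case_prod pos1) \<noteq> 0"
      "\<And>x. h x \<noteq> 0 \<Longrightarrow> rows_free ?C UNIV (?P x)"
      using rows_free_polynomial[OF finC, of UNIV UNIV ?P "case_prod pos1"] poly pos1 by auto
    \<comment> \<open>\<open>pos0\<close> keeps the rows of the smaller graph independent and
      \<open>pos1\<close> the common neighbours; \<open>x\<close> achieves both at once.\<close>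
    obtain x where x: "g x \<noteq> 0" "h x \<noteq> 0" using rat_polyfun_both_nonzero[OF g(1,2) h(1,2)] .
    have "rows_free E UNIV (edge_row (?P x \<circ> id(v := u)))"
      using split_rows_free[OF less.prems(1) _ uv(3) g(3)[OF x(1), unfolded r_def] h(3)[OF x(2)]]
        less.prems(2) nuv by blast
    then show ?thesis by blast
  qed
qed

text \<open>The four columns of \<open>b1\<close> and \<open>b2\<close> are deleted. If there were
  more rows than remaining columns, some nontrivial combination would vanish on the latter, and the
  four relations satisfied by every row would make it vanish on the deleted columns as well.\<close>

lemma rows_free_count:
  fixes pos :: "'v \<Rightarrow> 2 \<Rightarrow> real"
  assumes fin: "finite A" "finite B" "A \<inter> B = {}" and E: "\<And>e. e \<in> E \<Longrightarrow> \<exists>a\<in>A. \<exists>b\<in>B. e = {a, b}"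
    and free: "rows_free E UNIV (edge_row pos)"
    and b: "b1 \<in> B" "b2 \<in> B" "b1 \<noteq> b2" "pos b1 1 * pos b2 2 \<noteq> pos b1 2 * pos b2 1"
  shows "card E + 4 \<le> 2 * card (A \<union> B)"
proof (rule ccontr)
  assume neg: "\<not> card E + 4 \<le> 2 * card (A \<union> B)"
  let ?C = "(A \<union> B - {b1, b2}) \<times> (UNIV :: 2 set)"
  have finE: "finite E"
  proof (rule finite_subset)
    show "E \<subseteq> Pow (A \<union> B)" using E by blast
  qed (use fin in simp)
  have "card {b1, b2} \<le> card (A \<union> B)" using b fin by (intro card_mono) auto
  then have "card ?C = 2 * (card (A \<union> B) - 2)" "2 \<le> card (A \<union> B)"
    using b fin by (simp_all add: card_cartesian_product card_Diff_subset)
  then have "card ?C < card E" using neg by linarith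
  then obtain w where w: "\<exists>e\<in>E. w e \<noteq> 0" "\<forall>c\<in>?C. (\<Sum>e\<in>E. w e * edge_row pos e c) = 0"
    using underdetermined_solution[of ?C E "edge_row pos"] fin finE by auto
  define col where "col = (\<lambda>y k. \<Sum>e\<in>E. w e * edge_row pos e (y, k))"
  have col0: "col y k = 0" if "y \<in> A \<union> B" "y \<noteq> b1" "y \<noteq> b2" for y k
    using w(2) that by (auto simp: col_def)
  \<comment> \<open>Both sides are the product of coordinate \<open>k\<close> of the end in
    \<open>A\<close> and coordinate \<open>l\<close> of the end in \<open>B\<close>. The four
    choices of \<open>k\<close> and \<open>l\<close> are the trivial motions.\<close>
  have rowAB: "(\<Sum>a\<in>A. pos a k * edge_row pos e (a, l)) = (\<Sum>b\<in>B. pos b l * edge_row pos e (b, k))" if e: "e \<in> E" for e k l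
  proof -
    obtain a0 b0 where ab: "a0 \<in> A" "b0 \<in> B" "e = {a0, b0}" using E[OF e] by blast
    have n: "a0 \<noteq> b0" "b0 \<notin> A" "a0 \<notin> B" using ab fin(3) by auto
    have "(\<Sum>a\<in>A. pos a k * edge_row pos e (a, l)) = (\<Sum>a\<in>A. if a = a0 then pos a0 k * pos b0 l else 0)"
      unfolding ab(3) edge_row_doubleton[OF n(1)] using n by (intro sum.cong) auto
    moreover have "(\<Sum>b\<in>B. pos b l * edge_row pos e (b, k)) = (\<Sum>b\<in>B. if b = b0 then pos a0 k * pos b0 l else 0)"
      unfolding ab(3) edge_row_doubleton[OF n(1)] using n by (intro sum.cong) auto
    ultimately show ?thesis using ab fin by simp
  qed
  have colAB: "(\<Sum>a\<in>A. pos a k * col a l) = (\<Sum>b\<in>B. pos b l * col b k)" for k l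
  proof -
    have "(\<Sum>a\<in>A. pos a k * col a l) = (\<Sum>e\<in>E. w e * (\<Sum>a\<in>A. pos a k * edge_row pos e (a, l)))"
      unfolding col_def sum_distrib_left by (subst sum.swap) (simp add: mult_ac)
    also have "\<dots> = (\<Sum>e\<in>E. w e * (\<Sum>b\<in>B. pos b l * edge_row pos e (b, k)))"
      by (rule sum.cong) (simp_all add: rowAB)
    also have "\<dots> = (\<Sum>b\<in>B. pos b l * col b k)"
      unfolding col_def sum_distrib_left by (subst sum.swap) (simp add: mult_ac)
    finally show ?thesis .
  qed
  have two: "pos b1 l * col b1 k + pos b2 l * col b2 k = 0" for k l
  proof -
    have "(\<Sum>a\<in>A. pos a k * col a l) = 0"
    proof (rule sum.neutral, rule ballI)
      fix a assume "a \<in> A"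
      then have "a \<noteq> b1" "a \<noteq> b2" using b fin(3) by auto
      then show "pos a k * col a l = 0" using col0[of a l] \<open>a \<in> A\<close> by simp
    qed
    moreover have "(\<Sum>b\<in>B. pos b l * col b k) = (\<Sum>b\<in>{b1, b2}. pos b l * col b k)"
      by (rule sum.mono_neutral_right) (use fin b col0 in auto)
    ultimately show ?thesis using colAB[of k l] b(3) by simp
  qed
  have "col b1 k = 0 \<and> col b2 k = 0" for k
  proof -
    \<comment> \<open>Cramer's rule for the 2 x 2 system with the positions of \<open>b1\<close> and
      \<open>b2\<close> as coefficients.\<close>
    let ?d = "pos b1 1 * pos b2 2 - pos b1 2 * pos b2 1"
    have 1: "pos b1 1 * col b1 k + pos b2 1 * col b2 k = 0" and 2: "pos b1 2 * col b1 k + pos b2 2 * col b2 k = 0"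
      using two by auto
    have "?d * col b1 k = pos b2 2 * (pos b1 1 * col b1 k + pos b2 1 * col b2 k) - pos b2 1 * (pos b1 2 * col b1 k + pos b2 2 * col b2 k)"
      by algebra
    moreover have "?d * col b2 k = pos b1 1 * (pos b1 2 * col b1 k + pos b2 2 * col b2 k) - pos b1 2 * (pos b1 1 * col b1 k + pos b2 1 * col b2 k)"
      by algebra
    ultimately have "?d * col b1 k = 0" "?d * col b2 k = 0" unfolding 1 2 by simp_all
    then show ?thesis using b(4) by simp
  qed
  moreover have "col y k = 0" if "y \<notin> A \<union> B" for y k
  proof -
    have "y \<notin> e" if "e \<in> E" for e using E[OF that] \<open>y \<notin> A \<union> B\<close> by blast
    then show ?thesis unfolding col_def by (intro sum.neutral) (simp add: edge_row_def)
  qed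
  ultimately have "col y k = 0" for y k using col0 by metis
  then have "\<forall>c\<in>UNIV. (\<Sum>e\<in>E. w e * edge_row pos e c) = 0" by (auto simp: col_def)
  then have "\<forall>e\<in>E. w e = 0" using free unfolding rows_free_def by blast
  then show False using w(1) by blast
qed

text \<open>Pairing a relation with \<open>\<eta>\<close>, which annihilates the old rows, isolates
  the weight of the new one. In the application \<open>\<eta>\<close> is an infinitesimal motion
  that violates the equation of a missing pair.\<close>

lemma rows_free_insert:
  assumes fin: "finite E" and free: "rows_free E UNIV r" "e0 \<notin> E"
    and \<eta>: "finite C" "\<And>e. e \<in> E \<Longrightarrow> (\<Sum>c\<in>C. \<eta> c * r e c) = 0" "(\<Sum>c\<in>C. \<eta> c * r e0 c) \<noteq> 0"
  shows "rows_free (insert e0 E) UNIV r"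
  unfolding rows_free_def
proof (intro allI impI)
  fix w assume w: "\<forall>c\<in>UNIV. (\<Sum>e\<in>insert e0 E. w e * r e c) = 0"
  have "0 = (\<Sum>c\<in>C. \<eta> c * (\<Sum>e\<in>insert e0 E. w e * r e c))" using w by simp
  also have "\<dots> = (\<Sum>e\<in>insert e0 E. w e * (\<Sum>c\<in>C. \<eta> c * r e c))"
    unfolding sum_distrib_left by (subst sum.swap) (simp add: mult_ac)
  also have "\<dots> = w e0 * (\<Sum>c\<in>C. \<eta> c * r e0 c)" using fin free(2) \<eta>(2) by simp
  finally have w0: "w e0 = 0" using \<eta>(3) by simp
  then have "\<forall>c\<in>UNIV. (\<Sum>e\<in>E. w e * r e c) = 0" using w fin free(2) by simp
  then have "\<forall>e\<in>E. w e = 0" using free(1) unfolding rows_free_def by blast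
  then show "\<forall>e\<in>insert e0 E. w e = 0" using w0 by simp
qed

text \<open>Only the block that may be nonzero is read. As both blocks have the same dimension, the
  two sides share one space and identifications of vertices need not distinguish them.\<close>

definition block_position :: "'v set \<Rightarrow> ('v \<times> ('k + 'k) \<Rightarrow> real) \<Rightarrow> 'v \<Rightarrow> 'k \<Rightarrow> real" where
  "block_position A x v k = (if v \<in> A then x (v, Inl k) else x (v, Inr k))"

lemma block_position_polyfun:
  assumes "v \<in> A \<union> B"
  shows "rat_polyfun (A \<times> range Inl \<union> B \<times> range Inr) (\<lambda>x. block_position A x v k)"
  using assms unfolding block_position_def by (cases "v \<in> A") (auto intro!: rat_polyfun_var)

lemma generic_rows_free:
  fixes \<phi> :: "'v \<Rightarrow> (real^2) \<times> (real^2)"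
  assumes G: "simple_graph (A \<union> B) E" "bipartition (A \<union> B) E A B" "planar (A \<union> B) E"
    and gen: "generic_embedding A B \<phi>"
  shows "rows_free E UNIV (edge_row (block_position A (coordinate \<phi>)))"
proof -
  let ?I = "A \<times> range Inl \<union> B \<times> range Inr :: ('v \<times> (2 + 2)) set"
  have E: "e \<subseteq> A \<union> B" "card e = 2" if "e \<in> E" for e using G(1) that by (auto simp: simple_graph_def)
  have finE: "finite E"
  proof (rule finite_subset)
    show "E \<subseteq> Pow (A \<union> B)" using E by blast
  qed (use G(1) in \<open>simp add: simple_graph_def\<close>)
  have col: "(u \<in> A) \<noteq> (v \<in> A)" if uv: "{u, v} \<in> E" for u v
  proof -
    obtain a b where "a \<in> A" "b \<in> B" "{u, v} = {a, b}" using G(2) uv unfolding bipartition_def by meson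
    then show ?thesis using G(2) by (auto simp: bipartition_def doubleton_eq_iff)
  qed
  have "planar (\<Union>E) E" by (rule planar_subgraph[OF G(3)]) (use E in auto)
  then obtain pos :: "'v \<Rightarrow> 2 \<Rightarrow> real" where pos: "rows_free E UNIV (edge_row pos)"
    using planar_bipartite_rows_free[of E "\<lambda>v. v \<in> A"] finE E(2) col by blast
  define x0 :: "'v \<times> (2 + 2) \<Rightarrow> real" where "x0 = (\<lambda>(v, i). case i of Inl k \<Rightarrow> pos v k | Inr k \<Rightarrow> pos v k)"
  have "block_position A x0 = pos" by (auto simp: block_position_def x0_def fun_eq_iff)
  then have "rows_free E UNIV (edge_row (block_position A x0))" using pos by simp
  moreover have "rat_polyfun ?I (\<lambda>x. edge_row (block_position A x) e c)" if "e \<in> E" for e c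
    by (rule edge_row_polyfun, rule block_position_polyfun) (use E(1)[OF that] in blast)
  ultimately obtain g where g: "rat_polyfun ?I g" "g x0 \<noteq> 0"
    "\<And>x. g x \<noteq> 0 \<Longrightarrow> rows_free E UNIV (edge_row (block_position A x))"
    using rows_free_polynomial[OF finE, of UNIV ?I "\<lambda>x. edge_row (block_position A x)" x0] by blast
  then show ?thesis
    using rat_polyfun_generic[OF g(1,2)] gen unfolding generic_embedding_def by blast
qed

theorem theorem1p5:
  fixes A B :: "'v set" and E :: "'v set set"
    and \<phi> :: "'v \<Rightarrow> (real^2) \<times> (real^2)"
  assumes "simple_graph (A \<union> B) E"
    and "bipartition (A \<union> B) E A B"
    and "planar (A \<union> B) E"
    and "generic_embedding A B \<phi>"
  shows "stress_free (A \<union> B) E \<phi> \<and>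
    (maximal_planar_bipartite (A \<union> B) E \<longrightarrow> bipartite_rigid A B E \<phi>)"
proof
  let ?pos = "block_position A (coordinate \<phi>)"
  let ?I = "A \<times> range Inl \<union> B \<times> range Inr :: ('v \<times> (2 + 2)) set"
  have free: "rows_free E UNIV (edge_row ?pos)" by (rule generic_rows_free[OF assms])
  have fin: "finite (A \<union> B)" "finite A" "finite B" and AB: "A \<inter> B = {}"
    using assms(1,2) by (auto simp: simple_graph_def bipartition_def)
  have EV: "e \<subseteq> A \<union> B \<and> card e = 2" if "e \<in> E" for e using assms(1) that by (auto simp: simple_graph_def)
  have finE: "finite E"
  proof (rule finite_subset)
    show "E \<subseteq> Pow (A \<union> B)" using EV by blast
  qed (use fin in simp)
  have Eab: "\<exists>a\<in>A. \<exists>b\<in>B. e = {a, b}" if "e \<in> E" for e using assms(2) that unfolding bipartition_def by blast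
  have col: "(u \<in> A) \<noteq> (v \<in> A)" if uv: "{u, v} \<in> E" for u v
  proof -
    obtain a b where "a \<in> A" "b \<in> B" "{u, v} = {a, b}" using Eab[OF uv] by blast
    then show ?thesis using AB by (auto simp: doubleton_eq_iff)
  qed
  have posA: "?pos v k = fst (\<phi> v) $ k" if "v \<in> A" for v k using that by (simp add: block_position_def)
  have posB: "?pos v k = snd (\<phi> v) $ k" if "v \<notin> A" for v k using that by (simp add: block_position_def)
  show "stress_free (A \<union> B) E \<phi>"
    unfolding stress_free_def
  proof
    assume "\<exists>w. (\<exists>e\<in>E. w e \<noteq> 0) \<and> (\<forall>u\<in>A \<union> B. (\<Sum>v\<in>{v. {u, v} \<in> E}. w {u, v} *\<^sub>R \<phi> v) = 0)"
    then obtain w where w: "\<exists>e\<in>E. w e \<noteq> 0"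
      "\<And>u. u \<in> A \<union> B \<Longrightarrow> (\<Sum>v\<in>{v. {u, v} \<in> E}. w {u, v} *\<^sub>R \<phi> v) = 0" by blast
    have "(\<Sum>e\<in>E. w e * edge_row ?pos e (u, k)) = 0" for u k
    proof (cases "u \<in> A \<union> B")
      case False
      have "u \<notin> e" if "e \<in> E" for e using EV[OF that] False by blast
      then show ?thesis by (intro sum.neutral) (simp add: edge_row_def)
    next
      case True
      have "(\<Sum>e\<in>E. w e * edge_row ?pos e (u, k)) = (\<Sum>v\<in>{v. {u, v} \<in> E}. w {u, v} * ?pos v k)"
        by (rule edge_row_sum[OF finE]) (use EV in blast)
      also have "\<dots> = 0"
      proof (cases "u \<in> A")
        \<comment> \<open>The neighbours of a vertex of \<open>A\<close> are in \<open>B\<close>, so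
          only the second component of the balance carries information.\<close>
        case uA: True
        have "(\<Sum>v\<in>{v. {u, v} \<in> E}. w {u, v} * ?pos v k) = (\<Sum>v\<in>{v. {u, v} \<in> E}. snd (w {u, v} *\<^sub>R \<phi> v) $ k)"
          using col uA posB by (intro sum.cong) auto
        also have "\<dots> = snd (\<Sum>v\<in>{v. {u, v} \<in> E}. w {u, v} *\<^sub>R \<phi> v) $ k"
          by (simp add: snd_sum sum_component)
        finally show ?thesis using w(2)[OF True] by simp
      next
        case uA: False
        have "(\<Sum>v\<in>{v. {u, v} \<in> E}. w {u, v} * ?pos v k) = (\<Sum>v\<in>{v. {u, v} \<in> E}. fst (w {u, v} *\<^sub>R \<phi> v) $ k)"
          using col uA posA by (intro sum.cong) auto
        also have "\<dots> = fst (\<Sum>v\<in>{v. {u, v} \<in> E}. w {u, v} *\<^sub>R \<phi> v) $ k"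
          by (simp add: fst_sum sum_component)
        finally show ?thesis using w(2)[OF True] by simp
      qed
      finally show ?thesis .
    qed
    then have "\<forall>c\<in>UNIV. (\<Sum>e\<in>E. w e * edge_row ?pos e c) = 0" by auto
    then show False using free w(1) unfolding rows_free_def by blast
  qed
  show "maximal_planar_bipartite (A \<union> B) E \<longrightarrow> bipartite_rigid A B E \<phi>"
  proof
    assume max: "maximal_planar_bipartite (A \<union> B) E"
    \<comment> \<open>If one side is a single vertex, the edge count fails in general; but then the
      graph has no isolated vertices, so every pair of opposite vertices is an edge.\<close>
    have single: "{a, b} \<in> E" if ab: "a \<in> A" "b \<in> B" and one: "A = {a} \<or> B = {b}" for a b
    proof -
      have ne: "a \<noteq> b" using ab AB by blast
      have iso: "\<exists>e\<in>E. v \<in> e" if v: "v \<in> A \<union> B" "A \<union> B \<noteq> {v}" for v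
      proof -
        obtain e where "e \<in> E" "v \<in> e"
          by (rule maximal_planar_bipartite_no_isolated[of "A \<union> B" E "\<lambda>v. v \<in> A" v, OF fin(1) EV max col v])
        then show ?thesis by blast
      qed
      have nab: "A \<union> B \<noteq> {a}" "A \<union> B \<noteq> {b}" using ab ne by auto
      show ?thesis using one
      proof
        assume "A = {a}"
        obtain e where e: "e \<in> E" "b \<in> e" using iso[OF _ nab(2)] ab(2) by blast
        then show ?thesis using Eab[OF e(1)] \<open>A = {a}\<close> ne by auto
      next
        assume "B = {b}"
        obtain e where e: "e \<in> E" "a \<in> e" using iso[OF _ nab(1)] ab(1) by blast
        then show ?thesis using Eab[OF e(1)] \<open>B = {b}\<close> ne by auto
      qed
    qed
    show "bipartite_rigid A B E \<phi>"
      unfolding bipartite_rigid_def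
    proof (intro allI impI ballI, elim conjE)
      fix U :: "'v \<Rightarrow> (real^2) \<times> (real^2)" and a b
      assume UA: "\<forall>a\<in>A. U a \<in> {0} \<times> UNIV" and UB: "\<forall>b\<in>B. U b \<in> UNIV \<times> {0}"
        and UE: "\<forall>a\<in>A. \<forall>b\<in>B. {a, b} \<in> E \<longrightarrow> U a \<bullet> \<phi> b + U b \<bullet> \<phi> a = 0"
        and a: "a \<in> A" and b: "b \<in> B"
      show "U a \<bullet> \<phi> b + U b \<bullet> \<phi> a = 0"
      proof (rule ccontr)
        assume nz: "U a \<bullet> \<phi> b + U b \<bullet> \<phi> a \<noteq> 0"
        then have nE: "{a, b} \<notin> E" using UE a b by blast
        then have "A \<noteq> {a}" "B \<noteq> {b}" using single a b by blast+
        then obtain a' b' where a': "a' \<in> A" "a' \<noteq> a" and b': "b' \<in> B" "b' \<noteq> b" using a b by blast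
        have "\<exists>w\<in>A \<union> B. w \<noteq> v \<and> (w \<in> A) = (v \<in> A)" if "v \<in> A \<union> B" for v
        proof (cases "v \<in> A")
          case True
          then show ?thesis using a a' by (cases "v = a") auto
        next
          case False
          moreover have "b \<notin> A" "b' \<notin> A" using b b' AB by auto
          ultimately show ?thesis using b b' by (cases "v = b") auto
        qed
        then have cnt: "2 * card (A \<union> B) \<le> card E + 4"
          using a by (intro maximal_planar_bipartite_edge_count[of "A \<union> B" E "\<lambda>v. v \<in> A", OF fin(1) EV max col]) auto
        \<comment> \<open>The motion \<open>U\<close>, stripped of its zero blocks, as a vector on
          the columns; pairing it with the row of an edge gives the motion equation of that
          edge.\<close>
        define \<eta> where "\<eta> = (\<lambda>(y, k). if y \<in> A then snd (U y) $ k else fst (U y) $ k)"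
        have val: "(\<Sum>c\<in>(A \<union> B) \<times> UNIV. \<eta> c * edge_row ?pos {x, y} c) = U x \<bullet> \<phi> y + U y \<bullet> \<phi> x"
          if xy: "x \<in> A" "y \<in> B" for x y
        proof -
          have n: "x \<noteq> y" "y \<notin> A" using xy AB by auto
          have U0: "fst (U x) = 0" "snd (U y) = 0" using UA UB xy by (auto simp: mem_Times_iff)
          have "(\<Sum>c\<in>(A \<union> B) \<times> UNIV. \<eta> c * edge_row ?pos {x, y} c)
            = (\<Sum>z\<in>A \<union> B. \<Sum>k\<in>UNIV. \<eta> (z, k) * edge_row ?pos {x, y} (z, k))"
            by (simp add: sum.cartesian_product)
          also have "\<dots> = (\<Sum>z\<in>{x, y}. \<Sum>k\<in>UNIV. \<eta> (z, k) * edge_row ?pos {x, y} (z, k))"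
            by (rule sum.mono_neutral_right) (use fin xy n in \<open>auto simp: edge_row_doubleton\<close>)
          also have "\<dots> = (\<Sum>k\<in>UNIV. snd (U x) $ k * snd (\<phi> y) $ k) + (\<Sum>k\<in>UNIV. fst (U y) $ k * fst (\<phi> x) $ k)"
            using n xy by (simp add: edge_row_doubleton \<eta>_def posA posB)
          also have "\<dots> = U x \<bullet> \<phi> y + U y \<bullet> \<phi> x"
            using U0 by (simp add: inner_prod_def inner_vec_def)
          finally show ?thesis .
        qed
        have free': "rows_free (insert {a, b} E) UNIV (edge_row ?pos)"
        proof (rule rows_free_insert[OF finE free nE, of "(A \<union> B) \<times> UNIV" \<eta>])
          show "finite ((A \<union> B) \<times> (UNIV :: 2 set))" using fin by simp
          show "(\<Sum>c\<in>(A \<union> B) \<times> UNIV. \<eta> c * edge_row ?pos {a, b} c) \<noteq> 0" using val[OF a b] nz by simp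
          fix e assume e: "e \<in> E"
          then obtain x y where xy: "x \<in> A" "y \<in> B" "e = {x, y}" using Eab by blast
          then show "(\<Sum>c\<in>(A \<union> B) \<times> UNIV. \<eta> c * edge_row ?pos e c) = 0"
            using val[OF xy(1,2)] UE e by simp
        qed
        have det: "?pos b 1 * ?pos b' 2 \<noteq> ?pos b 2 * ?pos b' 1"
        proof -
          let ?f = "\<lambda>x. block_position A x b 1 * block_position A x b' 2 - block_position A x b 2 * block_position A x b' 1"
          have poly: "rat_polyfun ?I ?f"
            using b b' by (intro rat_polyfun_diff rat_polyfun_mult block_position_polyfun) auto
          \<comment> \<open>The first unit vector at \<open>b\<close> and the second at
            \<open>b'\<close>, so that the determinant is 1 and hence not the zero
            polynomial.\<close>
          let ?x0 = "\<lambda>(v, i :: 2 + 2). if v = b then (if i = Inr 1 then 1 else 0) else if i = Inr 2 then 1 else 0 :: real"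
          have nA: "b \<notin> A" "b' \<notin> A" using b b' AB by auto
          have "?f ?x0 \<noteq> 0" using nA b' by (simp add: block_position_def)
          then have "?f (coordinate \<phi>) \<noteq> 0"
            using rat_polyfun_generic[OF poly] assms(4) unfolding generic_embedding_def by blast
          then show ?thesis by simp
        qed
        \<comment> \<open>One row too many: \<open>card E + 5\<close> would be at most
          \<open>2 * card (A \<union> B)\<close>, which is at most
          \<open>card E + 4\<close>.\<close>
        have "card (insert {a, b} E) + 4 \<le> 2 * card (A \<union> B)"
          by (rule rows_free_count[OF fin(2,3) AB _ free' b b'(1) _ det]) (use Eab a b b' in auto)
        then show False using cnt nE finE by simp
      qed
    qed
  qed
qed

end
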